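(* Let $L$ be a Haantjes operator on a real even-dimensional manifold $\mathsf M$. Assume that $L$ has no real eigenvalues at any point of $\mathsf M$. Then there exists a unique complex structure $J$ on $\mathsf M$ satisfying the following properties: (C1) $J$ is a polynomial in $L$ with smooth (function) coefficients; in particular $JL=LJ$; (C2) the real part of each eigenvalue of the operator $JL$ is negative.
   Context: An operator (field) is a smooth $(1,1)$-tensor field, viewed as a field of endomorphisms of the tangent spaces. The Nijenhuis torsion of an operator $L$ is $$\mathcal N_L(\xi,\eta)=L^2[\xi,\eta]+[L\xi,L\eta]-L[L\xi,\eta]-L[\xi,L\eta],$$ and its Haantjes torsion is $$\mathcal H_L(\xi,\eta)=L^2\mathcal N_L(\xi,\eta)+\mathcal N_L(L\xi,L\eta)-L\,\mathcal N_L(L\xi,\eta)-L\,\mathcal N_L(\xi,L\eta).$$ $L$ is a Haantjes operator if $\mathcal H_L=0$. A complex structure is an integrable almost complex structure, i.e. an operator $J$ with $J^2=-\mathrm{Id}$ and $\mathcal N_J=0$. *)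

theory Defs
  imports "HOL-Analysis.Analysis" "HOL-Library.Function_Algebras"
begin

text \<open>Pointwise real vector space structure on functions, used both for tangent vectors and
  for fields on a manifold.\<close>

instantiation "fun" :: (type, real_vector) real_vector
begin

definition scaleR_fun :: "real \<Rightarrow> ('a \<Rightarrow> 'b) \<Rightarrow> 'a \<Rightarrow> 'b"
  where "scaleR_fun r f = (\<lambda>x. r *\<^sub>R f x)"

instance
  by standard (simp_all add: scaleR_fun_def fun_eq_iff scaleR_add_right scaleR_add_left)

end

subsection \<open>Smooth functions on open sets\<close>

text \<open>To be used with open \<open>S\<close> and a finite-dimensional domain: \<open>C\<^sup>k\<close> via iterated directional
  derivatives.\<close>

primrec Ck_on :: "nat \<Rightarrow> 'a::real_normed_vector set \<Rightarrow> ('a \<Rightarrow> 'b::real_normed_vector) \<Rightarrow> bool" where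
  "Ck_on 0 S f \<longleftrightarrow> continuous_on S f"
| "Ck_on (Suc k) S f \<longleftrightarrow> (\<forall>x\<in>S. f differentiable (at x)) \<and>
     (\<forall>v. Ck_on k S (\<lambda>x. frechet_derivative f (at x) v))"

definition smooth_on :: "'a::real_normed_vector set \<Rightarrow> ('a \<Rightarrow> 'b::real_normed_vector) \<Rightarrow> bool"
  where "smooth_on S f \<longleftrightarrow> (\<forall>k. Ck_on k S f)"

subsection \<open>Smooth manifolds\<close>

text \<open>A chart is a pair of its domain and its coordinate map; the values of the coordinate map
  outside the domain are irrelevant.\<close>

type_synonym ('a, 'n) chart = "'a set \<times> ('a \<Rightarrow> real ^ 'n)"

definition chart_image :: "('a, 'n::finite) chart \<Rightarrow> (real ^ 'n) set"
  where "chart_image c = snd c ` fst c"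

definition chart_inv :: "('a, 'n::finite) chart \<Rightarrow> real ^ 'n \<Rightarrow> 'a"
  where "chart_inv c = inv_into (fst c) (snd c)"

definition is_chart :: "'a topology \<Rightarrow> ('a, 'n::finite) chart \<Rightarrow> bool"
  where "is_chart X c \<longleftrightarrow> openin X (fst c) \<and> open (chart_image c) \<and>
    homeomorphic_map (subtopology X (fst c)) (top_of_set (chart_image c)) (snd c)"

definition transition :: "('a, 'n::finite) chart \<Rightarrow> ('a, 'n) chart \<Rightarrow> real ^ 'n \<Rightarrow> real ^ 'n"
  where "transition c c' = snd c' \<circ> chart_inv c"

text \<open>The atlas \<open>A\<close> need not be maximal; all notions below depend only on the smooth structure
  it generates.\<close>

definition smooth_manifold :: "'a topology \<Rightarrow> ('a, 'n::finite) chart set \<Rightarrow> bool"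
  where "smooth_manifold X A \<longleftrightarrow>
    Hausdorff_space X \<and> second_countable X \<and>
    (\<forall>c\<in>A. is_chart X c) \<and> \<Union>(fst ` A) = topspace X \<and>
    (\<forall>c\<in>A. \<forall>c'\<in>A. smooth_on (snd c ` (fst c \<inter> fst c')) (transition c c'))"

definition smooth_function :: "('a, 'n::finite) chart set \<Rightarrow> ('a \<Rightarrow> real) \<Rightarrow> bool"
  where "smooth_function A f \<longleftrightarrow> (\<forall>c\<in>A. smooth_on (chart_image c) (f \<circ> chart_inv c))"

subsection \<open>Tangent vectors and vector fields\<close>

text \<open>A tangent vector at \<open>p\<close> is the family of its coordinate vectors in all charts of the atlas
  around \<open>p\<close>, which are related by the Jacobians of the transition maps. To make the
  representation unique, the family is \<open>0\<close> at all other charts.\<close>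

type_synonym ('a, 'n) tangent_vector = "('a, 'n) chart \<Rightarrow> real ^ 'n"

definition tangent_space :: "('a, 'n::finite) chart set \<Rightarrow> 'a \<Rightarrow> ('a, 'n) tangent_vector set"
  where "tangent_space A p = {v.
    (\<forall>c. \<not> (c \<in> A \<and> p \<in> fst c) \<longrightarrow> v c = 0) \<and>
    (\<forall>c\<in>A. \<forall>c'\<in>A. p \<in> fst c \<and> p \<in> fst c' \<longrightarrow>
      v c' = frechet_derivative (transition c c') (at (snd c p)) (v c))}"

text \<open>The tangent vector at \<open>p\<close> with coordinate vector \<open>e\<close> in the chart \<open>c\<close>.\<close>

definition coordinate_vector ::
    "('a, 'n::finite) chart set \<Rightarrow> ('a, 'n) chart \<Rightarrow> real ^ 'n \<Rightarrow> 'a \<Rightarrow> ('a, 'n) tangent_vector"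
  where "coordinate_vector A c e p = (\<lambda>c'.
    if c' \<in> A \<and> p \<in> fst c' then frechet_derivative (transition c c') (at (snd c p)) e else 0)"

text \<open>Coordinate expression in the chart \<open>c\<close> of a vector field.\<close>

definition local_field ::
    "('a, 'n::finite) chart \<Rightarrow> ('a \<Rightarrow> ('a, 'n) tangent_vector) \<Rightarrow> real ^ 'n \<Rightarrow> real ^ 'n"
  where "local_field c \<xi> = (\<lambda>x. \<xi> (chart_inv c x) c)"

definition vector_field ::
    "'a topology \<Rightarrow> ('a, 'n::finite) chart set \<Rightarrow> ('a \<Rightarrow> ('a, 'n) tangent_vector) \<Rightarrow> bool"
  where "vector_field X A \<xi> \<longleftrightarrow>
    (\<forall>p\<in>topspace X. \<xi> p \<in> tangent_space A p) \<and>
    (\<forall>c\<in>A. smooth_on (chart_image c) (local_field c \<xi>))"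

definition lie_bracket ::
    "('a, 'n::finite) chart set \<Rightarrow> ('a \<Rightarrow> ('a, 'n) tangent_vector) \<Rightarrow>
     ('a \<Rightarrow> ('a, 'n) tangent_vector) \<Rightarrow> 'a \<Rightarrow> ('a, 'n) tangent_vector"
  where "lie_bracket A \<xi> \<eta> = (\<lambda>p c.
    if c \<in> A \<and> p \<in> fst c
    then frechet_derivative (local_field c \<eta>) (at (snd c p)) (\<xi> p c)
       - frechet_derivative (local_field c \<xi>) (at (snd c p)) (\<eta> p c)
    else 0)"

subsection \<open>Operator fields and their torsions\<close>

type_synonym ('a, 'n) op_field = "'a \<Rightarrow> ('a, 'n) tangent_vector \<Rightarrow> ('a, 'n) tangent_vector"

text \<open>Smoothness means that the matrix entries of \<open>L\<close> in every chart are smooth.\<close>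

definition operator_field ::
    "'a topology \<Rightarrow> ('a, 'n::finite) chart set \<Rightarrow> ('a, 'n) op_field \<Rightarrow> bool"
  where "operator_field X A L \<longleftrightarrow>
    (\<forall>p\<in>topspace X.
      (\<forall>v\<in>tangent_space A p. L p v \<in> tangent_space A p) \<and>
      (\<forall>v\<in>tangent_space A p. \<forall>w\<in>tangent_space A p. L p (v + w) = L p v + L p w) \<and>
      (\<forall>r. \<forall>v\<in>tangent_space A p. L p (r *\<^sub>R v) = r *\<^sub>R L p v)) \<and>
    (\<forall>c\<in>A. \<forall>e. smooth_on (chart_image c)
      (local_field c (\<lambda>p. L p (coordinate_vector A c e p))))"

definition field_app ::
    "('a, 'n::finite) op_field \<Rightarrow> ('a \<Rightarrow> ('a, 'n) tangent_vector) \<Rightarrow> 'a \<Rightarrow> ('a, 'n) tangent_vector"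
    (infixr "\<star>" 75)
  where "L \<star> \<xi> = (\<lambda>p. L p (\<xi> p))"

definition nijenhuis ::
    "('a, 'n::finite) chart set \<Rightarrow> ('a, 'n) op_field \<Rightarrow> ('a \<Rightarrow> ('a, 'n) tangent_vector) \<Rightarrow>
     ('a \<Rightarrow> ('a, 'n) tangent_vector) \<Rightarrow> 'a \<Rightarrow> ('a, 'n) tangent_vector"
  where "nijenhuis A L \<xi> \<eta> =
    L \<star> L \<star> lie_bracket A \<xi> \<eta> + lie_bracket A (L \<star> \<xi>) (L \<star> \<eta>)
    - L \<star> lie_bracket A (L \<star> \<xi>) \<eta> - L \<star> lie_bracket A \<xi> (L \<star> \<eta>)"

definition haantjes ::
    "('a, 'n::finite) chart set \<Rightarrow> ('a, 'n) op_field \<Rightarrow> ('a \<Rightarrow> ('a, 'n) tangent_vector) \<Rightarrow>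
     ('a \<Rightarrow> ('a, 'n) tangent_vector) \<Rightarrow> 'a \<Rightarrow> ('a, 'n) tangent_vector"
  where "haantjes A L \<xi> \<eta> =
    L \<star> L \<star> nijenhuis A L \<xi> \<eta> + nijenhuis A L (L \<star> \<xi>) (L \<star> \<eta>)
    - L \<star> nijenhuis A L (L \<star> \<xi>) \<eta> - L \<star> nijenhuis A L \<xi> (L \<star> \<eta>)"

definition haantjes_operator ::
    "'a topology \<Rightarrow> ('a, 'n::finite) chart set \<Rightarrow> ('a, 'n) op_field \<Rightarrow> bool"
  where "haantjes_operator X A L \<longleftrightarrow> operator_field X A L \<and>
    (\<forall>\<xi> \<eta>. vector_field X A \<xi> \<longrightarrow> vector_field X A \<eta> \<longrightarrow>
      (\<forall>p\<in>topspace X. haantjes A L \<xi> \<eta> p = 0))"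

definition complex_structure ::
    "'a topology \<Rightarrow> ('a, 'n::finite) chart set \<Rightarrow> ('a, 'n) op_field \<Rightarrow> bool"
  where "complex_structure X A J \<longleftrightarrow> operator_field X A J \<and>
    (\<forall>p\<in>topspace X. \<forall>v\<in>tangent_space A p. J p (J p v) = - v) \<and>
    (\<forall>\<xi> \<eta>. vector_field X A \<xi> \<longrightarrow> vector_field X A \<eta> \<longrightarrow>
      (\<forall>p\<in>topspace X. nijenhuis A J \<xi> \<eta> p = 0))"

subsection \<open>Eigenvalues and polynomials in an operator\<close>

definition real_eigenvalue :: "'v::real_vector set \<Rightarrow> ('v \<Rightarrow> 'v) \<Rightarrow> real \<Rightarrow> bool"
  where "real_eigenvalue V T r \<longleftrightarrow> (\<exists>v\<in>V. v \<noteq> 0 \<and> T v = r *\<^sub>R v)"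

text \<open>Eigenvalue of the complexification of \<open>T\<close>: the eigenvector is \<open>u + \<i> w\<close>, and the equation
  \<open>T u + \<i> T w = z (u + \<i> w)\<close> is split into its real and imaginary parts.\<close>

definition complex_eigenvalue :: "'v::real_vector set \<Rightarrow> ('v \<Rightarrow> 'v) \<Rightarrow> complex \<Rightarrow> bool"
  where "complex_eigenvalue V T z \<longleftrightarrow> (\<exists>u\<in>V. \<exists>w\<in>V. (u \<noteq> 0 \<or> w \<noteq> 0) \<and>
    T u = Re z *\<^sub>R u - Im z *\<^sub>R w \<and> T w = Im z *\<^sub>R u + Re z *\<^sub>R w)"

definition smooth_polynomial_in ::
    "'a topology \<Rightarrow> ('a, 'n::finite) chart set \<Rightarrow> ('a, 'n) op_field \<Rightarrow> ('a, 'n) op_field \<Rightarrow> bool"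
  where "smooth_polynomial_in X A L J \<longleftrightarrow>
    (\<exists>m a. (\<forall>k\<le>m. smooth_function A (a k)) \<and>
      (\<forall>p\<in>topspace X. \<forall>v\<in>tangent_space A p. J p v = (\<Sum>k\<le>m. a k p *\<^sub>R (L p ^^ k) v)))"

end

theory Submission
  imports Defs "HOL-Computational_Algebra.Fundamental_Theorem_Algebra"
begin

text \<open>Over the complexification, \<open>J\<close> must be \<open>\<i>\<close> on the generalised eigenspaces of \<open>L\<close> with eigenvalue
  in the upper half plane and \<open>-\<i>\<close> on the others, which gives uniqueness. Since
  \<open>2/\<pi> \<integral> z / (sin\<^sup>2 \<theta> - cos\<^sup>2 \<theta> z\<^sup>2) d\<theta>\<close> over \<open>0 \<le> \<theta> \<le> \<pi>/2\<close> equals \<open>\<plusminus>\<i>\<close> in the two half planes, \<open>J\<close> is the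
  integral of \<open>2/\<pi> L (sin\<^sup>2 \<theta> - cos\<^sup>2 \<theta> L\<^sup>2)\<^sup>-\<^sup>1\<close>; by Cayley--Hamilton the integrand is a polynomial in \<open>L\<close>
  whose coefficients are rational in those of the characteristic polynomial, so \<open>J\<close> is a polynomial
  in \<open>L\<close> with smooth coefficients. The Haantjes torsion of a polynomial in \<open>L\<close> is obtained from that
  of \<open>L\<close> by an algebraic operator, hence vanishes for \<open>J\<close>, and \<open>J\<^sup>2 = -1\<close> turns \<open>H\<^sub>J = 0\<close> into
  \<open>-4 N\<^sub>J = 0\<close>.\<close>

subsection \<open>Calculus of smooth functions\<close>

text \<open>Projections onto single generalised eigenspaces need not be smooth where eigenvalues
  collide, whereas the coefficients of the characteristic polynomial p always are; hence a
  construction that never names an eigenvalue. The substitution t = tan theta turns the integral of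
  L (t^2 - L^2)^-1 over the half line into one over a compact interval, and homogenising keeps the
  integrand smooth at theta = pi/2. Absence of real eigenvalues keeps the denominators nonzero.

  \<open>L\<close> may have nilpotent parts, so the values i and -i of the sign polynomial g at the
  roots of p do not yet give \<open>J^2 = -1\<close>: p must divide g^2 + 1 with multiplicities.
  This follows from g = i sgn(Im z) + p K off the real axis with K continuous.

  The coefficients of \<open>J\<close> vary with the point, but the terms containing their
  derivatives commute with \<open>J\<close> and drop out of the torsion. The hypothesis concerns
  global vector fields while the algebra uses arbitrary vectors at one point; cut-off fields bridge
  the two. Differentiating \<open>J^2 = -1\<close> leads to N(J u, v) = -J N(u, v), so each of the
  four terms of the Haantjes torsion is -N.\<close>

lemma Ck_on_cong:
  assumes "open S" "\<And>x. x \<in> S \<Longrightarrow> f x = g x"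
  shows "Ck_on k S f \<Longrightarrow> Ck_on k S g"
  using assms(2)
proof (induction k arbitrary: f g)
  case 0
  then show ?case using continuous_on_cong[of S S f g] by simp
next
  case (Suc k)
  have d: "(g has_derivative frechet_derivative f (at x)) (at x)" if "x \<in> S" for x
    using Suc.prems that assms(1)
    by (metis Ck_on.simps(2) frechet_derivative_works has_derivative_transform_within_open)
  then have eq: "frechet_derivative f (at x) = frechet_derivative g (at x)" if "x \<in> S" for x
    using that frechet_derivative_at by blast
  have "Ck_on k S (\<lambda>x. frechet_derivative g (at x) v)" for v
    by (rule Suc.IH[of "\<lambda>x. frechet_derivative f (at x) v"]) (use Suc.prems eq in auto)
  then show ?case using d by (auto simp: differentiable_def)
qed

lemma Ck_on_SucI:
  assumes "open S" "\<And>x. x \<in> S \<Longrightarrow> (f has_derivative f' x) (at x)"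
    "\<And>v. Ck_on k S (\<lambda>x. f' x v)"
  shows "Ck_on (Suc k) S f"
proof -
  have "Ck_on k S (\<lambda>x. frechet_derivative f (at x) v)" for v
    by (rule Ck_on_cong[OF assms(1) _ assms(3)[of v]])
      (use assms(2) frechet_derivative_at in metis)
  then show ?thesis using assms(2) by (auto simp: differentiable_def)
qed

lemma Ck_on_Suc_derivative:
  "Ck_on (Suc k) S f \<Longrightarrow> x \<in> S \<Longrightarrow> (f has_derivative frechet_derivative f (at x)) (at x)"
  by (simp add: frechet_derivative_works)

lemma Ck_on_Suc_imp: "Ck_on (Suc k) S f \<Longrightarrow> Ck_on k S f"
proof (induction k arbitrary: f)
  case 0
  then show ?case
    by (auto intro!: continuous_at_imp_continuous_on differentiable_imp_continuous_within)
next
  case (Suc k)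
  then show ?case using Ck_on.simps(2) by blast
qed

lemma Ck_on_mono: "Ck_on k S f \<Longrightarrow> j \<le> k \<Longrightarrow> Ck_on j S f"
  by (induction k) (auto simp del: Ck_on.simps(2) intro: Ck_on_Suc_imp elim: le_SucE)

lemma Ck_on_imp_continuous_on: "Ck_on k S f \<Longrightarrow> continuous_on S f"
  using Ck_on_mono[of k S f 0] by simp

lemma Ck_on_subset: "Ck_on k S f \<Longrightarrow> T \<subseteq> S \<Longrightarrow> Ck_on k T f"
  by (induction k arbitrary: f) (auto intro: continuous_on_subset)

lemma Ck_on_Union:
  assumes "\<And>S. S \<in> F \<Longrightarrow> open S" "\<And>S. S \<in> F \<Longrightarrow> Ck_on k S f"
  shows "Ck_on k (\<Union>F) f"
  using assms(2)
proof (induction k arbitrary: f)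
  case 0
  then show ?case
    using assms(1) continuous_on_open_UN[of F "\<lambda>x. x" f] by auto
qed auto

lemma Ck_on_const: "open S \<Longrightarrow> Ck_on k S (\<lambda>x. c)"
proof (induction k arbitrary: c)
  case (Suc k)
  show ?case by (rule Ck_on_SucI[where f' = "\<lambda>x v. 0"]) (use Suc in auto)
qed simp

lemma Ck_on_bounded_linear:
  assumes "open S" "bounded_linear l"
  shows "Ck_on k S l"
proof (cases k)
  case 0
  then show ?thesis by (simp add: assms(2) linear_continuous_on)
next
  case (Suc j)
  show ?thesis unfolding Suc
    by (rule Ck_on_SucI[where f' = "\<lambda>x. l"])
      (use assms in \<open>auto intro: Ck_on_const bounded_linear_imp_has_derivative\<close>)
qed

lemma Ck_on_bounded_linear_compose:
  assumes "open S" "bounded_linear l"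
  shows "Ck_on k S f \<Longrightarrow> Ck_on k S (\<lambda>x. l (f x))"
proof (induction k arbitrary: f)
  case 0
  then show ?case using assms(2) by (auto intro: bounded_linear.continuous_on)
next
  case (Suc k)
  show ?case
  proof (rule Ck_on_SucI[where f' = "\<lambda>x v. l (frechet_derivative f (at x) v)"])
    show "Ck_on k S (\<lambda>x. l (frechet_derivative f (at x) v))" for v
      using Suc by simp
  qed (use assms Ck_on_Suc_derivative[OF Suc.prems] in
      \<open>auto intro: bounded_linear.has_derivative\<close>)
qed

lemma Ck_on_add:
  assumes "open S"
  shows "Ck_on k S f \<Longrightarrow> Ck_on k S g \<Longrightarrow> Ck_on k S (\<lambda>x. f x + g x)"
proof (induction k arbitrary: f g)
  case (Suc k)
  show ?case
  proof (rule Ck_on_SucI[where f' = "\<lambda>x v. frechet_derivative f (at x) v + frechet_derivative g (at x) v"])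
    show "((\<lambda>x. f x + g x) has_derivative
      (\<lambda>v. frechet_derivative f (at x) v + frechet_derivative g (at x) v)) (at x)" if "x \<in> S" for x
      using Ck_on_Suc_derivative[OF Suc.prems(1) that] Ck_on_Suc_derivative[OF Suc.prems(2) that]
      by (rule has_derivative_add)
  qed (use assms(1) Suc in simp_all)
qed (auto intro!: continuous_intros)

lemma Ck_on_sum:
  assumes "open S" "\<And>i. i \<in> I \<Longrightarrow> Ck_on k S (f i)"
  shows "Ck_on k S (\<lambda>x. \<Sum>i\<in>I. f i x)"
  using assms(2)
  by (induction I rule: infinite_finite_induct)
    (auto intro: Ck_on_const[OF assms(1)] Ck_on_add[OF assms(1)])

lemma Ck_on_bilinear:
  assumes "open S" "bounded_bilinear b"
  shows "Ck_on k S f \<Longrightarrow> Ck_on k S g \<Longrightarrow> Ck_on k S (\<lambda>x. b (f x) (g x))"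
proof (induction k arbitrary: f g)
  case 0
  then show ?case using assms(2) by (auto intro: bounded_bilinear.continuous_on)
next
  case (Suc k)
  note Ck = Suc.prems[THEN Ck_on_Suc_imp]
  show ?case
  proof (rule Ck_on_SucI[where f' = "\<lambda>x v. b (f x) (frechet_derivative g (at x) v) +
      b (frechet_derivative f (at x) v) (g x)"])
    show "((\<lambda>x. b (f x) (g x)) has_derivative (\<lambda>v. b (f x) (frechet_derivative g (at x) v) +
      b (frechet_derivative f (at x) v) (g x))) (at x)" if "x \<in> S" for x
      using bounded_bilinear.FDERIV[OF assms(2) Ck_on_Suc_derivative[OF Suc.prems(1) that]
          Ck_on_Suc_derivative[OF Suc.prems(2) that]] .
    show "Ck_on k S (\<lambda>x. b (f x) (frechet_derivative g (at x) v) +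
      b (frechet_derivative f (at x) v) (g x))" for v
      using Suc by (intro Ck_on_add assms(1) Suc.IH Ck) simp_all
  qed (rule assms(1))
qed

lemmas Ck_on_scaleR = Ck_on_bilinear[OF _ bounded_bilinear_scaleR]
lemmas Ck_on_mult = Ck_on_bilinear[OF _ bounded_bilinear_mult]

lemma Ck_on_compose:
  fixes f :: "'a::real_normed_vector \<Rightarrow> 'b::euclidean_space"
    and g :: "'b \<Rightarrow> 'c::real_normed_vector"
  assumes "open S" "open T" "f ` S \<subseteq> T"
  shows "Ck_on k S f \<Longrightarrow> Ck_on k T g \<Longrightarrow> Ck_on k S (\<lambda>x. g (f x))"
proof (induction k arbitrary: g)
  case 0
  then show ?case using assms(3) by (auto intro: continuous_on_compose2)
next
  case (Suc k)
  let ?f' = "\<lambda>x. frechet_derivative f (at x)" and ?g' = "\<lambda>y. frechet_derivative g (at y)"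
  have dg: "(g has_derivative ?g' (f x)) (at (f x))" if "x \<in> S" for x
    using Ck_on_Suc_derivative[OF Suc.prems(2)] assms(3) that by blast
  \<comment> \<open>The chain rule evaluates g' in a direction that moves with x, while
    \<open>Ck_on\<close> only controls fixed directions; expanding in a basis separates the two
    dependences.\<close>
  have eq: "(\<Sum>b\<in>Basis. (w \<bullet> b) *\<^sub>R ?g' (f x) b) = ?g' (f x) w" if "x \<in> S" for x w
  proof -
    have "linear (?g' (f x))" using dg[OF that] has_derivative_linear by blast
    then have "?g' (f x) (\<Sum>b\<in>Basis. (w \<bullet> b) *\<^sub>R b) = (\<Sum>b\<in>Basis. (w \<bullet> b) *\<^sub>R ?g' (f x) b)"
      by (simp add: linear_sum linear_scale)
    then show ?thesis by (simp add: euclidean_representation)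
  qed
  show ?case
  proof (rule Ck_on_SucI[where f' = "\<lambda>x v. ?g' (f x) (?f' x v)"])
    show "((\<lambda>x. g (f x)) has_derivative (\<lambda>v. ?g' (f x) (?f' x v))) (at x)" if "x \<in> S" for x
      using has_derivative_compose[OF Ck_on_Suc_derivative[OF Suc.prems(1) that] dg[OF that]] .
    have f': "Ck_on k S (\<lambda>x. ?f' x v \<bullet> b)" for v b
      by (rule Ck_on_bounded_linear_compose[OF assms(1) bounded_linear_inner_left])
        (use Suc.prems(1) in simp)
    have g': "Ck_on k S (\<lambda>x. ?g' (f x) b)" for b
      by (rule Suc.IH[OF Ck_on_Suc_imp[OF Suc.prems(1)]]) (use Suc.prems(2) in simp)
    have sum: "Ck_on k S (\<lambda>x. \<Sum>b\<in>Basis. (?f' x v \<bullet> b) *\<^sub>R ?g' (f x) b)" for v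
      by (rule Ck_on_sum[OF assms(1)], rule Ck_on_scaleR[OF assms(1) f' g'])
    show "Ck_on k S (\<lambda>x. ?g' (f x) (?f' x v))" for v
      by (rule Ck_on_cong[OF assms(1) _ sum]) (rule eq)
  qed (rule assms(1))
qed

lemma Ck_on_inverse:
  fixes f :: "'a::real_normed_vector \<Rightarrow> real"
  assumes "open S" "\<And>x. x \<in> S \<Longrightarrow> f x \<noteq> 0"
  shows "Ck_on k S f \<Longrightarrow> Ck_on k S (\<lambda>x. inverse (f x))"
proof (induction k)
  case 0
  then show ?case using assms by (auto intro!: continuous_intros)
next
  case (Suc k)
  let ?f' = "\<lambda>x. frechet_derivative f (at x)"
  note Ck = Ck_on_Suc_imp[OF Suc.prems]
  show ?case
  proof (rule Ck_on_SucI[where f' = "\<lambda>x v. (- 1) * (inverse (f x) * ?f' x v * inverse (f x))"])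
    show "((\<lambda>x. inverse (f x)) has_derivative (\<lambda>v. (- 1) * (inverse (f x) * ?f' x v * inverse (f x)))) (at x)"
      if "x \<in> S" for x
      using Deriv.has_derivative_inverse[OF assms(2)[OF that] Ck_on_Suc_derivative[OF Suc.prems that]] by simp
    show "Ck_on k S (\<lambda>x. (- 1) * (inverse (f x) * ?f' x v * inverse (f x)))" for v
      using Suc Ck by (intro Ck_on_mult assms(1) Ck_on_const) auto
  qed (rule assms(1))
qed

text \<open>The derivative of each function involves the other one, so a single induction carries
  both.\<close>

lemma Ck_on_sin_cos:
  fixes f :: "'a::real_normed_vector \<Rightarrow> real"
  assumes "open S"
  shows "Ck_on k S f \<Longrightarrow> Ck_on k S (\<lambda>x. sin (f x)) \<and> Ck_on k S (\<lambda>x. cos (f x))"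
proof (induction k)
  case 0
  then show ?case by (auto intro!: continuous_intros)
next
  case (Suc k)
  let ?f' = "\<lambda>x. frechet_derivative f (at x)"
  note IH = Suc.IH[OF Ck_on_Suc_imp[OF Suc.prems]]
  have "Ck_on (Suc k) S (\<lambda>x. sin (f x))"
  proof (rule Ck_on_SucI[where f' = "\<lambda>x v. ?f' x v * cos (f x)"])
    show "((\<lambda>x. sin (f x)) has_derivative (\<lambda>v. ?f' x v * cos (f x))) (at x)" if "x \<in> S" for x
      using has_derivative_sin[OF Ck_on_Suc_derivative[OF Suc.prems that]] by (simp add: mult.commute)
    show "Ck_on k S (\<lambda>x. ?f' x v * cos (f x))" for v
      using Suc.prems IH by (intro Ck_on_mult assms(1)) auto
  qed (rule assms(1))
  moreover have "Ck_on (Suc k) S (\<lambda>x. cos (f x))"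
  proof (rule Ck_on_SucI[where f' = "\<lambda>x v. (- 1) * (?f' x v * sin (f x))"])
    show "((\<lambda>x. cos (f x)) has_derivative (\<lambda>v. (- 1) * (?f' x v * sin (f x)))) (at x)" if "x \<in> S" for x
      using has_derivative_cos[OF Ck_on_Suc_derivative[OF Suc.prems that]] by (simp add: mult.commute)
    show "Ck_on k S (\<lambda>x. (- 1) * (?f' x v * sin (f x)))" for v
      using Suc.prems IH by (intro Ck_on_mult assms(1) Ck_on_const) auto
  qed (rule assms(1))
  ultimately show ?case by blast
qed

section \<open>Differentiation under the integral sign\<close>

lemma frechet_derivative_partial_snd:
  assumes "(f has_derivative f') (at (t, x))"
  shows "((\<lambda>x. f (t, x)) has_derivative (\<lambda>v. f' (0, v))) (at x)"
proof -
  have "((\<lambda>x. (t, x)) has_derivative (\<lambda>v. (0, v))) (at x)"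
    by (auto intro!: derivative_eq_intros)
  from has_derivative_compose[OF this assms] show ?thesis .
qed

lemma continuous_on_prod_swap:
  assumes "continuous_on (UNIV \<times> S) f"
  shows "continuous_on (S \<times> T) (\<lambda>(x, t). f (t, x))"
proof -
  have "continuous_on (S \<times> T) (\<lambda>p. f (snd p, fst p))"
    by (rule continuous_on_compose2[OF assms]) (auto intro!: continuous_intros)
  then show ?thesis by (simp add: split_beta)
qed

lemma Ck_on_integral:
  fixes f :: "real \<times> 'a::euclidean_space \<Rightarrow> 'b::banach"
  assumes "open S"
  shows "Ck_on k (UNIV \<times> S) f \<Longrightarrow> Ck_on k S (\<lambda>x. integral {a..b} (\<lambda>t. f (t, x)))"
proof (induction k arbitrary: f)
  case 0
  then have "continuous_on (S \<times> cbox a b) (\<lambda>(x, t). f (t, x))"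
    by (simp add: continuous_on_prod_swap)
  then show ?case using integral_continuous_on_param[of S a b "\<lambda>x t. f (t, x)"] by simp
next
  case (Suc k)
  let ?f' = "\<lambda>y. frechet_derivative f (at y)"
  let ?D = "\<lambda>x t v. ?f' (t, x) (0, v)"
  have d: "((\<lambda>x. f (t, x)) has_derivative ?D x t) (at x)" if "x \<in> S" for x t
    by (rule frechet_derivative_partial_snd, rule Ck_on_Suc_derivative[OF Suc.prems]) (use that in auto)
  have cf: "continuous_on (UNIV \<times> S) f"
    using Suc.prems Ck_on_imp_continuous_on by blast
  have cD: "continuous_on (UNIV \<times> S) (\<lambda>y. ?f' y w)" for w
    using Suc.prems Ck_on_imp_continuous_on Ck_on.simps(2) by blast
  \<comment> \<open>\<open>leibniz_rule\<close> asks for the derivative as a continuous family of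
    bounded linear maps. The value 0 outside S is only a default.\<close>
  define fx where "fx x t = (if x \<in> S then Blinfun (?D x t) else 0)" for x t
  have fx: "blinfun_apply (fx x t) = ?D x t" if "x \<in> S" for x t
    using d[OF that, of t] that by (simp add: fx_def bounded_linear_Blinfun_apply has_derivative_bounded_linear)
  have cfx: "continuous_on (S \<times> cbox a b) (\<lambda>(x, t). fx x t)"
  proof (rule continuous_on_blinfun_componentwise)
    fix i :: 'a
    have "continuous_on (S \<times> cbox a b) (\<lambda>(x, t). ?D x t i)"
      by (rule continuous_on_prod_swap[OF cD])
    then show "continuous_on (S \<times> cbox a b) (\<lambda>y. (case y of (x, t) \<Rightarrow> fx x t) i)"
      by (rule continuous_on_eq) (auto simp: fx)
  qed
  have D: "((\<lambda>x. integral {a..b} (\<lambda>t. f (t, x))) has_derivative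
      (\<lambda>v. integral {a..b} (\<lambda>t. ?D x t v))) (at x)" if x: "x \<in> S" for x
  proof -
    \<comment> \<open>\<open>leibniz_rule\<close> needs a convex parameter set, hence the
      restriction to a ball.\<close>
    obtain e where e: "e > 0" "ball x e \<subseteq> S" using \<open>open S\<close> x open_contains_ball by blast
    have "((\<lambda>x. integral (cbox a b) (\<lambda>t. f (t, x))) has_derivative
        integral (cbox a b) (fx x)) (at x within ball x e)"
    proof (rule leibniz_rule)
      show "((\<lambda>x. f (t, x)) has_derivative blinfun_apply (fx y t)) (at y within ball x e)"
        if "y \<in> ball x e" for y t
        using d[of y t] fx[of y t] that e(2) by (metis has_derivative_at_withinI subsetD)
      show "(\<lambda>t. f (t, y)) integrable_on cbox a b" if "y \<in> ball x e" for y
        by (rule integrable_continuous, rule continuous_on_compose2[OF cf])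
          (use that e(2) in \<open>auto intro!: continuous_intros\<close>)
      show "continuous_on (ball x e \<times> cbox a b) (\<lambda>(x, t). fx x t)"
        by (rule continuous_on_subset[OF cfx]) (use e(2) in auto)
    qed (use e(1) in auto)
    then have *: "((\<lambda>x. integral {a..b} (\<lambda>t. f (t, x))) has_derivative
        integral (cbox a b) (fx x)) (at x)"
      using e(1) by (simp add: at_within_open[of x "ball x e"])
    have "continuous_on (cbox a b) (\<lambda>t. case (x, t) of (x, t) \<Rightarrow> fx x t)"
      by (rule continuous_on_compose2[OF cfx]) (use x in \<open>auto intro!: continuous_intros\<close>)
    then have "fx x integrable_on cbox a b"
      by (intro integrable_continuous) simp
    then have "blinfun_apply (integral (cbox a b) (fx x)) v = integral {a..b} (\<lambda>t. ?D x t v)" for v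
      using fx[OF x] by (simp add: blinfun_apply_integral)
    then show ?thesis by (intro has_derivative_eq_rhs[OF *]) auto
  qed
  show ?case
  proof (rule Ck_on_SucI[OF assms D])
    show "Ck_on k S (\<lambda>x. integral {a..b} (\<lambda>t. ?D x t v))" for v
      using Suc.IH[of "\<lambda>y. ?f' y (0, v)"] Suc.prems by simp
  qed
qed

lemma smooth_on_derivative:
  "smooth_on S f \<Longrightarrow> x \<in> S \<Longrightarrow> (f has_derivative frechet_derivative f (at x)) (at x)"
  unfolding smooth_on_def using Ck_on_Suc_derivative by blast

lemma smooth_on_frechet_derivative:
  "smooth_on S f \<Longrightarrow> smooth_on S (\<lambda>x. frechet_derivative f (at x) v)"
  unfolding smooth_on_def using Ck_on.simps(2) by blast

lemma smooth_on_imp_continuous_on: "smooth_on S f \<Longrightarrow> continuous_on S f"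
  unfolding smooth_on_def using Ck_on.simps(1) by blast

lemma smooth_on_cong:
  "open S \<Longrightarrow> (\<And>x. x \<in> S \<Longrightarrow> f x = g x) \<Longrightarrow> smooth_on S f \<Longrightarrow> smooth_on S g"
  unfolding smooth_on_def by (metis Ck_on_cong)

lemma smooth_on_subset: "smooth_on S f \<Longrightarrow> T \<subseteq> S \<Longrightarrow> smooth_on T f"
  unfolding smooth_on_def using Ck_on_subset by blast

lemma smooth_on_Un:
  assumes "open S" "open T" "smooth_on S f" "smooth_on T f"
  shows "smooth_on (S \<union> T) f"
  using Ck_on_Union[of "{S, T}" _ f] assms unfolding smooth_on_def by auto

lemma smooth_on_const: "open S \<Longrightarrow> smooth_on S (\<lambda>x. c)"
  unfolding smooth_on_def using Ck_on_const by blast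

lemma smooth_on_bounded_linear: "open S \<Longrightarrow> bounded_linear l \<Longrightarrow> smooth_on S l"
  unfolding smooth_on_def using Ck_on_bounded_linear by blast

lemma smooth_on_bounded_linear_compose:
  "open S \<Longrightarrow> bounded_linear l \<Longrightarrow> smooth_on S f \<Longrightarrow> smooth_on S (\<lambda>x. l (f x))"
  unfolding smooth_on_def using Ck_on_bounded_linear_compose by blast

lemma smooth_on_add: "open S \<Longrightarrow> smooth_on S f \<Longrightarrow> smooth_on S g \<Longrightarrow> smooth_on S (\<lambda>x. f x + g x)"
  unfolding smooth_on_def by (intro allI Ck_on_add) simp_all

lemma smooth_on_sum:
  "open S \<Longrightarrow> (\<And>i. i \<in> I \<Longrightarrow> smooth_on S (f i)) \<Longrightarrow> smooth_on S (\<lambda>x. \<Sum>i\<in>I. f i x)"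
  unfolding smooth_on_def by (intro allI Ck_on_sum) simp_all

lemma smooth_on_scaleR:
  "open S \<Longrightarrow> smooth_on S f \<Longrightarrow> smooth_on S g \<Longrightarrow> smooth_on S (\<lambda>x. f x *\<^sub>R g x)"
  unfolding smooth_on_def by (intro allI Ck_on_scaleR) simp_all

lemma smooth_on_mult:
  fixes f g :: "'a::real_normed_vector \<Rightarrow> real"
  shows "open S \<Longrightarrow> smooth_on S f \<Longrightarrow> smooth_on S g \<Longrightarrow> smooth_on S (\<lambda>x. f x * g x)"
  unfolding smooth_on_def by (intro allI Ck_on_mult) simp_all

lemma smooth_on_power:
  fixes f :: "'a::real_normed_vector \<Rightarrow> real"
  shows "open S \<Longrightarrow> smooth_on S f \<Longrightarrow> smooth_on S (\<lambda>x. f x ^ k)"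
  by (induction k) (auto intro: smooth_on_const smooth_on_mult)

lemma smooth_on_uminus: "open S \<Longrightarrow> smooth_on S f \<Longrightarrow> smooth_on S (\<lambda>x. - f x)"
  using smooth_on_bounded_linear_compose[of S uminus f] bounded_linear_minus[OF bounded_linear_ident] by blast

lemma smooth_on_diff:
  "open S \<Longrightarrow> smooth_on S f \<Longrightarrow> smooth_on S g \<Longrightarrow> smooth_on S (\<lambda>x. f x - g x)"
  using smooth_on_add[of S f "\<lambda>x. - g x"] smooth_on_uminus by auto

lemma smooth_on_compose:
  fixes f :: "'a::real_normed_vector \<Rightarrow> 'b::euclidean_space"
    and g :: "'b \<Rightarrow> 'c::real_normed_vector"
  shows "open S \<Longrightarrow> open T \<Longrightarrow> f ` S \<subseteq> T \<Longrightarrow> smooth_on S f \<Longrightarrow> smooth_on T g \<Longrightarrow>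
    smooth_on S (\<lambda>x. g (f x))"
  unfolding smooth_on_def by (metis Ck_on_compose)

lemma smooth_on_inverse:
  fixes f :: "'a::real_normed_vector \<Rightarrow> real"
  assumes "open S" "\<And>x. x \<in> S \<Longrightarrow> f x \<noteq> 0" "smooth_on S f"
  shows "smooth_on S (\<lambda>x. inverse (f x))"
  unfolding smooth_on_def
  by (rule allI, rule Ck_on_inverse[OF assms(1,2)]) (use assms(3) in \<open>simp_all add: smooth_on_def\<close>)

lemma smooth_on_integral:
  fixes f :: "real \<times> 'a::euclidean_space \<Rightarrow> 'b::banach"
  shows "open S \<Longrightarrow> smooth_on (UNIV \<times> S) f \<Longrightarrow> smooth_on S (\<lambda>x. integral {a..b} (\<lambda>t. f (t, x)))"
  unfolding smooth_on_def using Ck_on_integral by blast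

lemma smooth_on_sin:
  fixes f :: "'a::real_normed_vector \<Rightarrow> real"
  shows "open S \<Longrightarrow> smooth_on S f \<Longrightarrow> smooth_on S (\<lambda>x. sin (f x))"
  unfolding smooth_on_def using Ck_on_sin_cos by blast

lemma smooth_on_cos:
  fixes f :: "'a::real_normed_vector \<Rightarrow> real"
  shows "open S \<Longrightarrow> smooth_on S f \<Longrightarrow> smooth_on S (\<lambda>x. cos (f x))"
  unfolding smooth_on_def using Ck_on_sin_cos by blast

subsection \<open>Polynomials in a linear operator\<close>

definition poly_op :: "real poly \<Rightarrow> ('v::real_vector \<Rightarrow> 'v) \<Rightarrow> 'v \<Rightarrow> 'v"
  where "poly_op p T v = (\<Sum>k\<le>degree p. coeff p k *\<^sub>R (T ^^ k) v)"

lemma linear_funpow: "linear T \<Longrightarrow> linear (T ^^ k)" for T :: "'v::real_vector \<Rightarrow> 'v"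
  by (induction k) (auto intro: linear_compose module_hom_id linear_id simp: linear_id[unfolded id_def])

lemma poly_op_eq_sum: "degree p \<le> n \<Longrightarrow> poly_op p T v = (\<Sum>k\<le>n. coeff p k *\<^sub>R (T ^^ k) v)"
  unfolding poly_op_def by (rule sum.mono_neutral_left) (auto simp: coeff_eq_0)

lemma poly_op_0 [simp]: "poly_op 0 T v = 0"
  by (simp add: poly_op_def)

lemma poly_op_1 [simp]: "poly_op 1 T v = v"
  by (simp add: poly_op_def)

lemma poly_op_pCons:
  assumes "linear T"
  shows "poly_op (pCons a p) T v = a *\<^sub>R v + T (poly_op p T v)"
proof -
  have "poly_op (pCons a p) T v = (\<Sum>k\<le>Suc (degree p). coeff (pCons a p) k *\<^sub>R (T ^^ k) v)"
    by (rule poly_op_eq_sum) (simp add: degree_pCons_le)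
  also have "\<dots> = a *\<^sub>R v + (\<Sum>k\<le>degree p. coeff p k *\<^sub>R T ((T ^^ k) v))"
    by (simp add: sum.atMost_Suc_shift del: sum.atMost_Suc)
  also have "(\<Sum>k\<le>degree p. coeff p k *\<^sub>R T ((T ^^ k) v)) = T (poly_op p T v)"
    unfolding poly_op_def by (simp add: linear_sum[OF assms] linear_scale[OF assms])
  finally show ?thesis .
qed

lemma linear_poly_op: "linear T \<Longrightarrow> linear (poly_op p T)"
  unfolding poly_op_def by (intro linear_compose_sum linear_compose_scale_right linear_funpow ballI)

lemma poly_op_commute: "linear T \<Longrightarrow> T (poly_op p T v) = poly_op p T (T v)"
  by (induction p) (simp_all add: linear_0 poly_op_pCons linear_add linear_scale)

lemma poly_op_add: "linear T \<Longrightarrow> poly_op (p + q) T v = poly_op p T v + poly_op q T v"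
  by (induction p q rule: poly_induct2) (simp_all add: poly_op_pCons linear_add algebra_simps)

lemma poly_op_smult: "linear T \<Longrightarrow> poly_op (smult a p) T v = a *\<^sub>R poly_op p T v"
  by (induction p) (simp_all add: poly_op_pCons linear_scale algebra_simps)

lemma poly_op_minus: "linear T \<Longrightarrow> poly_op (- p) T v = - poly_op p T v"
  using poly_op_smult[of T "-1" p v] by simp

lemma poly_op_diff: "linear T \<Longrightarrow> poly_op (p - q) T v = poly_op p T v - poly_op q T v"
  using poly_op_add[of T p "- q" v] by (simp add: poly_op_minus)

lemma poly_op_mult: "linear T \<Longrightarrow> poly_op (p * q) T v = poly_op p T (poly_op q T v)"
  by (induction p) (simp_all add: poly_op_pCons poly_op_add poly_op_smult linear_0)

lemma poly_op_sum: "linear T \<Longrightarrow> poly_op (\<Sum>i\<in>I. p i) T v = (\<Sum>i\<in>I. poly_op (p i) T v)"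
  by (induction I rule: infinite_finite_induct) (auto simp: poly_op_add)

lemma poly_op_mult_commute: "linear T \<Longrightarrow> poly_op p T (poly_op q T v) = poly_op q T (poly_op p T v)"
  by (metis mult.commute poly_op_mult)

lemma poly_op_dvd_0:
  assumes "linear T" "p dvd q" "poly_op p T v = 0"
  shows "poly_op q T v = 0"
proof -
  obtain r where "q = r * p" using assms(2) by (metis dvdE mult.commute)
  then show ?thesis
    using assms by (simp add: poly_op_mult linear_0[OF linear_poly_op])
qed

text \<open>Division with remainder by an annihilator of least degree. The annihilator is that of
  the single vector \<open>v\<close>, so it divides every polynomial killing \<open>v\<close>; its
  positive degree provides a complex root, that is, an eigenvalue reached from
  \<open>v\<close>.\<close>

lemma minimal_annihilator:
  fixes T :: "'v::real_vector \<Rightarrow> 'v"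
  assumes "linear T" "v \<noteq> 0" "p \<noteq> 0" "poly_op p T v = 0"
  obtains m where "degree m > 0" "poly_op m T v = 0" "\<And>q. poly_op q T v = 0 \<Longrightarrow> m dvd q"
proof -
  define P where "P m \<longleftrightarrow> m \<noteq> 0 \<and> poly_op m T v = 0" for m
  obtain m where m: "P m" and min: "\<And>q. P q \<Longrightarrow> degree m \<le> degree q"
    using arg_min_nat_lemma[of P p degree] assms(3,4) unfolding P_def by blast
  have "m dvd q" if "poly_op q T v = 0" for q
  proof -
    have "poly_op (q mod m) T v = 0"
      using that m assms(1) poly_op_diff[of T q "q div m * m" v]
      by (simp add: P_def poly_op_mult linear_0[OF linear_poly_op] minus_div_mult_eq_mod)
    moreover have "\<not> degree m \<le> degree (q mod m)" if "q mod m \<noteq> 0"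
      using that m degree_mod_less'[of m q] by (simp add: P_def)
    ultimately have "q mod m = 0"
      using min[of "q mod m"] by (auto simp: P_def)
    then show ?thesis by auto
  qed
  moreover have "degree m > 0"
  proof (rule ccontr)
    assume "\<not> degree m > 0"
    then obtain c where "m = [:c:]" by (auto elim: degree_eq_zeroE)
    then show False using m assms(1,2) by (auto simp: P_def poly_op_pCons linear_0)
  qed
  ultimately show ?thesis using m that by (auto simp: P_def)
qed

section \<open>Real polynomials viewed over the complex numbers\<close>

abbreviation cpoly :: "real poly \<Rightarrow> complex poly"
  where "cpoly \<equiv> map_poly complex_of_real"

lemma cpoly_pCons: "cpoly (pCons a p) = pCons (of_real a) (cpoly p)"
  by (simp add: map_poly_pCons)

lemma cpoly_add: "cpoly (p + q) = cpoly p + cpoly q"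
  by (simp add: poly_eq_iff coeff_map_poly)

lemma cpoly_smult: "cpoly (smult a p) = smult (of_real a) (cpoly p)"
  by (simp add: poly_eq_iff coeff_map_poly)

lemma cpoly_mult: "cpoly (p * q) = cpoly p * cpoly q"
  by (induction p) (simp_all add: cpoly_add cpoly_smult cpoly_pCons)

lemma cpoly_diff: "cpoly (p - q) = cpoly p - cpoly q"
  by (simp add: poly_eq_iff coeff_map_poly)

lemma cpoly_root_dvd: "p dvd q \<Longrightarrow> poly (cpoly p) z = 0 \<Longrightarrow> poly (cpoly q) z = 0"
  by (auto simp: cpoly_mult elim!: dvdE)

lemma degree_cpoly [simp]: "degree (cpoly p) = degree p"
  by (simp add: degree_map_poly)

lemma cpoly_eq_0_iff [simp]: "cpoly p = 0 \<longleftrightarrow> p = 0"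
  by (simp add: poly_eq_iff coeff_map_poly)

lemma poly_cpoly_of_real: "poly (cpoly p) (of_real x) = of_real (poly p x)"
  by (induction p) (simp_all add: cpoly_pCons)

lemma cpoly_root_exists: "degree p > 0 \<Longrightarrow> \<exists>z. poly (cpoly p) z = 0"
  using alg_closed_imp_poly_has_root[of "cpoly p"] by simp

text \<open>The remainder of the real division is a complex multiple of p of smaller degree, hence
  zero. Divisibility can therefore be tested over the complex numbers, where growth near the roots
  decides it.\<close>

lemma dvd_cpolyD:
  assumes "cpoly p dvd cpoly q" "p \<noteq> 0"
  shows "p dvd q"
proof -
  have "cpoly q = cpoly (q div p) * cpoly p + cpoly (q mod p)"
    by (metis cpoly_add cpoly_mult div_mult_mod_eq)
  then have "cpoly p dvd cpoly (q mod p)"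
    using assms(1) by (metis dvd_add_right_iff dvd_triv_right)
  then have "q mod p = 0"
    using dvd_imp_degree_le[of "cpoly p" "cpoly (q mod p)"] degree_mod_less'[OF assms(2), of q]
    by fastforce
  then show ?thesis by auto
qed

text \<open>This is (x - z)(x - conj z), the real minimal polynomial of a nonreal z.\<close>

definition quadratic_factor :: "complex \<Rightarrow> real poly"
  where "quadratic_factor z = [:(Re z)\<^sup>2 + (Im z)\<^sup>2, - 2 * Re z, 1:]"

lemma linear_factor_dvd:
  assumes "poly (cpoly m) z = 0" "Im z \<noteq> 0" "degree m < 2"
  shows "m = 0"
proof -
  obtain a b where m: "m = [:a, b:]"
  proof
    show "m = [:coeff m 0, coeff m 1:]"
      using assms(3) by (auto simp: poly_eq_iff coeff_pCons coeff_eq_0 split: nat.split)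
  qed
  have "b = 0" "a = 0"
    using assms(1,2) by (auto simp: m cpoly_pCons complex_eq_iff)
  then show ?thesis by (simp add: m)
qed

text \<open>The remainder has degree below 2 and still vanishes at the nonreal z, so
  \<open>linear_factor_dvd\<close> makes it zero.\<close>

lemma quadratic_factor_dvd:
  assumes "poly (cpoly m) z = 0" "Im z \<noteq> 0"
  shows "quadratic_factor z dvd m"
proof -
  let ?q = "quadratic_factor z"
  have q: "poly (cpoly ?q) z = 0"
    by (simp add: quadratic_factor_def cpoly_pCons complex_eq_iff power2_eq_square algebra_simps)
  have "?q \<noteq> 0" "degree ?q = 2" by (simp_all add: quadratic_factor_def)
  then have "degree (m mod ?q) < 2"
    using degree_mod_less[of ?q m] by auto
  moreover have "cpoly m = cpoly (m div ?q) * cpoly ?q + cpoly (m mod ?q)"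
    by (metis cpoly_add cpoly_mult div_mult_mod_eq)
  then have "poly (cpoly (m mod ?q)) z = 0"
    using assms(1) q by simp
  ultimately have "m mod ?q = 0" using linear_factor_dvd assms(2) by blast
  then show ?thesis by auto
qed

text \<open>The bounds are required on punctured neighbourhoods, so that common linear factors cancel.\<close>

lemma poly_dvd_if_bounded:
  fixes p q :: "complex poly"
  assumes "p \<noteq> 0" "\<And>a. poly p a = 0 \<Longrightarrow> \<exists>C. \<forall>\<^sub>F z in at a. norm (poly q z) \<le> C * norm (poly p z)"
  shows "p dvd q"
  using assms
proof (induction "degree p" arbitrary: p q)
  case 0
  then have "is_unit p" by (simp add: is_unit_iff_degree)
  then show ?case by (rule unit_imp_dvd)
next
  case (Suc n)
  obtain a where a: "poly p a = 0"
    using alg_closed_imp_poly_has_root[of p] Suc.hyps(2) by auto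
  obtain C where C: "\<forall>\<^sub>F z in at a. norm (poly q z) \<le> C * norm (poly p z)"
    using Suc.prems(2)[OF a] by blast
  have "((\<lambda>z. norm (poly q z)) \<longlongrightarrow> norm (poly q a)) (at a)"
    "((\<lambda>z. C * norm (poly p z)) \<longlongrightarrow> C * norm (poly p a)) (at a)"
    by (auto intro!: tendsto_intros simp: poly_isCont isContD)
  then have "norm (poly q a) \<le> C * norm (poly p a)"
    using C by (intro tendsto_le[of "at a"]) auto
  then have "poly q a = 0" using a by simp
  then obtain q' where q': "q = [:- a, 1:] * q'" by (metis poly_eq_0_iff_dvd dvdE)
  obtain p' where p': "p = [:- a, 1:] * p'" using a by (metis poly_eq_0_iff_dvd dvdE)
  have "p' dvd q'"
  proof (rule Suc.hyps(1))
    show "p' \<noteq> 0" using Suc.prems(1) p' by auto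
    then show "n = degree p'" using Suc.hyps(2) p' degree_mult_eq[of "[:- a, 1:]" p'] by simp
    fix b assume "poly p' b = 0"
    then have "poly p b = 0" by (simp add: p')
    then obtain C where C: "\<forall>\<^sub>F z in at b. norm (poly q z) \<le> C * norm (poly p z)"
      using Suc.prems(2) by blast
    moreover have "\<forall>\<^sub>F z in at b. z \<noteq> a"
      by (cases "a = b") (auto simp: eventually_at_topological eventually_neq_at_within)
    ultimately have "\<forall>\<^sub>F z in at b. norm (poly q' z) \<le> C * norm (poly p' z)"
    proof eventually_elim
      case (elim z)
      have "norm (z - a) * norm (poly q' z) \<le> norm (z - a) * (C * norm (poly p' z))"
        using elim(1) unfolding q' p' poly_mult norm_mult by (simp add: mult.left_commute)
      then show ?case using elim(2) by simp
    qed
    then show "\<exists>C. \<forall>\<^sub>F z in at b. norm (poly q' z) \<le> C * norm (poly p' z)" by blast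
  qed
  then show ?case unfolding q' p' by (rule mult_dvd_mono[OF dvd_refl])
qed

subsection \<open>The characteristic polynomial\<close>

definition charmatrix :: "'a::comm_ring_1 ^'n^'n \<Rightarrow> 'a poly ^'n^'n"
  where "charmatrix M = (\<chi> i j. (if i = j then [:0, 1:] else 0) - [:M $ i $ j:])"

definition charpoly :: "'a::comm_ring_1 ^'n^'n \<Rightarrow> 'a poly"
  where "charpoly M = det (charmatrix M)"

lemma poly_det: "poly (det A) x = det (\<chi> i j. poly (A $ i $ j) x)"
  by (simp add: det_def poly_sum poly_prod of_int_poly) 

lemma poly_charpoly: "poly (charpoly M) x = det (mat x - M)"
  unfolding charpoly_def poly_det charmatrix_def
  by (rule arg_cong[where f = det]) (simp add: vec_eq_iff mat_def)

text \<open>Only the identity permutation picks all diagonal entries; any other one picks a constant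
  entry and loses degree. The degree being the same for all matrices matters later, where it occurs
  as an exponent.\<close>

lemma charpoly_monic:
  fixes M :: "real^'n^'n"
  shows "degree (charpoly M) = CARD('n)" "lead_coeff (charpoly M) = 1"
proof -
  let ?n = "CARD('n)"
  let ?t = "\<lambda>p. of_int (sign p) * (\<Prod>i\<in>UNIV. charmatrix M $ i $ p i)"
  have deg1: "degree (charmatrix M $ i $ j) \<le> 1" for i j
    by (simp add: charmatrix_def)
  have lt: "degree (?t p) < ?n" if ne: "p \<noteq> id" for p :: "'n \<Rightarrow> 'n"
  proof -
    obtain i where i: "p i \<noteq> i" using ne by (auto simp: fun_eq_iff id_def)
    have "degree (\<Prod>i\<in>UNIV. charmatrix M $ i $ p i) \<le> (\<Sum>i\<in>UNIV. degree (charmatrix M $ i $ p i))"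
      using degree_prod_sum_le[of UNIV "\<lambda>i. charmatrix M $ i $ p i"] by simp
    also have "\<dots> = degree (charmatrix M $ i $ p i) + (\<Sum>i\<in>UNIV - {i}. degree (charmatrix M $ i $ p i))"
      by (simp add: sum.remove)
    also have "\<dots> \<le> 0 + (\<Sum>i\<in>UNIV - {i}. 1)"
      using i by (intro add_mono sum_mono deg1) (auto simp: charmatrix_def)
    also have "\<dots> < ?n" by (simp add: card_gt_0_iff)
    finally show ?thesis by (auto simp: sign_def)
  qed
  define R where "R = (\<Sum>p\<in>{p. p permutes UNIV} - {id}. ?t p)"
  have small: "degree R < ?n"
    unfolding R_def by (intro degree_sum_less) (use lt in auto)
  have lin: "charmatrix M $ i $ i = [:- M $ i $ i, 1:]" for i
    by (simp add: charmatrix_def)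
  have mon: "lead_coeff (?t id) = 1" by (simp only: lead_coeff_mult lead_coeff_prod) (simp add: lin)
  have deg: "degree (?t id) = ?n" by (simp add: lin degree_prod_eq_sum_degree)
  have eq: "charpoly M = ?t id + R"
    unfolding charpoly_def det_def R_def by (subst sum.remove[of _ id]) (auto simp: permutes_id)
  show d: "degree (charpoly M) = ?n"
    unfolding eq using degree_add_eq_left[of R "?t id"] small unfolding deg by blast
  have "coeff R ?n = 0" by (rule coeff_eq_0[OF small])
  then show "lead_coeff (charpoly M) = 1"
    unfolding d unfolding eq using mon unfolding deg by simp
qed

lemma charpoly_nonzero: "charpoly M \<noteq> 0" for M :: "real^'n^'n"
  using charpoly_monic(2)[of M] by auto

lemma mat_scalar_vec: "mat r *v v = r *\<^sub>R v" for v :: "real^'n"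
  by (simp add: vec_eq_iff matrix_vector_mult_def mat_def if_distrib[of "\<lambda>x. x * _"] cong: if_cong)

text \<open>Both sides are compared as functions of a real x, where x - D M E = D (x - M) E and the
  determinants of D and E cancel.\<close>

lemma charpoly_similar:
  fixes M D E :: "real^'n^'n"
  assumes "D ** E = mat 1"
  shows "charpoly (D ** M ** E) = charpoly M"
proof (rule poly_ext)
  fix x
  have "mat x - D ** M ** E = D ** (mat x - M) ** E"
    using assms by (simp add: matrix_eq matrix_vector_mult_diff_rdistrib matrix_vector_mult_diff_distrib mat_scalar_vec
        linear_scale flip: matrix_vector_mul_assoc)
  moreover have "det D * det E = 1" using assms by (metis det_I det_mul)
  ultimately show "poly (charpoly (D ** M ** E)) x = poly (charpoly M) x"
    by (simp add: poly_charpoly det_mul)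
qed

lemma charpoly_root_eigenvector:
  fixes M :: "real^'n^'n"
  assumes "poly (charpoly M) r = 0"
  shows "\<exists>v. v \<noteq> 0 \<and> M *v v = r *\<^sub>R v"
proof -
  have "\<not> invertible (mat r - M)"
    using assms by (simp add: poly_charpoly invertible_det_nz)
  then obtain v where "v \<noteq> 0" "(mat r - M) *v v = 0"
    by (metis invertible_left_inverse matrix_left_invertible_ker)
  then show ?thesis
    by (metis eq_iff_diff_eq_0 matrix_vector_mult_diff_rdistrib mat_scalar_vec)
qed

text \<open>The adjugate in the form suggested by Cramer's rule: entry (k, j) is the determinant
  after column k has been replaced by the j-th unit vector.\<close>

definition char_adjugate :: "'a::comm_ring_1 ^'n^'n \<Rightarrow> 'a poly ^'n^'n"
  where "char_adjugate M = (\<chi> k j. det (\<chi> i l. if l = k then (if i = j then 1 else 0) else charmatrix M $ i $ l))"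

lemma charmatrix_adjugate:
  fixes M :: "real^'n^'n"
  shows "(\<Sum>k\<in>UNIV. charmatrix M $ i $ k * char_adjugate M $ k $ j) = (if i = j then charpoly M else 0)"
proof -
  let ?l = "(\<Sum>k\<in>UNIV. charmatrix M $ i $ k * char_adjugate M $ k $ j) - (if i = j then charpoly M else 0)"
  \<comment> \<open>Cramer's rule gives the identity at every real x that is not a root.
    Multiplication by \<open>charpoly M\<close> makes it trivial at the roots, and the factor is
    cancelled afterwards in the integral domain of polynomials.\<close>
  have "poly (charpoly M * ?l) x = poly 0 x" for x
  proof (cases "poly (charpoly M) x = 0")
    case False
    let ?A = "mat x - M"
    let ?b = "axis j 1 :: real^'n"
    have A: "poly (charmatrix M $ i $ j) x = ?A $ i $ j" for i j
      by (simp add: charmatrix_def mat_def)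
    have d: "det ?A \<noteq> 0" using False by (simp add: poly_charpoly)
    have B: "poly (char_adjugate M $ k $ j) x = det (\<chi> i l. if l = k then ?b $ i else ?A $ i $ l)" for k
      unfolding char_adjugate_def by (simp add: poly_det A axis_def if_distrib[of "\<lambda>p. poly p x"] cong: if_cong)
    have "?A *v (\<chi> k. poly (char_adjugate M $ k $ j) x / det ?A) = ?b"
      using cramer[OF d, of _ ?b] unfolding B by blast
    then have "(\<Sum>k\<in>UNIV. ?A $ i $ k * (poly (char_adjugate M $ k $ j) x / det ?A)) = ?b $ i"
      by (auto simp: matrix_vector_mult_def vec_eq_iff)
    then have "(\<Sum>k\<in>UNIV. ?A $ i $ k * poly (char_adjugate M $ k $ j) x) / det ?A = ?b $ i"
      by (simp add: sum_divide_distrib)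
    then have "poly ?l x = 0"
      using d by (auto simp: poly_sum A poly_charpoly axis_def divide_eq_eq)
    then show ?thesis by simp
  qed simp
  then have "charpoly M * ?l = 0" by (intro poly_ext) blast
  then show ?thesis using charpoly_nonzero[of M] by auto
qed

text \<open>Cayley--Hamilton: the columns of the characteristic matrix, evaluated at \<open>M\<close>, are relations
  between the coordinate vectors, and the adjugate combines them.\<close>

lemma poly_op_charpoly:
  fixes M :: "real^'n^'n"
  shows "poly_op (charpoly M) ((*v) M) v = 0"
proof -
  let ?T = "(*v) M" and ?e = "\<lambda>i. axis i 1 :: real^'n"
  have T: "linear ?T" by simp
  have rel: "(\<Sum>i\<in>UNIV. poly_op (charmatrix M $ i $ k) ?T (?e i)) = 0" for k
  proof -
    have "poly_op (charmatrix M $ i $ k) ?T (?e i) = (if i = k then ?T (?e k) else 0) - M $ i $ k *\<^sub>R ?e i" for i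
      by (simp add: charmatrix_def poly_op_diff[OF T] poly_op_pCons[OF T] linear_0[OF T])
    moreover have "(\<Sum>i\<in>UNIV. M $ i $ k *\<^sub>R ?e i) = ?T (?e k)"
      by (simp add: vec_eq_iff matrix_vector_mult_def axis_def if_distrib cong: if_cong)
    ultimately show ?thesis by (simp add: sum_subtractf)
  qed
  have basis: "poly_op (charpoly M) ?T (?e j) = 0" for j
  proof -
    have "poly_op (charpoly M) ?T (?e j) =
        (\<Sum>i\<in>UNIV. poly_op (if i = j then charpoly M else 0) ?T (?e i))"
      by (subst sum.remove[of _ j]) auto
    also have "\<dots> = (\<Sum>i\<in>UNIV. \<Sum>k\<in>UNIV. poly_op (charmatrix M $ i $ k * char_adjugate M $ k $ j) ?T (?e i))"
      unfolding charmatrix_adjugate[symmetric] by (simp add: poly_op_sum[OF T])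
    also have "\<dots> = (\<Sum>k\<in>UNIV. \<Sum>i\<in>UNIV. poly_op (charmatrix M $ i $ k * char_adjugate M $ k $ j) ?T (?e i))"
      by (rule sum.swap)
    also have "\<dots> = (\<Sum>k\<in>UNIV. poly_op (char_adjugate M $ k $ j) ?T (\<Sum>i\<in>UNIV. poly_op (charmatrix M $ i $ k) ?T (?e i)))"
      by (simp add: linear_sum[OF linear_poly_op[OF T]] poly_op_mult[OF T, symmetric] mult.commute)
    also have "\<dots> = 0" by (simp add: rel linear_0[OF linear_poly_op[OF T]])
    finally show ?thesis .
  qed
  have "v = (\<Sum>j\<in>UNIV. v $ j *\<^sub>R ?e j)"
    by (simp add: vec_eq_iff axis_def if_distrib cong: if_cong)
  then have "poly_op (charpoly M) ?T v = (\<Sum>j\<in>UNIV. v $ j *\<^sub>R poly_op (charpoly M) ?T (?e j))"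
    using linear_sum[OF linear_poly_op[OF T]] linear_scale[OF linear_poly_op[OF T]]
    by (metis (no_types, lifting) sum.cong)
  then show ?thesis by (simp add: basis)
qed

subsection \<open>The sign polynomial\<close>

text \<open>Homogenisations of \<open>\<chi>(s)\<close> and of \<open>(\<chi>(s) - \<chi>(x)) / (s - x)\<close>; for \<open>\<chi>\<close> the characteristic
  polynomial of \<open>L\<close> they give \<open>(s - c L)\<^sup>-\<^sup>1 = hom_quot \<chi> s c L / hom_eval \<chi> s c\<close>.\<close>

definition hom_eval :: "real poly \<Rightarrow> real \<Rightarrow> real \<Rightarrow> real"
  where "hom_eval p s c = (\<Sum>j\<le>degree p. coeff p j * s ^ j * c ^ (degree p - j))"

definition hom_quot :: "real poly \<Rightarrow> real \<Rightarrow> real \<Rightarrow> real poly"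
  where "hom_quot p s c = (\<Sum>j\<le>degree p. smult (coeff p j * c ^ (degree p - j))
    (\<Sum>k<j. monom (s ^ (j - 1 - k) * c ^ k) k))"

text \<open>The geometric sum turns (s - c x) times the inner sum for index j into s^j - (c x)^j;
  the factor c^(n - j), with n the degree, completes every second term to the same power c^n. On an
  operator annihilated by p the last summand disappears, which leaves a resolvent formula.\<close>

lemma hom_quot: "[:s, - c:] * hom_quot p s c = [:hom_eval p s c:] - smult (c ^ degree p) p"
proof (rule poly_ext)
  fix x
  let ?n = "degree p"
  define G where "G j = (\<Sum>k<j. s ^ (j - 1 - k) * c ^ k * x ^ k)" for j
  have geo: "(s - c * x) * G j = s ^ j - (c * x) ^ j" for j
  proof (cases j)
    case (Suc n)
    have "(\<Sum>k<Suc n. (c * x) ^ k * s ^ (n - k)) = G j"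
      unfolding Suc G_def by (intro sum.cong) (auto simp: power_mult_distrib)
    then show ?thesis
      using diff_power_eq_sum[of "c * x" n s] unfolding Suc by (simp add: algebra_simps)
  qed (simp add: G_def)
  have "poly (hom_quot p s c) x = (\<Sum>j\<le>?n. coeff p j * c ^ (?n - j) * G j)"
    by (simp add: hom_quot_def poly_sum poly_monom G_def)
  moreover have "poly ([:s, - c:] * hom_quot p s c) x = (s - c * x) * poly (hom_quot p s c) x"
    by (simp add: algebra_simps)
  ultimately have "poly ([:s, - c:] * hom_quot p s c) x =
      (\<Sum>j\<le>?n. coeff p j * c ^ (?n - j) * ((s - c * x) * G j))"
    by (simp only: sum_distrib_left) (simp add: mult_ac)
  also have "\<dots> = (\<Sum>j\<le>?n. coeff p j * s ^ j * c ^ (?n - j)) -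
      (\<Sum>j\<le>?n. c ^ ?n * (coeff p j * x ^ j))"
    unfolding geo sum_subtractf[symmetric]
  proof (rule sum.cong)
    fix j assume "j \<in> {..?n}"
    then have "c ^ ?n = c ^ (?n - j) * c ^ j" by (simp flip: power_add)
    then show "coeff p j * c ^ (?n - j) * (s ^ j - (c * x) ^ j) =
        coeff p j * s ^ j * c ^ (?n - j) - c ^ ?n * (coeff p j * x ^ j)"
      by (simp add: power_mult_distrib algebra_simps)
  qed simp
  also have "\<dots> = poly ([:hom_eval p s c:] - smult (c ^ ?n) p) x"
    by (simp only: poly_diff poly_smult hom_eval_def) (simp add: poly_altdef sum_distrib_left)
  finally show "poly ([:s, - c:] * hom_quot p s c) x = poly ([:hom_eval p s c:] - smult (c ^ ?n) p) x" .
qed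

lemma degree_hom_quot: "degree (hom_quot p s c) \<le> degree p"
  unfolding hom_quot_def
  by (intro degree_sum_le order.trans[OF degree_smult_le])
    (auto intro!: degree_sum_le intro: order.trans[OF degree_monom_le])

text \<open>For c = 0 only the leading term survives. Otherwise evaluation of the quotient identity
  at the zero s / c of its linear factor gives c^n p(s / c), with n the degree.\<close>

lemma hom_eval_nonzero:
  assumes "p \<noteq> 0" "\<And>x. poly p x \<noteq> 0" "s \<noteq> 0 \<or> c \<noteq> 0"
  shows "hom_eval p s c \<noteq> 0"
proof (cases "c = 0")
  case True
  have "hom_eval p s c = (\<Sum>j\<in>{degree p}. coeff p j * s ^ j * c ^ (degree p - j))"
    unfolding hom_eval_def by (rule sum.mono_neutral_right) (auto simp: True)
  then show ?thesis using True assms(1,3) by auto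
next
  case False
  have "hom_eval p s c = poly (smult (c ^ degree p) p) (s / c)"
    using arg_cong[OF hom_quot[of s c p], of "\<lambda>q. poly q (s / c)"] False by simp
  then show ?thesis using False assms(2) by simp
qed

text \<open>For \<open>\<chi>\<close> the characteristic polynomial of \<open>L\<close>, this is the resolvent product
  \<open>L (sin\<^sup>2 \<theta> - cos\<^sup>2 \<theta> L\<^sup>2)\<^sup>-\<^sup>1\<close> written as a polynomial in \<open>L\<close>.\<close>

definition sign_integrand :: "real poly \<Rightarrow> real \<Rightarrow> real poly"
  where "sign_integrand p \<theta> =
    smult (inverse (hom_eval p (sin \<theta>) (cos \<theta>) * hom_eval p (sin \<theta>) (- cos \<theta>)))
      ([:0, 1:] * hom_quot p (sin \<theta>) (cos \<theta>) * hom_quot p (sin \<theta>) (- cos \<theta>))"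

text \<open>The factor 2 / pi normalises the scalar integral, whose value is i pi / 2 or -i pi / 2
  according to the half plane.\<close>

definition sign_coeff :: "real poly \<Rightarrow> nat \<Rightarrow> real"
  where "sign_coeff p k = 2 / pi * integral {0..pi/2} (\<lambda>\<theta>. coeff (sign_integrand p \<theta>) k)"

text \<open>The bound counts the factor x and two quotients of degree at most that of p; it does not
  depend on the angle, so the integral can be taken coefficient by coefficient.\<close>

definition sign_poly :: "real poly \<Rightarrow> real poly"
  where "sign_poly p = (\<Sum>k\<le>2 * degree p + 1. monom (sign_coeff p k) k)"

section \<open>Smooth dependence of the sign polynomial on parameters\<close>

definition smooth_coeffs :: "'a::real_normed_vector set \<Rightarrow> ('a \<Rightarrow> real poly) \<Rightarrow> bool"
  where "smooth_coeffs S p \<longleftrightarrow> (\<forall>k. smooth_on S (\<lambda>y. coeff (p y) k))"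

lemma smooth_coeffs_cong:
  assumes "open S" "\<And>y. y \<in> S \<Longrightarrow> p y = q y" "smooth_coeffs S p"
  shows "smooth_coeffs S q"
  unfolding smooth_coeffs_def
proof
  fix k
  show "smooth_on S (\<lambda>y. coeff (q y) k)"
    by (rule smooth_on_cong[OF assms(1), of "\<lambda>y. coeff (p y) k"])
      (use assms(2,3) in \<open>auto simp: smooth_coeffs_def\<close>)
qed

lemma smooth_coeffs_const: "open S \<Longrightarrow> smooth_coeffs S (\<lambda>y. p)"
  by (simp add: smooth_coeffs_def smooth_on_const)

lemma smooth_coeffs_monom: "open S \<Longrightarrow> smooth_on S f \<Longrightarrow> smooth_coeffs S (\<lambda>y. monom (f y) k)"
  unfolding smooth_coeffs_def
proof
  fix j assume "open S" "smooth_on S f"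
  then show "smooth_on S (\<lambda>y. coeff (monom (f y) k) j)"
    by (cases "j = k") (simp_all add: smooth_on_const)
qed

lemma smooth_coeffs_add:
  "open S \<Longrightarrow> smooth_coeffs S p \<Longrightarrow> smooth_coeffs S q \<Longrightarrow> smooth_coeffs S (\<lambda>y. p y + q y)"
  by (simp add: smooth_coeffs_def smooth_on_add)

lemma smooth_coeffs_diff:
  "open S \<Longrightarrow> smooth_coeffs S p \<Longrightarrow> smooth_coeffs S q \<Longrightarrow> smooth_coeffs S (\<lambda>y. p y - q y)"
  by (simp add: smooth_coeffs_def smooth_on_diff)

lemma smooth_coeffs_smult:
  "open S \<Longrightarrow> smooth_on S f \<Longrightarrow> smooth_coeffs S p \<Longrightarrow> smooth_coeffs S (\<lambda>y. smult (f y) (p y))"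
  by (simp add: smooth_coeffs_def smooth_on_mult)

lemma smooth_coeffs_mult:
  "open S \<Longrightarrow> smooth_coeffs S p \<Longrightarrow> smooth_coeffs S q \<Longrightarrow> smooth_coeffs S (\<lambda>y. p y * q y)"
  by (auto simp: smooth_coeffs_def coeff_mult intro!: smooth_on_sum smooth_on_mult)

lemma smooth_coeffs_sum:
  assumes "open S" "\<And>i. i \<in> I \<Longrightarrow> smooth_coeffs S (p i)"
  shows "smooth_coeffs S (\<lambda>y. \<Sum>i\<in>I. p i y)"
  using assms(2)
  by (induction I rule: infinite_finite_induct)
    (auto intro: smooth_coeffs_const[OF assms(1)] smooth_coeffs_add[OF assms(1)])

lemma smooth_coeffs_prod:
  assumes "open S" "\<And>i. i \<in> I \<Longrightarrow> smooth_coeffs S (p i)"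
  shows "smooth_coeffs S (\<lambda>y. \<Prod>i\<in>I. p i y)"
  using assms(2)
  by (induction I rule: infinite_finite_induct)
    (auto intro: smooth_coeffs_const[OF assms(1)] smooth_coeffs_mult[OF assms(1)])

lemma smooth_coeffs_charpoly:
  fixes M :: "'a::real_normed_vector \<Rightarrow> real^'n^'n"
  assumes "open S" "\<And>i j. smooth_on S (\<lambda>y. M y $ i $ j)"
  shows "smooth_coeffs S (\<lambda>y. charpoly (M y))"
proof -
  have "smooth_coeffs S (\<lambda>y. [:M y $ i $ j:])" for i j
    using smooth_coeffs_monom[OF assms, of i j 0] by (simp add: monom_0)
  then have "smooth_coeffs S (\<lambda>y. charmatrix (M y) $ i $ j)" for i j
    by (simp add: charmatrix_def smooth_coeffs_diff[OF assms(1)] smooth_coeffs_const[OF assms(1)])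
  then show ?thesis
    unfolding charpoly_def det_def
    by (intro smooth_coeffs_sum smooth_coeffs_mult smooth_coeffs_prod smooth_coeffs_const assms(1))
qed

text \<open>The degree enters as a summation bound and in exponents; once it is constant on S, both
  constructions are polynomial expressions in the coefficients, \<open>s\<close> and
  \<open>c\<close>.\<close>

lemma smooth_hom:
  assumes "open S" "smooth_coeffs S p" "\<And>y. y \<in> S \<Longrightarrow> degree (p y) = n"
    "smooth_on S s" "smooth_on S c"
  shows "smooth_on S (\<lambda>y. hom_eval (p y) (s y) (c y))"
    "smooth_coeffs S (\<lambda>y. hom_quot (p y) (s y) (c y))"
proof -
  have p: "smooth_on S (\<lambda>y. coeff (p y) j)" for j
    using assms(2) by (simp add: smooth_coeffs_def)
  have "smooth_on S (\<lambda>y. \<Sum>j\<le>n. coeff (p y) j * s y ^ j * c y ^ (n - j))"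
    by (intro smooth_on_sum[OF assms(1)] smooth_on_mult[OF assms(1)]
        smooth_on_power[OF assms(1)] assms(4,5) p)
  then show "smooth_on S (\<lambda>y. hom_eval (p y) (s y) (c y))"
    by (rule smooth_on_cong[OF assms(1), rotated]) (simp add: hom_eval_def assms(3))
  have "smooth_coeffs S (\<lambda>y. \<Sum>j\<le>n. smult (coeff (p y) j * c y ^ (n - j))
      (\<Sum>k<j. monom (s y ^ (j - 1 - k) * c y ^ k) k))"
    by (intro smooth_coeffs_sum[OF assms(1)] smooth_coeffs_smult[OF assms(1)]
        smooth_coeffs_monom[OF assms(1)] smooth_on_mult[OF assms(1)]
        smooth_on_power[OF assms(1)] assms(4,5) p)
  then show "smooth_coeffs S (\<lambda>y. hom_quot (p y) (s y) (c y))"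
    by (rule smooth_coeffs_cong[OF assms(1), rotated]) (simp add: hom_quot_def assms(3))
qed

lemma hom_eval_sin_cos_nonzero:
  assumes "p \<noteq> 0" "\<And>x. poly p x \<noteq> 0"
  shows "hom_eval p (sin \<theta>) (cos \<theta>) \<noteq> 0" "hom_eval p (sin \<theta>) (- cos \<theta>) \<noteq> 0"
proof -
  have "sin \<theta> \<noteq> 0 \<or> cos \<theta> \<noteq> 0" using sin_zero_norm_cos_one[of \<theta>] by auto
  then show "hom_eval p (sin \<theta>) (cos \<theta>) \<noteq> 0" "hom_eval p (sin \<theta>) (- cos \<theta>) \<noteq> 0"
    using hom_eval_nonzero[OF assms, of "sin \<theta>" "cos \<theta>"]
      hom_eval_nonzero[OF assms, of "sin \<theta>" "- cos \<theta>"] by simp_all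
qed

lemma smooth_on_fst_snd:
  assumes "open (T :: 'b::real_normed_vector set)"
  shows "smooth_on (UNIV \<times> T) (fst :: 'a::real_normed_vector \<times> 'b \<Rightarrow> 'a)"
    "smooth_on (UNIV \<times> T) (snd :: 'a::real_normed_vector \<times> 'b \<Rightarrow> 'b)"
  using smooth_on_bounded_linear[OF open_Times[OF open_UNIV assms] bounded_linear_fst]
    smooth_on_bounded_linear[OF open_Times[OF open_UNIV assms] bounded_linear_snd] by blast+

text \<open>The angle is treated as one more coordinate: the integrand is jointly smooth on
  \<open>UNIV \<times> S\<close>, and integrating it out keeps smoothness in the parameter.\<close>

lemma smooth_sign_coeff:
  fixes p :: "'a::euclidean_space \<Rightarrow> real poly"
  assumes "open S" "smooth_coeffs S p" "\<And>y. y \<in> S \<Longrightarrow> degree (p y) = n"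
    "\<And>y. y \<in> S \<Longrightarrow> p y \<noteq> 0" "\<And>y x. y \<in> S \<Longrightarrow> poly (p y) x \<noteq> 0"
  shows "smooth_on S (\<lambda>y. sign_coeff (p y) k)"
proof -
  let ?S = "UNIV \<times> S :: (real \<times> 'a) set"
  have S: "open ?S" by (simp add: assms(1) open_Times)
  note fs = smooth_on_fst_snd[OF assms(1), where 'a = real]
  have p: "smooth_coeffs ?S (\<lambda>y. p (snd y))"
    unfolding smooth_coeffs_def
    by (intro allI smooth_on_compose[OF S assms(1) _ fs(2)])
      (use assms(2) in \<open>auto simp: smooth_coeffs_def\<close>)
  have d: "degree (p (snd y)) = n" if "y \<in> ?S" for y using that assms(3) by auto
  have sc: "smooth_on ?S (\<lambda>y. sin (fst y))" "smooth_on ?S (\<lambda>y. cos (fst y))"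
    "smooth_on ?S (\<lambda>y. - cos (fst y))"
    by (intro smooth_on_uminus smooth_on_sin smooth_on_cos S fs(1))+
  have "smooth_coeffs ?S (\<lambda>y. sign_integrand (p (snd y)) (fst y))"
    unfolding sign_integrand_def
  proof (intro smooth_coeffs_smult smooth_on_inverse smooth_on_mult smooth_coeffs_mult S
      smooth_coeffs_const[OF S] smooth_hom[OF S p d] sc)
    fix y assume "y \<in> ?S"
    then show "hom_eval (p (snd y)) (sin (fst y)) (cos (fst y)) *
        hom_eval (p (snd y)) (sin (fst y)) (- cos (fst y)) \<noteq> 0"
      using hom_eval_sin_cos_nonzero[of "p (snd y)" "fst y"] assms(4,5)[of "snd y"] by auto
  qed
  then have "smooth_on ?S (\<lambda>y. coeff (sign_integrand (p (snd y)) (fst y)) k)"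
    by (simp add: smooth_coeffs_def)
  from smooth_on_integral[OF assms(1) this, of 0 "pi/2"]
  show ?thesis
    unfolding sign_coeff_def by (intro smooth_on_mult smooth_on_const assms(1)) simp
qed

lemma continuous_on_sign_integrand:
  assumes "p \<noteq> 0" "\<And>x. poly p x \<noteq> 0"
  shows "continuous_on UNIV (\<lambda>\<theta>. coeff (sign_integrand p \<theta>) k)"
proof -
  have S: "open (UNIV :: real set)" by simp
  have p: "smooth_coeffs UNIV (\<lambda>\<theta>::real. p)" by (rule smooth_coeffs_const[OF S])
  have id: "smooth_on UNIV (\<lambda>\<theta>::real. \<theta>)"
    by (rule smooth_on_bounded_linear) (auto intro: bounded_linear_ident)
  have sc: "smooth_on UNIV (\<lambda>\<theta>::real. sin \<theta>)" "smooth_on UNIV (\<lambda>\<theta>::real. cos \<theta>)"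
    "smooth_on UNIV (\<lambda>\<theta>::real. - cos \<theta>)"
    by (intro smooth_on_uminus smooth_on_sin smooth_on_cos S id)+
  have "smooth_coeffs UNIV (\<lambda>\<theta>::real. sign_integrand p \<theta>)"
    unfolding sign_integrand_def
    by (intro smooth_coeffs_smult smooth_on_inverse smooth_on_mult smooth_coeffs_mult S
      smooth_coeffs_const[OF S] smooth_hom[OF S p refl] sc)
      (use hom_eval_sin_cos_nonzero[OF assms] in auto)
  then show ?thesis
    unfolding smooth_coeffs_def using smooth_on_imp_continuous_on by blast
qed

lemma degree_sign_integrand: "degree (sign_integrand p \<theta>) \<le> 2 * degree p + 1"
proof -
  have "degree ([:0, 1:] * hom_quot p (sin \<theta>) (cos \<theta>) * hom_quot p (sin \<theta>) (- cos \<theta>)) \<le>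
      1 + degree p + degree p"
    by (intro order.trans[OF degree_mult_le] add_mono degree_hom_quot) simp
  then show ?thesis
    unfolding sign_integrand_def by (intro order.trans[OF degree_smult_le]) simp
qed

lemma coeff_sign_poly:
  "coeff (sign_poly p) k = (if k \<le> 2 * degree p + 1 then sign_coeff p k else 0)"
  by (simp add: sign_poly_def coeff_sum)

lemma degree_sign_poly: "degree (sign_poly p) \<le> 2 * degree p + 1"
  by (rule degree_le) (simp add: coeff_sign_poly)

section \<open>The sign integral at a complex number\<close>

lemma poly_cpoly_sum:
  "degree p \<le> n \<Longrightarrow> poly (cpoly p) z = (\<Sum>k\<le>n. of_real (coeff p k) * z ^ k)"
  by (subst poly_altdef, rule sum.mono_neutral_cong_left) (auto simp: coeff_map_poly coeff_eq_0)

text \<open>Evaluation at a fixed z is a finite linear combination of coefficients and so commutes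
  with the integral that defines them.\<close>

lemma has_integral_sign_poly:
  assumes "p \<noteq> 0" "\<And>x. poly p x \<noteq> 0"
  shows "((\<lambda>\<theta>. poly (cpoly (sign_integrand p \<theta>)) z) has_integral
    (of_real (pi / 2) * poly (cpoly (sign_poly p)) z)) {0..pi/2}"
proof -
  let ?n = "2 * degree p + 1"
  have "((\<lambda>\<theta>. coeff (sign_integrand p \<theta>) k) has_integral (pi / 2 * sign_coeff p k)) {0..pi/2}" for k
    using integrable_continuous_real[OF continuous_on_subset[OF continuous_on_sign_integrand[OF assms]]]
    by (simp add: sign_coeff_def has_integral_integral)
  then have "((\<lambda>\<theta>. of_real (coeff (sign_integrand p \<theta>) k) * z ^ k) has_integral
      (of_real (pi / 2 * sign_coeff p k) * z ^ k)) {0..pi/2}" for k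
    by (intro has_integral_mult_left has_integral_of_real)
  then have "((\<lambda>\<theta>. \<Sum>k\<le>?n. of_real (coeff (sign_integrand p \<theta>) k) * z ^ k) has_integral
      (\<Sum>k\<le>?n. of_real (pi / 2 * sign_coeff p k) * z ^ k)) {0..pi/2}"
    by (intro has_integral_sum) auto
  moreover have "(\<Sum>k\<le>?n. of_real (pi / 2 * sign_coeff p k) * z ^ k) =
      of_real (pi / 2) * poly (cpoly (sign_poly p)) z"
    by (simp add: poly_cpoly_sum[OF degree_sign_poly] coeff_sign_poly sum_distrib_left mult.assoc
        del: sum.atMost_Suc)
  ultimately show ?thesis
    by (simp only: poly_cpoly_sum[OF degree_sign_integrand])
qed

lemma sin_cos_denominator_nonzero:
  assumes "Im z \<noteq> 0"
  shows "complex_of_real (sin \<theta>) - complex_of_real (cos \<theta>) * z \<noteq> 0"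
    "complex_of_real (sin \<theta>) + complex_of_real (cos \<theta>) * z \<noteq> 0"
  using assms sin_zero_norm_cos_one[of \<theta>] by (auto simp: complex_eq_iff)

text \<open>The primitive is a branch of \<open>1/2 log ((cos \<theta> z - sin \<theta>) / (cos \<theta> z + sin \<theta>))\<close>; the argument
  stays in the closed upper half plane, so it is rotated into the right half plane.\<close>

lemma has_integral_sign_upper:
  assumes "Im z > 0"
  shows "((\<lambda>\<theta>. z / ((of_real (sin \<theta>))\<^sup>2 - (of_real (cos \<theta>))\<^sup>2 * z\<^sup>2)) has_integral
    (\<i> * of_real (pi / 2))) {0..pi/2}"
proof -
  define W where "W u = - \<i> * ((cos u * z - sin u) / (cos u * z + sin u))" for u :: complex
  have "((\<lambda>\<theta>. Ln (W (of_real \<theta>)) / 2) has_vector_derivative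
      (z / ((of_real (sin \<theta>))\<^sup>2 - (of_real (cos \<theta>))\<^sup>2 * z\<^sup>2))) (at \<theta> within {0..pi/2})"
    if \<theta>: "\<theta> \<in> {0..pi/2}" for \<theta>
  proof -
    define s c where "s = sin \<theta>" and "c = cos \<theta>"
    have sc: "s \<ge> 0" "c \<ge> 0" "s\<^sup>2 + c\<^sup>2 = 1"
      using \<theta> by (auto simp: s_def c_def intro: sin_ge_zero cos_ge_zero)
    have Sc: "sin (complex_of_real \<theta>) = of_real s" "cos (complex_of_real \<theta>) = of_real c"
      by (simp_all add: s_def c_def sin_of_real cos_of_real)
    define N D where "N = of_real c * z - of_real s" and "D = of_real c * z + of_real s"
    have nz: "N \<noteq> 0" "D \<noteq> 0"
      using sin_cos_denominator_nonzero[of z \<theta>] assms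
      by (auto simp: N_def D_def s_def c_def add.commute)
    have W: "W (of_real \<theta>) = - \<i> * (N / D)" by (simp add: W_def Sc N_def D_def)
    have "Re (- \<i> * x) = Im x" for x by simp
    then have "Re (W (of_real \<theta>)) = Im (N / D)" unfolding W .
    also have "\<dots> = 2 * s * c * Im z / ((Re D)\<^sup>2 + (Im D)\<^sup>2)"
      unfolding Im_divide by (simp add: N_def D_def algebra_simps)
    also have "\<dots> \<ge> 0" using sc assms by simp
    finally have "Re (W (of_real \<theta>)) \<ge> 0" .
    moreover have "W (of_real \<theta>) \<noteq> 0"
      using nz by (auto simp: W)
    ultimately have neg: "W (of_real \<theta>) \<notin> \<real>\<^sub>\<le>\<^sub>0"
      by (auto simp: complex_nonpos_Reals_iff complex_eq_iff)
    have SC: "(of_real s)\<^sup>2 + (of_real c)\<^sup>2 = (1::complex)"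
      using sc(3) by (metis of_real_1 of_real_add of_real_power)
    define N' D' where "N' = - of_real s * z - of_real c" and "D' = - of_real s * z + of_real c"
    have "N' * D - N * D' = - 2 * z * ((of_real s)\<^sup>2 + (of_real c)\<^sup>2)"
      by (simp add: N_def D_def N'_def D'_def algebra_simps power2_eq_square)
    then have ND: "N' * D - N * D' = - 2 * z" using SC by simp
    have dN: "((\<lambda>u. cos u * z - sin u) has_field_derivative N') (at (of_real \<theta>))"
      and dD: "((\<lambda>u. cos u * z + sin u) has_field_derivative D') (at (of_real \<theta>))"
      by (auto intro!: derivative_eq_intros simp: N'_def D'_def Sc)
    have "(W has_field_derivative (- \<i> * ((N' * D - N * D') / (D * D)))) (at (of_real \<theta>))"
      unfolding W_def
      using DERIV_cmult[OF DERIV_divide[OF dN dD], of "- \<i>"] nz(2) by (simp add: Sc N_def D_def)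
    from DERIV_chain2[OF has_field_derivative_Ln[OF neg] this]
    have "((\<lambda>u. Ln (W u)) has_field_derivative
        (inverse (W (of_real \<theta>)) * (- \<i> * (- 2 * z / (D * D))))) (at (of_real \<theta>))"
      unfolding ND .
    from DERIV_cdivide[OF this, of 2]
    have "((\<lambda>u. Ln (W u) / 2) has_field_derivative
        (inverse (W (of_real \<theta>)) * (- \<i> * (- 2 * z / (D * D))) / 2)) (at (of_real \<theta>))" .
    moreover have "inverse (W (of_real \<theta>)) * (- \<i> * (- 2 * z / (D * D))) / 2 = z / - (N * D)"
      unfolding W using nz by (simp add: field_simps)
    moreover have "- (N * D) = (of_real (sin \<theta>))\<^sup>2 - (of_real (cos \<theta>))\<^sup>2 * z\<^sup>2"
      by (simp add: N_def D_def s_def c_def algebra_simps power2_eq_square)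
    ultimately have "((\<lambda>u. Ln (W u) / 2) has_field_derivative
        (z / ((of_real (sin \<theta>))\<^sup>2 - (of_real (cos \<theta>))\<^sup>2 * z\<^sup>2))) (at (of_real \<theta>))" by (simp only:)
    from has_vector_derivative_at_within[OF has_vector_derivative_real_field[OF this]]
    show ?thesis .
  qed
  then have "((\<lambda>\<theta>. z / ((of_real (sin \<theta>))\<^sup>2 - (of_real (cos \<theta>))\<^sup>2 * z\<^sup>2)) has_integral
      (Ln (W (of_real (pi/2))) / 2 - Ln (W (of_real 0)) / 2)) {0..pi/2}"
    by (intro fundamental_theorem_of_calculus) auto
  moreover have "z \<noteq> 0" using assms by auto
  \<comment> \<open>The principal logarithms of the endpoint values are i pi / 2 and -i pi / 2, so
    half their difference is i pi / 2.\<close>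
  then have "W (of_real (pi/2)) = \<i>" "W (of_real 0) = - \<i>"
    by (simp_all add: W_def sin_of_real cos_of_real del: of_real_divide)
  ultimately show ?thesis by simp
qed

text \<open>The integrand is odd in z, which reduces the lower half plane to the upper one.\<close>

lemma has_integral_sign:
  assumes "Im z \<noteq> 0"
  shows "((\<lambda>\<theta>. z / ((of_real (sin \<theta>))\<^sup>2 - (of_real (cos \<theta>))\<^sup>2 * z\<^sup>2)) has_integral
    (\<i> * of_real (sgn (Im z)) * of_real (pi / 2))) {0..pi/2}"
proof (cases "Im z > 0")
  case True
  then show ?thesis using has_integral_sign_upper[of z] by simp
next
  case False
  then show ?thesis using has_integral_neg[OF has_integral_sign_upper[of "- z"]] assms by simp
qed

lemma cpoly_hom_quot:
  "(of_real s - of_real c * z) * poly (cpoly (hom_quot p s c)) z =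
    of_real (hom_eval p s c) - of_real c ^ degree p * poly (cpoly p) z"
proof -
  have "cpoly [:s, - c:] * cpoly (hom_quot p s c) =
      cpoly [:hom_eval p s c:] - smult (of_real c ^ degree p) (cpoly p)"
    using arg_cong[OF hom_quot[of s c p], of cpoly]
    by (simp only: cpoly_mult cpoly_diff cpoly_smult of_real_power)
  from arg_cong[OF this, of "\<lambda>q. poly q z"] show ?thesis
    by (simp add: cpoly_pCons algebra_simps)
qed

text \<open>The error term is divisible by \<open>p\<close>, with a quotient that is continuous off the real axis.\<close>

lemma sign_poly_error:
  assumes "p \<noteq> 0" "\<And>x. poly p x \<noteq> 0"
  obtains K where "continuous_on {z. Im z \<noteq> 0} K"
    "\<And>z. Im z \<noteq> 0 \<Longrightarrow> poly (cpoly (sign_poly p)) z = \<i> * of_real (sgn (Im z)) + poly (cpoly p) z * K z"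
proof -
  let ?U = "{z. Im z \<noteq> 0}"
  let ?n = "degree p"
  define w w' where "w \<theta> = complex_of_real (hom_eval p (sin \<theta>) (cos \<theta>))"
    and "w' \<theta> = complex_of_real (hom_eval p (sin \<theta>) (- cos \<theta>))" for \<theta>
  define a b where "a \<theta> = complex_of_real (cos \<theta>) ^ ?n" and "b \<theta> = complex_of_real (- cos \<theta>) ^ ?n" for \<theta>
  define h where "h z \<theta> = z / ((of_real (sin \<theta>))\<^sup>2 - (of_real (cos \<theta>))\<^sup>2 * z\<^sup>2)" for z :: complex and \<theta>
  \<comment> \<open>With X = p(z) the integrand of the sign polynomial equals h (1 - a X / w) (1 - b
    X / w'); after h is subtracted, everything contains X, and \<open>k\<close> is the remaining
    factor.\<close>
  define k where "k z \<theta> = - h z \<theta> * (a \<theta> / w \<theta> + b \<theta> / w' \<theta> -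
    a \<theta> * b \<theta> * poly (cpoly p) z / (w \<theta> * w' \<theta>))" for z \<theta>
  define K where "K z = of_real (2 / pi) * integral {0..pi/2} (k z)" for z
  have w: "w \<theta> \<noteq> 0" "w' \<theta> \<noteq> 0" for \<theta>
    using hom_eval_sin_cos_nonzero[OF assms] by (simp_all add: w_def w'_def)
  have den: "(of_real (sin \<theta>))\<^sup>2 - (of_real (cos \<theta>))\<^sup>2 * z\<^sup>2 =
      (of_real (sin \<theta>) - of_real (cos \<theta>) * z) * (of_real (sin \<theta>) + of_real (cos \<theta>) * z)"
    for z :: complex and \<theta> by (simp add: algebra_simps power2_eq_square)
  have den_nz: "(of_real (sin \<theta>))\<^sup>2 - (of_real (cos \<theta>))\<^sup>2 * z\<^sup>2 \<noteq> 0" if "z \<in> ?U" for z :: complex and \<theta>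
    unfolding den using sin_cos_denominator_nonzero[of z \<theta>] that by simp
  have cont_w: "continuous_on S w" "continuous_on S w'" for S
    unfolding w_def w'_def hom_eval_def by (intro continuous_intros)+
  have cont: "continuous_on (?U \<times> cbox 0 (pi/2)) (\<lambda>(z, \<theta>). k z \<theta>)"
    unfolding k_def h_def split_beta a_def b_def
    by (intro continuous_intros continuous_on_compose2[OF cont_w(1)[of UNIV]] 
       continuous_on_compose2[OF cont_w(2)[of UNIV]])
       (use w den_nz in auto)
  have "continuous_on ?U (\<lambda>z. integral (cbox 0 (pi/2)) (k z))"
    by (rule integral_continuous_on_param) (use cont in simp)
  then have "continuous_on ?U K" unfolding K_def by (intro continuous_intros) simp
  moreover have "poly (cpoly (sign_poly p)) z = \<i> * of_real (sgn (Im z)) + poly (cpoly p) z * K z"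
    if z: "Im z \<noteq> 0" for z
  proof -
    have "continuous_on (cbox 0 (pi/2)) (\<lambda>\<theta>. (z, \<theta>))" by (intro continuous_intros)
    from continuous_on_compose2[OF cont this]
    have "continuous_on (cbox 0 (pi/2)) (\<lambda>\<theta>. case (z, \<theta>) of (z, \<theta>) \<Rightarrow> k z \<theta>)"
      using z by (simp add: image_subset_iff)
    then have "k z integrable_on {0..pi/2}"
      using integrable_continuous[of 0 "pi/2" "k z"] by simp
    then have "(k z has_integral (of_real (pi/2) * K z)) {0..pi/2}"
      by (simp add: K_def has_integral_integral)
    then have "((\<lambda>\<theta>. h z \<theta> + poly (cpoly p) z * k z \<theta>) has_integral
        (\<i> * of_real (sgn (Im z)) * of_real (pi / 2) + poly (cpoly p) z * (of_real (pi/2) * K z))) {0..pi/2}"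
      using has_integral_sign[OF z] unfolding h_def
      by (intro has_integral_add has_integral_mult_right)
    moreover have "h z \<theta> + poly (cpoly p) z * k z \<theta> = poly (cpoly (sign_integrand p \<theta>)) z" for \<theta>
    proof -
      let ?s = "complex_of_real (sin \<theta>)" and ?c = "complex_of_real (cos \<theta>)"
      let ?X = "poly (cpoly p) z"
      define R R' where "R = poly (cpoly (hom_quot p (sin \<theta>) (cos \<theta>))) z"
        and "R' = poly (cpoly (hom_quot p (sin \<theta>) (- cos \<theta>))) z"
      note nz = sin_cos_denominator_nonzero[OF z, of \<theta>]
      have "(?s - ?c * z) * R = w \<theta> - a \<theta> * ?X"
        using cpoly_hom_quot[of "sin \<theta>" "cos \<theta>" z p] by (simp add: R_def w_def a_def)
      moreover have "(?s + ?c * z) * R' = w' \<theta> - b \<theta> * ?X"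
        using cpoly_hom_quot[of "sin \<theta>" "- cos \<theta>" z p] by (simp add: R'_def w'_def b_def)
      ultimately have R: "R = (w \<theta> - a \<theta> * ?X) / (?s - ?c * z)" "R' = (w' \<theta> - b \<theta> * ?X) / (?s + ?c * z)"
        using nz by (auto simp: field_simps)
      have "poly (cpoly (sign_integrand p \<theta>)) z = z * R * R' / (w \<theta> * w' \<theta>)"
        by (simp add: sign_integrand_def cpoly_mult cpoly_smult cpoly_pCons R_def R'_def w_def w'_def
            divide_inverse mult_ac)
      also have "\<dots> = h z \<theta> * ((w \<theta> - a \<theta> * ?X) * (w' \<theta> - b \<theta> * ?X) / (w \<theta> * w' \<theta>))"
        unfolding R h_def den by simp
      also have "(w \<theta> - a \<theta> * ?X) * (w' \<theta> - b \<theta> * ?X) / (w \<theta> * w' \<theta>) =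
          1 - ?X * (a \<theta> / w \<theta> + b \<theta> / w' \<theta> - a \<theta> * b \<theta> * ?X / (w \<theta> * w' \<theta>))"
        using w[of \<theta>] by (simp add: field_simps)
      finally show ?thesis by (simp add: k_def algebra_simps)
    qed
    ultimately have int: "((\<lambda>\<theta>. poly (cpoly (sign_integrand p \<theta>)) z) has_integral
        (\<i> * of_real (sgn (Im z)) * of_real (pi / 2) + poly (cpoly p) z * (of_real (pi/2) * K z))) {0..pi/2}"
      by (simp only:)
    have "\<i> * of_real (sgn (Im z)) * of_real (pi / 2) + poly (cpoly p) z * (of_real (pi/2) * K z) =
        of_real (pi / 2) * poly (cpoly (sign_poly p)) z"
      by (rule has_integral_unique[OF int has_integral_sign_poly[OF assms]])
    then have "of_real (pi / 2) * (\<i> * of_real (sgn (Im z)) + poly (cpoly p) z * K z) =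
        of_real (pi / 2) * poly (cpoly (sign_poly p)) z"
      by (simp only: distrib_left mult_ac)
    then show ?thesis by simp
  qed
  ultimately show ?thesis using that by blast
qed

lemma sign_poly_root:
  assumes "p \<noteq> 0" "\<And>x. poly p x \<noteq> 0" "poly (cpoly p) z = 0"
  shows "Im z \<noteq> 0" "poly (cpoly (sign_poly p)) z = \<i> * of_real (sgn (Im z))"
proof -
  show "Im z \<noteq> 0"
  proof
    assume "Im z = 0"
    then have "z = of_real (Re z)" by (simp add: complex_eq_iff)
    then show False using assms(2)[of "Re z"] assms(3) poly_cpoly_of_real by (metis of_real_eq_0_iff)
  qed
  then show "poly (cpoly (sign_poly p)) z = \<i> * of_real (sgn (Im z))"
    using sign_poly_error[OF assms(1,2)] assms(3) by (metis add.right_neutral mult_zero_left)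
qed

text \<open>Roots of p may be multiple, so values at the roots do not suffice. Near a root mu, with
  s = sgn (Im mu), the product (g + i s)(g - i s) equals g^2 + 1; its second factor is p K with K
  bounded, so g^2 + 1 is bounded by a multiple of p and \<open>poly_dvd_if_bounded\<close>
  applies.\<close>

lemma sign_poly_square:
  assumes "p \<noteq> 0" "\<And>x. poly p x \<noteq> 0"
  shows "p dvd sign_poly p * sign_poly p + 1"
proof -
  obtain K where K: "continuous_on {z. Im z \<noteq> 0} K"
    "\<And>z. Im z \<noteq> 0 \<Longrightarrow> poly (cpoly (sign_poly p)) z = \<i> * of_real (sgn (Im z)) + poly (cpoly p) z * K z"
    using sign_poly_error[OF assms] by blast
  have op: "open {z. Im z \<noteq> 0}"
    by (intro open_Collect_neq continuous_intros)
  have "cpoly p dvd cpoly (sign_poly p * sign_poly p + 1)"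
  proof (rule poly_dvd_if_bounded)
    show "cpoly p \<noteq> 0" using assms(1) by simp
    fix \<mu> assume "poly (cpoly p) \<mu> = 0"
    then have \<mu>: "Im \<mu> \<noteq> 0" using sign_poly_root(1)[OF assms] by blast
    let ?g = "poly (cpoly (sign_poly p))" and ?X = "poly (cpoly p)"
    define B where "B z = norm (?g z + \<i> * of_real (sgn (Im \<mu>))) * norm (K z)" for z
    have "isCont K \<mu>" using K(1) op \<mu> by (simp add: continuous_on_eq_continuous_at)
    then have "isCont B \<mu>" unfolding B_def by (intro continuous_intros) auto
    then have "B \<midarrow>\<mu>\<rightarrow> B \<mu>" by (simp add: isCont_def)
    then have "\<forall>\<^sub>F z in at \<mu>. B z < B \<mu> + 1" by (rule order_tendstoD) simp
    \<comment> \<open>Near mu the point z stays in the half plane of mu, so the sign in the error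
      formula is constant there.\<close>
    moreover have "((\<lambda>z. Im z * Im \<mu>) \<longlongrightarrow> Im \<mu> * Im \<mu>) (at \<mu>)" by (intro tendsto_intros)
    then have "\<forall>\<^sub>F z in at \<mu>. Im z * Im \<mu> > 0"
      by (rule order_tendstoD) (use \<mu> in \<open>auto simp: zero_less_mult_iff\<close>)
    ultimately have "\<forall>\<^sub>F z in at \<mu>. norm (poly (cpoly (sign_poly p * sign_poly p + 1)) z) \<le> (B \<mu> + 1) * norm (?X z)"
    proof eventually_elim
      case (elim z)
      let ?i = "\<i> * of_real (sgn (Im \<mu>))"
      have "Im z \<noteq> 0" "sgn (Im z) = sgn (Im \<mu>)"
        using elim(2) by (auto simp: zero_less_mult_iff sgn_if)
      then have g: "?g z - ?i = ?X z * K z" using K(2)[of z] by simp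
      have "?i * ?i = -1" using \<mu> by (simp add: sgn_if)
      then have "poly (cpoly (sign_poly p * sign_poly p + 1)) z = (?g z + ?i) * (?g z - ?i)"
        by (simp add: cpoly_add cpoly_mult algebra_simps) 
      then have "norm (poly (cpoly (sign_poly p * sign_poly p + 1)) z) = B z * norm (?X z)"
        unfolding g by (simp add: norm_mult B_def)
      then show ?case using elim(1) by (simp add: mult_right_mono)
    qed
    then show "\<exists>C. \<forall>\<^sub>F z in at \<mu>. norm (poly (cpoly (sign_poly p * sign_poly p + 1)) z) \<le> C * norm (?X z)"
      by blast
  qed
  then show ?thesis using dvd_cpolyD assms(1) by blast
qed

text \<open>The linear algebra at one point. The link between \<open>T\<close> and p is annihilation
  alone, which Cayley--Hamilton supplies for the characteristic polynomial.\<close>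

locale annihilated_operator =
  fixes T :: "'v::real_vector \<Rightarrow> 'v" and p :: "real poly"
  assumes linear: "linear T" and nonzero: "p \<noteq> 0" and no_real_root: "\<And>x. poly p x \<noteq> 0"
    and annihilates: "\<And>v. poly_op p T v = 0"
begin

abbreviation J :: "'v \<Rightarrow> 'v"
  where "J \<equiv> poly_op (sign_poly p) T"

lemma J_J: "J (J v) = - v"
proof -
  have "poly_op (sign_poly p * sign_poly p + 1) T v = 0"
    by (rule poly_op_dvd_0[OF linear sign_poly_square[OF nonzero no_real_root] annihilates])
  then show ?thesis
    by (simp add: poly_op_add[OF linear] poly_op_mult[OF linear] eq_neg_iff_add_eq_0)
qed

text \<open>The minimal annihilator of \<open>v\<close> divides both p and q, and any complex root
  of it is shared.\<close>

lemma common_root: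
  assumes "v \<noteq> 0" "poly_op q T v = 0"
  obtains z where "poly (cpoly q) z = 0" "poly (cpoly p) z = 0"
  using minimal_annihilator[OF linear assms(1) nonzero annihilates] cpoly_root_exists cpoly_root_dvd
    assms(2) annihilates by metis

text \<open>With G = x g, where g is the sign polynomial, the eigenvector equations say that (G - Re
  z)^2 + (Im z)^2 kills u and w, so it shares a root mu with p. Hence Re z = Re G(mu), and G(mu) = i
  sgn(Im mu) mu has real part -|Im mu|.\<close>

lemma Re_eigenvalue_negative:
  assumes "u \<noteq> 0 \<or> w \<noteq> 0"
    "J (T u) = Re z *\<^sub>R u - Im z *\<^sub>R w" "J (T w) = Im z *\<^sub>R u + Re z *\<^sub>R w"
  shows "Re z < 0"
proof -
  let ?G = "pCons 0 (sign_poly p)"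
  let ?Q = "?G - [:Re z:]"
  have G: "poly_op ?G T v = J (T v)" for v
    by (simp add: poly_op_pCons[OF linear] poly_op_commute[OF linear])
  have c: "poly_op [:c:] T v = c *\<^sub>R v" for c v
    by (simp add: poly_op_pCons[OF linear] linear_0[OF linear])
  have Qu: "poly_op ?Q T u = - Im z *\<^sub>R w" and Qw: "poly_op ?Q T w = Im z *\<^sub>R u"
    unfolding poly_op_diff[OF linear] G c using assms(2,3) by simp_all
  note sc = linear_scale[OF linear_poly_op[OF linear]]
  have QQ: "poly_op (?Q * ?Q + [:Im z * Im z:]) T u = 0" "poly_op (?Q * ?Q + [:Im z * Im z:]) T w = 0"
    unfolding poly_op_add[OF linear] poly_op_mult[OF linear] c Qu Qw sc by simp_all
  obtain \<mu> where "poly (cpoly (?Q * ?Q + [:Im z * Im z:])) \<mu> = 0" and p: "poly (cpoly p) \<mu> = 0"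
    using common_root QQ assms(1) by metis
  then have "(poly (cpoly ?G) \<mu> - of_real (Re z))\<^sup>2 = - (of_real (Im z))\<^sup>2"
    by (simp only: cpoly_add cpoly_mult cpoly_diff poly_add poly_mult poly_diff)
      (simp add: cpoly_pCons power2_eq_square eq_neg_iff_add_eq_0)
  also have "\<dots> = (\<i> * of_real (Im z))\<^sup>2" by (simp add: power_mult_distrib)
  finally have "poly (cpoly ?G) \<mu> - of_real (Re z) = \<i> * of_real (Im z) \<or>
      poly (cpoly ?G) \<mu> - of_real (Re z) = - (\<i> * of_real (Im z))"
    by (simp add: power2_eq_iff)
  then have "Re (poly (cpoly ?G) \<mu>) = Re z"
    by (auto simp: complex_eq_iff)
  moreover have "poly (cpoly ?G) \<mu> = \<mu> * (\<i> * of_real (sgn (Im \<mu>)))"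
    using sign_poly_root[OF nonzero no_real_root p] by (simp add: cpoly_pCons)
  ultimately have "Re z = - \<bar>Im \<mu>\<bar>" by (simp add: abs_sgn)
  then show ?thesis using sign_poly_root(1)[OF nonzero no_real_root p] by simp
qed

text \<open>Two polynomials in \<open>T\<close> squaring to \<open>-1\<close> that differ at some vector are opposite on a nonzero
  invariant subspace, whose complexification contains an eigenvector \<open>e \<plusminus> \<i> f\<close> of \<open>T\<close>; there they cannot
  both satisfy the sign condition.\<close>

lemma sign_structure_unique:
  assumes J': "\<And>v. poly_op q T (poly_op q T v) = - v"
    and neg: "\<And>z u w. u \<noteq> 0 \<or> w \<noteq> 0 \<Longrightarrow> poly_op q T (T u) = Re z *\<^sub>R u - Im z *\<^sub>R w \<Longrightarrow>
      poly_op q T (T w) = Im z *\<^sub>R u + Re z *\<^sub>R w \<Longrightarrow> Re z < 0"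
  shows "poly_op q T v = J v"
proof (rule ccontr)
  let ?g = "sign_poly p"
  note lin = linear_poly_op[OF linear]
  assume "poly_op q T v \<noteq> J v"
  define d where "d = poly_op q T v - J v"
  have "d \<noteq> 0" using \<open>poly_op q T v \<noteq> J v\<close> by (simp add: d_def)
  \<comment> \<open>With g the sign polynomial, (q + g)(q - g) = q^2 - g^2 kills every vector
    because both squares act as -1; so \<open>q\<close> and g are opposite on \<open>d\<close> and
    on everything obtained from it by polynomials in \<open>T\<close>.\<close>
  have qg: "poly_op (q + ?g) T d = 0"
    unfolding poly_op_add[OF linear] d_def linear_diff[OF lin] J' J_J
    by (simp add: poly_op_mult_commute[OF linear, of ?g q])
  obtain m where m: "degree m > 0" "poly_op m T d = 0" "\<And>r. poly_op r T d = 0 \<Longrightarrow> m dvd r"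
    using minimal_annihilator[OF linear \<open>d \<noteq> 0\<close> nonzero annihilates] by blast
  obtain \<mu> where "poly (cpoly m) \<mu> = 0" using cpoly_root_exists[OF m(1)] by blast
  then have p: "poly (cpoly p) \<mu> = 0" using cpoly_root_dvd m(3)[OF annihilates] by blast
  note \<mu> = sign_poly_root[OF nonzero no_real_root p]
  define a b where "a = Re \<mu>" and "b = Im \<mu>"
  have b: "b \<noteq> 0" using \<mu>(1) by (simp add: b_def)
  \<comment> \<open>Applying the cofactor of the quadratic factor moves \<open>d\<close> into the
    kernel of that factor; the result is nonzero because the cofactor has degree below the minimal
    one.\<close>
  obtain r where r: "m = quadratic_factor \<mu> * r"
    using quadratic_factor_dvd[OF \<open>poly (cpoly m) \<mu> = 0\<close> \<mu>(1)] by (elim dvdE)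
  define e where "e = poly_op r T d"
  have "r \<noteq> 0" using m(1) r by auto
  then have "degree m > degree r"
    unfolding r by (subst degree_mult_eq) (auto simp: quadratic_factor_def)
  then have "\<not> m dvd r" using \<open>r \<noteq> 0\<close> dvd_imp_degree_le by fastforce
  then have "e \<noteq> 0" using m(3) by (auto simp: e_def)
  have qf: "poly_op (quadratic_factor \<mu>) T e = 0"
    using m(2) by (simp add: r e_def poly_op_mult[OF linear])
  \<comment> \<open>Chosen so that \<open>T\<close> acts on e, f by T e = a e + b f and T f = a f -
    b e, the real form of a pair of conjugate eigenvalues.\<close>
  define f where "f = (1 / b) *\<^sub>R (T e - a *\<^sub>R e)"
  have Te: "T e = a *\<^sub>R e + b *\<^sub>R f" using b by (simp add: f_def)
  have TTe: "T (T e) = (2 * a) *\<^sub>R T e - (a\<^sup>2 + b\<^sup>2) *\<^sub>R e"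
    using qf by (simp add: quadratic_factor_def poly_op_pCons[OF linear] linear_0[OF linear]
        linear_add[OF linear] linear_scale[OF linear] linear_diff[OF linear] linear_neg[OF linear] a_def b_def algebra_simps)
  have "T f = (1 / b) *\<^sub>R (a *\<^sub>R T e - (a\<^sup>2 + b\<^sup>2) *\<^sub>R e)"
    unfolding f_def by (simp add: linear_scale[OF linear] linear_diff[OF linear] TTe algebra_simps
        flip: scaleR_add_left)
  also have "\<dots> = a *\<^sub>R f - b *\<^sub>R e"
    using b by (simp add: Te algebra_simps power2_eq_square)
  finally have Tf: "T f = a *\<^sub>R f - b *\<^sub>R e" .
  \<comment> \<open>The real linear polynomial with the value i sgn b at mu. It agrees with the sign
    polynomial modulo the quadratic factor, so it computes \<open>J\<close> on
    \<open>e\<close>.\<close>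
  let ?l = "smult (sgn b / b) [:- a, 1:]"
  have "poly (cpoly [:- a, 1:]) \<mu> = \<i> * of_real b"
    by (simp add: cpoly_pCons complex_eq_iff a_def b_def)
  then have "poly (cpoly (?g - ?l)) \<mu> = 0"
    using \<mu>(2) b by (simp add: cpoly_diff cpoly_smult b_def del: smult_pCons)
  then have "poly_op (?g - ?l) T e = 0"
    by (intro poly_op_dvd_0[OF linear quadratic_factor_dvd[OF _ \<mu>(1)] qf])
  moreover have "poly_op ?l T e = sgn b *\<^sub>R f"
    by (simp add: poly_op_smult[OF linear] poly_op_pCons[OF linear] linear_0[OF linear] f_def
        del: smult_pCons)
  ultimately have "J e = sgn b *\<^sub>R f" by (simp add: poly_op_diff[OF linear])
  moreover have "poly_op (q + ?g) T e = 0"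
    unfolding e_def poly_op_mult_commute[OF linear, of "q + ?g"] qg by (simp add: linear_0[OF lin])
  ultimately have qe: "poly_op q T e = - sgn b *\<^sub>R f"
    by (simp add: poly_op_add[OF linear] eq_neg_iff_add_eq_0)
  have qTe: "poly_op q T (T e) = \<bar>b\<bar> *\<^sub>R e - (sgn b * a) *\<^sub>R f"
    unfolding poly_op_commute[OF linear, symmetric] qe
    by (simp add: linear_scale[OF linear] linear_neg[OF linear] Tf algebra_simps abs_sgn)
  have "poly_op q T (T f) = a *\<^sub>R poly_op q T f - b *\<^sub>R poly_op q T e"
    by (simp add: Tf linear_diff[OF lin] linear_scale[OF lin])
  moreover have "poly_op q T f = (1 / b) *\<^sub>R (poly_op q T (T e) - a *\<^sub>R poly_op q T e)"
    by (simp add: f_def linear_diff[OF lin] linear_scale[OF lin])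
  ultimately have qTf: "poly_op q T (T f) = (sgn b * a) *\<^sub>R e + \<bar>b\<bar> *\<^sub>R f"
    using b by (simp add: qTe qe algebra_simps) (simp add: abs_sgn sgn_if)
  \<comment> \<open>The opposite sign of \<open>q\<close> makes |b| the real part of an eigenvalue
    of q(T) T, which the sign condition forbids.\<close>
  have "\<bar>b\<bar> < 0"
    using neg[of e f "Complex \<bar>b\<bar> (sgn b * a)"] qTe qTf \<open>e \<noteq> 0\<close> by simp
  then show False by simp
qed

end

subsection \<open>Torsion of polynomials in an operator\<close>

text \<open>For commuting operators this is (Z^k - X^k) / (Z - X).\<close>

definition power_quotient :: "('f::real_vector \<Rightarrow> 'f) \<Rightarrow> ('f \<Rightarrow> 'f) \<Rightarrow> nat \<Rightarrow> 'f \<Rightarrow> 'f"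
  where "power_quotient Z X k f = (\<Sum>i<k. (Z ^^ i) ((X ^^ (k - 1 - i)) f))"

lemma power_quotient_0 [simp]: "power_quotient Z X 0 f = 0"
  by (simp add: power_quotient_def)

lemma power_quotient_Suc:
  assumes "linear Z"
  shows "power_quotient Z X (Suc k) f = Z (power_quotient Z X k f) + (X ^^ k) f"
proof -
  have "power_quotient Z X (Suc k) f = (X ^^ k) f + (\<Sum>i<k. (Z ^^ Suc i) ((X ^^ (k - 1 - i)) f))"
    unfolding power_quotient_def by (subst sum.lessThan_Suc_shift) simp
  then show ?thesis by (simp add: power_quotient_def linear_sum[OF assms] add.commute)
qed

definition commutes :: "('f \<Rightarrow> 'f) \<Rightarrow> ('f \<Rightarrow> 'f) \<Rightarrow> bool"
  where "commutes F G \<longleftrightarrow> (\<forall>f. F (G f) = G (F f))"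

lemma commutes_sym: "commutes F G \<Longrightarrow> commutes G F"
  by (simp add: commutes_def)

lemma commutes_refl: "commutes F F"
  by (simp add: commutes_def)

lemma commutes_funpow: "commutes F G \<Longrightarrow> commutes F (G ^^ k)"
  by (induction k) (simp_all add: commutes_def)

lemma commutes_diff: "linear F \<Longrightarrow> commutes F G \<Longrightarrow> commutes F H \<Longrightarrow> commutes F (\<lambda>f. G f - H f)"
  by (simp add: commutes_def linear_diff)

lemma commutes_sum_scaleR:
  "linear F \<Longrightarrow> (\<And>k. commutes F (G k)) \<Longrightarrow> commutes F (\<lambda>f. \<Sum>k\<in>I. c k *\<^sub>R G k f)"
  by (simp add: commutes_def linear_sum linear_scale)

lemma commutes_power_quotient:
  "linear F \<Longrightarrow> commutes F Z \<Longrightarrow> commutes F X \<Longrightarrow> commutes F (power_quotient Z X k)"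
  using commutes_funpow[of F Z] commutes_funpow[of F X]
  unfolding power_quotient_def commutes_def by (simp add: linear_sum)

definition op_diff :: "('f::real_vector \<Rightarrow> 'f) \<Rightarrow> ('f \<Rightarrow> 'f) \<Rightarrow> 'f \<Rightarrow> 'f"
  where "op_diff Z W f = Z f - W f"

text \<open>The formal computation behind Bogoyavlenskij's theorem that polynomials in a Haantjes operator
  are Haantjes: with \<open>P(Z) - P(X) = Q (Z - X)\<close>, the torsion expression of \<open>P\<close> is a multiple of that
  of the original operator. \<open>X\<close>, \<open>Y\<close>, \<open>Z\<close> stand for inserting the operator into the first argument,
  the second argument and the value of a bilinear map; \<open>e\<close>, \<open>e'\<close> are the contributions of the
  derivatives of the coefficients.\<close>

lemma polynomial_torsion_vanishes:
  fixes X Y Z :: "'f::real_vector \<Rightarrow> 'f" and a :: "nat \<Rightarrow> real" and m :: nat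
  defines "P \<equiv> \<lambda>W f. \<Sum>k\<le>m. a k *\<^sub>R (W ^^ k) f"
    and "Q \<equiv> \<lambda>W f. \<Sum>k\<le>m. a k *\<^sub>R power_quotient Z W k f"
  assumes lin: "linear X" "linear Y" "linear Z"
    and com: "commutes X Y" "commutes X Z" "commutes Y Z"
    and t: "t = Q Y \<tau> + e" "P Z e = P Y e" and t': "t' = Q X \<tau>' + e'" "P Z e' = P X e'"
    and vanish: "op_diff Z X (op_diff Z Y (op_diff Z Y \<tau>' - op_diff Z X \<tau>)) = 0"
    and N: "N = (P Z t' - P Y t') - (P Z t - P X t)"
  shows "P Z (P Z N - P Y N) - P X (P Z N - P Y N) = 0"
proof -
  define dX dY where "dX f = Z f - X f" and "dY f = Z f - Y f" for f
  define DX DY where "DX f = P Z f - P X f" and "DY f = P Z f - P Y f" for f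
  have linP: "linear (P W)" if "linear W" for W
    unfolding P_def using that
    by (intro linear_compose_sum linear_compose_scale_right linear_funpow ballI)
  have linQ: "linear (Q W)" if "linear W" for W
    unfolding Q_def power_quotient_def using that lin(3)
    by (intro linear_compose_sum linear_compose_scale_right ballI
        linear_compose[OF linear_funpow[OF that] linear_funpow[OF lin(3)], unfolded o_def])
  have lind: "linear dX" "linear dY" "linear DX" "linear DY"
    unfolding dX_def dY_def DX_def DY_def by (intro linear_compose_sub lin linP)+
  note sym = com com[THEN commutes_sym]
  have cP: "commutes F (P W)" if "linear F" "commutes F W" for F W
    unfolding P_def using that by (intro commutes_sum_scaleR commutes_funpow)
  have cQ: "commutes F (Q W)" if "linear F" "commutes F Z" "commutes F W" for F W
    unfolding Q_def using that by (intro commutes_sum_scaleR commutes_power_quotient)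
  have cd: "commutes F dX" "commutes F dY" if "linear F" "commutes F X" "commutes F Y" "commutes F Z" for F
    unfolding dX_def dY_def using that by (simp_all add: commutes_diff)
  have all: "commutes dX X" "commutes dX Y" "commutes dX Z" "commutes dY X" "commutes dY Y" "commutes dY Z"
    using cd lin sym commutes_refl commutes_sym by metis+
  have dQ: "commutes d (Q W)" if "d \<in> {dX, dY}" "W \<in> {X, Y}" for d W
    using that lind all by (auto intro!: cQ)
  have XQ: "commutes V (Q W)" if "V \<in> {X, Y, Z}" "W \<in> {X, Y}" for V W
    using that lin sym commutes_refl by (auto intro!: cQ)
  have QQ: "commutes (Q W) (Q W')" if "W \<in> {X, Y}" "W' \<in> {X, Y}" for W W'
    using that lin XQ[THEN commutes_sym] by (auto intro!: cQ linQ)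
  have dd: "commutes dX dY" using cd lind all by metis
  have D_power: "(Z ^^ k) f - (W ^^ k) f = power_quotient Z W k (Z f - W f)"
    if W: "linear W" "commutes Z W" for W k f
  proof (induction k)
    case (Suc k)
    have "(Z ^^ Suc k) f - (W ^^ Suc k) f = Z ((Z ^^ k) f - (W ^^ k) f) + (Z ((W ^^ k) f) - (W ^^ k) (W f))"
      by (simp add: linear_diff[OF lin(3)] funpow_swap1)
    also have "Z ((W ^^ k) f) = (W ^^ k) (Z f)"
      using commutes_funpow[OF W(2), of k] by (simp add: commutes_def)
    finally show ?case
      by (simp add: power_quotient_Suc[OF lin(3)] Suc linear_diff[OF linear_funpow[OF W(1)]])
  qed simp
  have DQ: "DX f = Q X (dX f)" "DY f = Q Y (dY f)" for f
    unfolding DX_def DY_def P_def Q_def dX_def dY_def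
    using D_power[OF lin(1) sym(5)] D_power[OF lin(2) sym(6)]
    by (simp_all flip: sum_subtractf scaleR_diff_right)
  have step: "DY (Q Y f) = Q Y (Q Y (dY f))" "DX (Q X f) = Q X (Q X (dX f))"
    "DX (Q Y f) = Q Y (Q X (dX f))" "DY (Q X f) = Q X (Q Y (dY f))" for f
    unfolding DQ using dQ QQ by (auto simp: commutes_def)
  have DD: "DX (DY f) = DY (DX f)" for f
    unfolding DQ using dQ QQ dd by (auto simp: commutes_def)
  \<comment> \<open>Derivatives of the coefficients enter only through \<open>e\<close> and
    \<open>e'\<close>, which these differences kill.\<close>
  have De: "DY e = 0" "DX e' = 0" using t(2) t'(2) by (simp_all add: DX_def DY_def)
  have "DY t = Q Y (Q Y (dY \<tau>))" "DX t' = Q X (Q X (dX \<tau>'))"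
    unfolding t(1) t'(1) linear_add[OF lind(3)] linear_add[OF lind(4)] step De by simp_all
  moreover have "DX (DY N) = DY (DY (DX t')) - DX (DX (DY t))"
    unfolding N DX_def[symmetric] DY_def[symmetric] linear_diff[OF lind(3)] linear_diff[OF lind(4)]
    by (simp add: DD)
  \<comment> \<open>Each of \<open>DX\<close>, \<open>DY\<close> is a \<open>Q\<close> factor times
    \<open>dX\<close> or \<open>dY\<close>. Since all of them commute, two factors Q X and two
    factors Q Y come out in front, leaving the torsion expression of the original operator.\<close>
  ultimately have "DX (DY N) = Q X (Q X (Q Y (Q Y (dY (dY (dX \<tau>')))))) - Q X (Q X (Q Y (Q Y (dX (dX (dY \<tau>))))))"
    unfolding DQ using dQ QQ dd by (auto simp: commutes_def)
  also have "\<dots> = Q X (Q X (Q Y (Q Y (dX (dY (dY \<tau>' - dX \<tau>))))))"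
    using dd by (simp add: linear_diff lind linQ lin commutes_def)
  also have "dX (dY (dY \<tau>' - dX \<tau>)) = 0"
    using vanish by (simp add: dX_def dY_def op_diff_def)
  finally show ?thesis by (simp add: linear_0 linQ lin DX_def DY_def)
qed

section \<open>The torsions as algebra at one point\<close>

lemma sum_fun_apply: "(\<Sum>i\<in>I. f i) x = (\<Sum>i\<in>I. f i x)"
  for f :: "'i \<Rightarrow> 'a \<Rightarrow> 'b::comm_monoid_add"
  by (induction I rule: infinite_finite_induct) auto

text \<open>In a chart, \<open>T u\<close> is the derivative of the operator \<open>M\<close> in the direction \<open>u\<close>.\<close>

definition point_nijenhuis :: "('v::real_vector \<Rightarrow> 'v) \<Rightarrow> ('v \<Rightarrow> 'v \<Rightarrow> 'v) \<Rightarrow> 'v \<Rightarrow> 'v \<Rightarrow> 'v"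
  where "point_nijenhuis M T u v = T (M u) v - T (M v) u + M (T v u) - M (T u v)"

definition point_haantjes :: "('v::real_vector \<Rightarrow> 'v) \<Rightarrow> ('v \<Rightarrow> 'v \<Rightarrow> 'v) \<Rightarrow> 'v \<Rightarrow> 'v \<Rightarrow> 'v"
  where "point_haantjes M N u v = M (M (N u v)) + N (M u) (M v) - M (N (M u) v) - M (N u (M v))"

lemma power_quotient_apply:
  fixes M :: "'v::real_vector \<Rightarrow> 'v" and f :: "'v \<Rightarrow> 'v \<Rightarrow> 'v"
  defines "X \<equiv> \<lambda>f u v. f (M u) v" and "Y \<equiv> \<lambda>f u v. f u (M v)" and "Z \<equiv> \<lambda>f u v. M (f u v)"
  shows "(X ^^ k) f u v = f ((M ^^ k) u) v" "(Y ^^ k) f u v = f u ((M ^^ k) v)"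
    "(Z ^^ k) f u v = (M ^^ k) (f u v)"
    "power_quotient Z X k f u v = (\<Sum>i<k. (M ^^ i) (f ((M ^^ (k - 1 - i)) u) v))"
    "power_quotient Z Y k f u v = (\<Sum>i<k. (M ^^ i) (f u ((M ^^ (k - 1 - i)) v)))"
proof -
  have X: "(X ^^ k) f u v = f ((M ^^ k) u) v" for k and f :: "'v \<Rightarrow> 'v \<Rightarrow> 'v" and u v
    by (induction k arbitrary: u) (simp_all add: X_def funpow_swap1)
  have Y: "(Y ^^ k) f u v = f u ((M ^^ k) v)" for k and f :: "'v \<Rightarrow> 'v \<Rightarrow> 'v" and u v
    by (induction k arbitrary: v) (simp_all add: Y_def funpow_swap1)
  have Z: "(Z ^^ k) f u v = (M ^^ k) (f u v)" for k and f :: "'v \<Rightarrow> 'v \<Rightarrow> 'v" and u v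
    by (induction k) (simp_all add: Z_def)
  show "(X ^^ k) f u v = f ((M ^^ k) u) v" "(Y ^^ k) f u v = f u ((M ^^ k) v)"
    "(Z ^^ k) f u v = (M ^^ k) (f u v)"
    "power_quotient Z X k f u v = (\<Sum>i<k. (M ^^ i) (f ((M ^^ (k - 1 - i)) u) v))"
    "power_quotient Z Y k f u v = (\<Sum>i<k. (M ^^ i) (f u ((M ^^ (k - 1 - i)) v)))"
    by (simp_all add: power_quotient_def sum_fun_apply X Y Z)
qed

text \<open>\<open>TJ\<close> is what the Leibniz rule gives for the derivative of \<open>J\<close>,
  with \<open>D k\<close> the derivative of the k-th coefficient. The formal computation is applied
  to maps of two vectors, and the swapped arguments in t' and tau' account for the antisymmetry of
  the torsion.\<close>

lemma point_haantjes_polynomial: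
  fixes M :: "'v::real_vector \<Rightarrow> 'v" and T :: "'v \<Rightarrow> 'v \<Rightarrow> 'v"
    and a :: "nat \<Rightarrow> real" and D :: "nat \<Rightarrow> 'v \<Rightarrow> real" and m :: nat
  defines "J \<equiv> \<lambda>v. \<Sum>k\<le>m. a k *\<^sub>R (M ^^ k) v"
    and "TJ \<equiv> \<lambda>u v. \<Sum>k\<le>m. D k u *\<^sub>R (M ^^ k) v +
      a k *\<^sub>R (\<Sum>i<k. (M ^^ i) (T u ((M ^^ (k - 1 - i)) v)))"
  assumes M: "linear M" and T: "\<And>u. linear (T u)" "\<And>v. linear (\<lambda>u. T u v)"
    and D: "\<And>k. linear (D k)"
    and H: "\<And>u v. point_haantjes M (point_nijenhuis M T) u v = 0"
  shows "point_haantjes J (point_nijenhuis J TJ) u v = 0"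
proof -
  let ?X = "\<lambda>f u v. f (M u) v :: 'v" and ?Y = "\<lambda>f u v. f u (M v) :: 'v" and ?Z = "\<lambda>f u v. M (f u v)"
  let ?P = "\<lambda>W (f :: 'v \<Rightarrow> 'v \<Rightarrow> 'v). \<Sum>k\<le>m. a k *\<^sub>R (W ^^ k) f"
  have J: "linear J"
    unfolding J_def using M by (intro linear_compose_sum linear_compose_scale_right linear_funpow ballI)
  note Mk = linear_funpow[OF M]
  have JM: "J ((M ^^ k) v) = (M ^^ k) (J v)" for k v
  proof (induction k)
    case (Suc k)
    have "J (M w) = M (J w)" for w
      unfolding J_def linear_sum[OF M] linear_scale[OF M] by (simp add: funpow_swap1)
    then show ?case using Suc by simp
  qed simp
  have PZ: "?P ?Z f u v = J (f u v)" for f u v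
    by (simp add: sum_fun_apply scaleR_fun_def power_quotient_apply J_def)
  \<comment> \<open>Precomposition turns a polynomial in the insertion operator into insertion of
    \<open>J\<close> only for maps linear in that argument; hence the linearity facts below.\<close>
  have PX: "?P ?X f u v = f (J u) v" if "linear (\<lambda>u. f u v)" for f u v
    by (simp add: sum_fun_apply scaleR_fun_def power_quotient_apply J_def linear_sum[OF that] linear_scale[OF that])
  have PY: "?P ?Y f u v = f u (J v)" if "linear (f u)" for f u v
    by (simp add: sum_fun_apply scaleR_fun_def power_quotient_apply J_def linear_sum[OF that] linear_scale[OF that])
  have TJ1: "linear (TJ u)" for u
    unfolding TJ_def
    by (intro linear_compose_sum linear_compose_add linear_compose_scale_right ballI Mk
        linear_compose[OF linear_compose[OF Mk T(1)] Mk, unfolded o_def])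
  have D: "linear (\<lambda>u. D k u *\<^sub>R v)" for k and v :: 'v
    by (intro linearI) (simp_all add: linear_add[OF D] linear_scale[OF D] algebra_simps)
  have TJ2: "linear (\<lambda>u. TJ u v)" for v
    unfolding TJ_def
    by (intro linear_compose_sum linear_compose_add linear_compose_scale_right ballI D
        linear_compose[OF T(2) Mk, unfolded o_def])
  \<comment> \<open>The part of \<open>TJ\<close> with differentiated coefficients. For fixed u it
    is again a polynomial in \<open>M\<close>, so it commutes with \<open>J\<close>.\<close>
  define e where "e u v = (\<Sum>k\<le>m. D k u *\<^sub>R (M ^^ k) v)" for u v
  have e: "linear (e u)" for u
    unfolding e_def by (intro linear_compose_sum linear_compose_scale_right ballI Mk)
  have eJ: "J (e u v) = e u (J v)" for u v
    unfolding e_def linear_sum[OF J] linear_scale[OF J] JM ..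
  let ?N = "point_nijenhuis J TJ"
  have 0: "?P ?Z (?P ?Z ?N - ?P ?Y ?N) - ?P ?X (?P ?Z ?N - ?P ?Y ?N) = 0"
  proof (rule polynomial_torsion_vanishes[where X = ?X and Y = ?Y and Z = ?Z
        and a = a and m = m and N = ?N and e = e and e' = "\<lambda>u v. e v u" and \<tau> = T
        and \<tau>' = "\<lambda>u v. T v u" and t = TJ and t' = "\<lambda>u v. TJ v u"])
    show "linear ?X" "linear ?Y" "linear ?Z"
      by (auto intro!: linearI simp: fun_eq_iff scaleR_fun_def linear_add[OF M] linear_scale[OF M])
    show "commutes ?X ?Y" "commutes ?X ?Z" "commutes ?Y ?Z" by (simp_all add: commutes_def)
    show "TJ = (\<Sum>k\<le>m. a k *\<^sub>R power_quotient ?Z ?Y k T) + e"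
      "(\<lambda>u v. TJ v u) = (\<Sum>k\<le>m. a k *\<^sub>R power_quotient ?Z ?X k (\<lambda>u v. T v u)) + (\<lambda>u v. e v u)"
      by (simp_all add: fun_eq_iff TJ_def e_def sum_fun_apply scaleR_fun_def power_quotient_apply
          sum.distrib)
    show "?P ?Z e = ?P ?Y e"
      by (intro ext) (simp only: PZ PY[OF e] eJ)
    show "?P ?Z (\<lambda>u v. e v u) = ?P ?X (\<lambda>u v. e v u)"
      by (intro ext) (simp only: PZ PX[OF e] eJ)
    show "?N = (?P ?Z (\<lambda>u v. TJ v u) - ?P ?Y (\<lambda>u v. TJ v u)) - (?P ?Z TJ - ?P ?X TJ)"
      by (intro ext) (simp add: PZ PX[OF TJ2] PY[OF TJ2] point_nijenhuis_def)
    have "op_diff ?Z ?Y (\<lambda>u v. T v u) - op_diff ?Z ?X T = point_nijenhuis M T"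
      by (intro ext) (simp add: op_diff_def point_nijenhuis_def)
    moreover have "op_diff ?Z ?X (op_diff ?Z ?Y f) = point_haantjes M f" for f
      by (intro ext) (simp add: op_diff_def point_haantjes_def linear_diff[OF M])
    moreover have "point_haantjes M (point_nijenhuis M T) = 0"
      by (intro ext) (simp add: H)
    ultimately show "op_diff ?Z ?X (op_diff ?Z ?Y (op_diff ?Z ?Y (\<lambda>u v. T v u) - op_diff ?Z ?X T)) = 0"
      by (simp only:)
  qed
  have N1: "linear (?N u)" and N2: "linear (\<lambda>u. ?N u v)" for u v
    unfolding point_nijenhuis_def
    by (intro linear_compose_sub linear_compose_add TJ1 TJ2 linear_compose[OF TJ1 J, unfolded o_def]
        linear_compose[OF TJ2 J, unfolded o_def] linear_compose[OF J TJ2, unfolded o_def])+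
  let ?G = "\<lambda>u v. J (?N u v) - ?N u (J v)"
  have "?P ?Z ?N - ?P ?Y ?N = ?G"
    by (intro ext) (simp add: PZ PY[OF N1])
  with 0 have "?P ?Z ?G - ?P ?X ?G = 0" by (simp only:)
  from fun_cong[OF fun_cong[OF this, of u], of v]
  have "?P ?Z ?G u v - ?P ?X ?G u v = 0" by simp
  moreover have "linear (\<lambda>u. ?G u v)"
    by (intro linear_compose_sub N2 linear_compose[OF N2 J, unfolded o_def])
  ultimately have "J (?G u v) - ?G (J u) v = 0"
    by (simp only: PZ PX)
  then show ?thesis
    by (simp add: point_haantjes_def linear_diff[OF J] algebra_simps)
qed

text \<open>The third condition on \<open>T\<close> is the derivative of J^2 = -1. It makes N
  antilinear in each argument, N(J u, v) = N(u, J v) = -J N(u, v), so all four terms of the Haantjes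
  expression equal -N.\<close>

lemma point_nijenhuis_zero:
  fixes J :: "'v::real_vector \<Rightarrow> 'v" and T :: "'v \<Rightarrow> 'v \<Rightarrow> 'v"
  assumes J: "linear J" "\<And>v. J (J v) = - v"
    and T: "\<And>u. linear (T u)" "\<And>v. linear (\<lambda>u. T u v)" "\<And>u v. T u (J v) = - J (T u v)"
    and H: "\<And>u v. point_haantjes J (point_nijenhuis J T) u v = 0"
  shows "point_nijenhuis J T u v = 0"
proof -
  let ?N = "point_nijenhuis J T"
  note lin = linear_neg[OF J(1)] linear_add[OF J(1)] linear_diff[OF J(1)]
  have N1: "?N (J u) v = - J (?N u v)" for u v
    using linear_neg[OF T(2)] by (simp add: point_nijenhuis_def J(2) T(3) lin)
  have N2: "?N u (J v) = - J (?N u v)" for u v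
    using linear_neg[OF T(2)] by (simp add: point_nijenhuis_def J(2) T(3) lin)
  have four: "4 *\<^sub>R w = w + (w + (w + w))" for w :: 'v
    using scaleR_left_distrib[of 2 2 w] by (simp add: scaleR_2)
  have "- (4::real) *\<^sub>R ?N u v = point_haantjes J ?N u v"
    unfolding point_haantjes_def N1 N2 by (simp add: lin J(2) four)
  then show ?thesis using H by simp
qed

text \<open>The Leibniz rule for an operator known to be differentiable only on fixed vectors:
  expanding the argument in a basis reduces it to scalar products.\<close>

lemma has_derivative_operator_field:
  fixes M :: "'a::real_normed_vector \<Rightarrow> 'v::euclidean_space \<Rightarrow> 'w::real_normed_vector"
  assumes lin: "\<And>x. x \<in> S \<Longrightarrow> linear (M x)" and S: "open S" "x \<in> S"
    and M: "\<And>v. ((\<lambda>x. M x v) has_derivative (\<lambda>u. DM u v)) (at x)"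
    and w: "(w has_derivative w') (at x)"
  shows "((\<lambda>x. M x (w x)) has_derivative (\<lambda>u. DM u (w x) + M x (w' u))) (at x)"
proof -
  have eq: "M y v = (\<Sum>b\<in>Basis. (v \<bullet> b) *\<^sub>R M y b)" if "y \<in> S" for y v
  proof -
    have "M y v = M y (\<Sum>b\<in>Basis. (v \<bullet> b) *\<^sub>R b)" by (simp add: euclidean_representation)
    then show ?thesis by (simp only: linear_sum[OF lin[OF that]] linear_scale[OF lin[OF that]])
  qed
  have DM: "DM u v = (\<Sum>b\<in>Basis. (v \<bullet> b) *\<^sub>R DM u b)" for u v
  proof -
    have "((\<lambda>x. \<Sum>b\<in>Basis. (v \<bullet> b) *\<^sub>R M x b) has_derivative (\<lambda>u. \<Sum>b\<in>Basis. (v \<bullet> b) *\<^sub>R DM u b)) (at x)"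
      by (intro derivative_intros M)
    then have "((\<lambda>x. M x v) has_derivative (\<lambda>u. \<Sum>b\<in>Basis. (v \<bullet> b) *\<^sub>R DM u b)) (at x)"
      by (rule has_derivative_transform_within_open[OF _ S]) (simp add: eq)
    from fun_cong[OF has_derivative_unique[OF M[of v] this], of u] show ?thesis .
  qed
  have "((\<lambda>x. \<Sum>b\<in>Basis. (w x \<bullet> b) *\<^sub>R M x b) has_derivative
      (\<lambda>u. \<Sum>b\<in>Basis. (w x \<bullet> b) *\<^sub>R DM u b + (w' u \<bullet> b) *\<^sub>R M x b)) (at x)"
    by (intro derivative_intros M w)
  then have "((\<lambda>x. M x (w x)) has_derivative
      (\<lambda>u. \<Sum>b\<in>Basis. (w x \<bullet> b) *\<^sub>R DM u b + (w' u \<bullet> b) *\<^sub>R M x b)) (at x)"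
    by (rule has_derivative_transform_within_open[OF _ S]) (simp add: eq)
  then show ?thesis
    by (rule has_derivative_eq_rhs) (auto simp: fun_eq_iff sum.distrib DM[of _ "w x"] eq[OF S(2), of "w' _"])
qed

text \<open>\<open>M\<close> need not commute with its derivative, so the Leibniz rule keeps the
  order of the factors; the indexing matches \<open>power_quotient\<close>.\<close>

lemma has_derivative_operator_power:
  fixes M :: "'a::real_normed_vector \<Rightarrow> 'v::euclidean_space \<Rightarrow> 'v"
  assumes lin: "\<And>x. x \<in> S \<Longrightarrow> linear (M x)" and S: "open S" "x \<in> S"
    and M: "\<And>v. ((\<lambda>x. M x v) has_derivative (\<lambda>u. DM u v)) (at x)"
  shows "((\<lambda>x. (M x ^^ k) v) has_derivative
    (\<lambda>u. \<Sum>i<k. (M x ^^ i) (DM u ((M x ^^ (k - 1 - i)) v)))) (at x)"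
proof (induction k)
  case (Suc k)
  have "(\<lambda>u. DM u ((M x ^^ k) v) + M x (\<Sum>i<k. (M x ^^ i) (DM u ((M x ^^ (k - 1 - i)) v)))) =
      (\<lambda>u. \<Sum>i<Suc k. (M x ^^ i) (DM u ((M x ^^ (Suc k - 1 - i)) v)))"
    by (intro ext, subst sum.lessThan_Suc_shift) (simp add: linear_sum[OF lin[OF S(2)]])
  then show ?case
    using has_derivative_operator_field[OF lin S M Suc] by simp
qed simp

lemma scaleR_fun_apply: "(r *\<^sub>R f) x = r *\<^sub>R f x"
  by (simp add: scaleR_fun_def)

subsection \<open>Tangent vectors and operators in charts\<close>

locale manifold =
  fixes X :: "'a topology" and A :: "('a, 'n::finite) chart set"
  assumes manifold: "smooth_manifold X A"
begin

lemma chart: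
  assumes "c \<in> A"
  shows "openin X (fst c)" "open (chart_image c)" "inj_on (snd c) (fst c)"
    "homeomorphic_map (subtopology X (fst c)) (top_of_set (chart_image c)) (snd c)"
    "topspace (subtopology X (fst c)) = fst c"
proof -
  have "is_chart X c" using manifold assms by (simp add: smooth_manifold_def)
  then show o: "openin X (fst c)" "open (chart_image c)" 
    and h: "homeomorphic_map (subtopology X (fst c)) (top_of_set (chart_image c)) (snd c)"
    by (auto simp: is_chart_def)
  show t: "topspace (subtopology X (fst c)) = fst c"
    using openin_subset[OF o(1)] by auto
  show "inj_on (snd c) (fst c)"
    using homeomorphic_imp_injective_map[OF h] t by simp
qed

lemma chart_inv: "c \<in> A \<Longrightarrow> p \<in> fst c \<Longrightarrow> chart_inv c (snd c p) = p"
  by (simp add: chart_inv_def chart)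

lemma chart_image: "p \<in> fst c \<Longrightarrow> snd c p \<in> chart_image c"
  by (simp add: chart_image_def)

lemma chart_imageE:
  assumes "x \<in> chart_image c" "c \<in> A"
  obtains p where "p \<in> fst c" "x = snd c p" "chart_inv c x = p"
  using assms chart_inv by (auto simp: chart_image_def)

lemma in_topspace: "c \<in> A \<Longrightarrow> p \<in> fst c \<Longrightarrow> p \<in> topspace X"
  using chart(1) openin_subset by blast

lemma chart_exists: "p \<in> topspace X \<Longrightarrow> \<exists>c\<in>A. p \<in> fst c"
  using manifold by (auto simp: smooth_manifold_def)

definition overlap :: "('a, 'n) chart \<Rightarrow> ('a, 'n) chart \<Rightarrow> (real ^ 'n) set"
  where "overlap c c' = snd c ` (fst c \<inter> fst c')"

lemma open_chart_part:
  assumes "c \<in> A" "openin X U"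
  shows "open (snd c ` (fst c \<inter> U))"
proof -
  have "openin (subtopology X (fst c)) (fst c \<inter> U)"
    using assms(2) by (auto simp: openin_subtopology)
  then have "openin (top_of_set (chart_image c)) (snd c ` (fst c \<inter> U))"
    using homeomorphic_imp_open_map[OF chart(4)[OF assms(1)]] by (simp add: open_map_def)
  then show ?thesis using openin_open_trans chart(2)[OF assms(1)] by blast
qed

lemma open_overlap: "c \<in> A \<Longrightarrow> c' \<in> A \<Longrightarrow> open (overlap c c')"
  unfolding overlap_def by (rule open_chart_part) (auto simp: chart)

lemma in_overlap: "p \<in> fst c \<Longrightarrow> p \<in> fst c' \<Longrightarrow> snd c p \<in> overlap c c'"
  by (auto simp: overlap_def)

lemma overlapE:
  assumes "x \<in> overlap c c'" "c \<in> A"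
  obtains p where "p \<in> fst c" "p \<in> fst c'" "x = snd c p" "chart_inv c x = p"
  using assms chart_inv by (auto simp: overlap_def)

lemma transition: "c \<in> A \<Longrightarrow> p \<in> fst c \<Longrightarrow> transition c c' (snd c p) = snd c' p"
  by (simp add: transition_def chart_inv)

lemma smooth_transition: "c \<in> A \<Longrightarrow> c' \<in> A \<Longrightarrow> smooth_on (overlap c c') (transition c c')"
  using manifold by (auto simp: smooth_manifold_def overlap_def)

definition jac :: "('a, 'n) chart \<Rightarrow> ('a, 'n) chart \<Rightarrow> 'a \<Rightarrow> real ^ 'n \<Rightarrow> real ^ 'n"
  where "jac c c' p = frechet_derivative (transition c c') (at (snd c p))"

lemma jac:
  assumes "c \<in> A" "c' \<in> A" "p \<in> fst c" "p \<in> fst c'"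
  shows "(transition c c' has_derivative jac c c' p) (at (snd c p))"
  unfolding jac_def
  using smooth_on_derivative[OF smooth_transition] assms by (simp add: in_overlap)

lemma linear_jac:
  "c \<in> A \<Longrightarrow> c' \<in> A \<Longrightarrow> p \<in> fst c \<Longrightarrow> p \<in> fst c' \<Longrightarrow> linear (jac c c' p)"
  using jac has_derivative_linear by blast

lemma jac_cocycle:
  assumes "c \<in> A" "c' \<in> A" "c'' \<in> A" "p \<in> fst c" "p \<in> fst c'" "p \<in> fst c''"
  shows "jac c' c'' p (jac c c' p v) = jac c c'' p v"
proof -
  have "(transition c' c'' has_derivative jac c' c'' p) (at (transition c c' (snd c p)))"
    using jac[of c' c'' p] assms by (simp add: transition)
  from has_derivative_compose[OF jac[OF assms(1,2,4,5)] this]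
  have "((\<lambda>x. transition c' c'' (transition c c' x)) has_derivative
      (\<lambda>v. jac c' c'' p (jac c c' p v))) (at (snd c p))" .
  then have "(transition c c'' has_derivative (\<lambda>v. jac c' c'' p (jac c c' p v))) (at (snd c p))"
    by (rule has_derivative_transform_within_open[of _ _ _ _ "overlap c c'"])
      (use assms in \<open>auto simp: open_overlap in_overlap transition elim!: overlapE\<close>)
  from has_derivative_unique[OF this jac[OF assms(1,3,4,6)]] show ?thesis by metis
qed

lemma jac_same:
  assumes "c \<in> A" "p \<in> fst c"
  shows "jac c c p v = v"
proof -
  have "(transition c c has_derivative (\<lambda>v. v)) (at (snd c p))"
    by (rule has_derivative_transform_within_open[OF has_derivative_ident open_overlap[OF assms(1) assms(1)]])
      (use assms in \<open>auto simp: in_overlap transition elim!: overlapE\<close>)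
  from has_derivative_unique[OF this jac[OF assms(1,1,2,2)]] show ?thesis by metis
qed

lemma tangent_space_iff:
  "v \<in> tangent_space A p \<longleftrightarrow> (\<forall>c. \<not> (c \<in> A \<and> p \<in> fst c) \<longrightarrow> v c = 0) \<and>
    (\<forall>c\<in>A. \<forall>c'\<in>A. p \<in> fst c \<and> p \<in> fst c' \<longrightarrow> v c' = jac c c' p (v c))"
  by (simp add: tangent_space_def jac_def)

lemma tangentD:
  assumes "v \<in> tangent_space A p" "c \<in> A" "c' \<in> A" "p \<in> fst c" "p \<in> fst c'"
  shows "v c' = jac c c' p (v c)"
  using assms unfolding tangent_space_iff by blast

lemma tangent_outside: "v \<in> tangent_space A p \<Longrightarrow> \<not> (c \<in> A \<and> p \<in> fst c) \<Longrightarrow> v c = 0"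
  unfolding tangent_space_iff by blast

text \<open>One chart determines a tangent vector because the Jacobians determine the other
  components. Identities on the manifold are reduced to coordinates through this.\<close>

lemma tangent_eqI:
  assumes "v \<in> tangent_space A p" "w \<in> tangent_space A p" "c \<in> A" "p \<in> fst c" "v c = w c"
  shows "v = w"
proof
  fix c'
  show "v c' = w c'"
    using tangentD[OF assms(1,3)] tangentD[OF assms(2,3)] assms(4,5)
      tangent_outside[OF assms(1)] tangent_outside[OF assms(2)] by metis
qed

lemma coordinate_vector_eq:
  "coordinate_vector A c e p c' = (if c' \<in> A \<and> p \<in> fst c' then jac c c' p e else 0)"
  by (simp add: coordinate_vector_def jac_def)

lemma coordinate_vector_tangent:
  assumes "c \<in> A" "p \<in> fst c"
  shows "coordinate_vector A c e p \<in> tangent_space A p"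
  using assms by (auto simp: tangent_space_iff coordinate_vector_eq jac_cocycle)

lemma coordinate_vector_same: "c \<in> A \<Longrightarrow> p \<in> fst c \<Longrightarrow> coordinate_vector A c e p c = e"
  by (simp add: coordinate_vector_eq jac_same)

lemma tangent_coordinate:
  assumes "v \<in> tangent_space A p" "c \<in> A" "p \<in> fst c"
  shows "coordinate_vector A c (v c) p = v"
  by (rule tangent_eqI[OF coordinate_vector_tangent assms]) (use assms in \<open>simp_all add: coordinate_vector_same\<close>)

lemma subspace_tangent_space: "subspace (tangent_space A p)"
  unfolding subspace_def
proof (intro conjI ballI allI)
  note lin = linear_0[OF linear_jac] linear_add[OF linear_jac] linear_scale[OF linear_jac]
  show "0 \<in> tangent_space A p" by (simp add: tangent_space_iff lin)
  fix v assume v: "v \<in> tangent_space A p"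
  show "r *\<^sub>R v \<in> tangent_space A p" for r
    unfolding tangent_space_iff
  proof (intro conjI allI ballI impI)
    fix c c' assume "c \<in> A" "c' \<in> A" "p \<in> fst c \<and> p \<in> fst c'"
    then show "(r *\<^sub>R v) c' = jac c c' p ((r *\<^sub>R v) c)"
      using tangentD[OF v, of c c'] by (simp add: scaleR_fun_apply lin)
  qed (simp add: scaleR_fun_apply tangent_outside[OF v])
  show "v + w \<in> tangent_space A p" if w: "w \<in> tangent_space A p" for w
    unfolding tangent_space_iff
  proof (intro conjI allI ballI impI)
    fix c c' assume "c \<in> A" "c' \<in> A" "p \<in> fst c \<and> p \<in> fst c'"
    then show "(v + w) c' = jac c c' p ((v + w) c)"
      using tangentD[OF v, of c c'] tangentD[OF w, of c c'] by (simp add: lin)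
  qed (simp add: tangent_outside[OF v] tangent_outside[OF w])
qed

lemmas tangent_add = subspace_add[OF subspace_tangent_space]
  and tangent_diff = subspace_diff[OF subspace_tangent_space]
  and tangent_scale = subspace_scale[OF subspace_tangent_space]
  and tangent_sum = subspace_sum[OF subspace_tangent_space]
  and tangent_neg = subspace_neg[OF subspace_tangent_space]
  and tangent_0 = subspace_0[OF subspace_tangent_space]

section \<open>Operator fields in coordinates\<close>

definition op_coord :: "('a, 'n) chart \<Rightarrow> ('a, 'n) op_field \<Rightarrow> real ^ 'n \<Rightarrow> real ^ 'n \<Rightarrow> real ^ 'n"
  where "op_coord c L x e = local_field c (\<lambda>p. L p (coordinate_vector A c e p)) x"

lemma op_coord_eq:
  "c \<in> A \<Longrightarrow> p \<in> fst c \<Longrightarrow> op_coord c L (snd c p) e = L p (coordinate_vector A c e p) c"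
  by (simp add: op_coord_def local_field_def chart_inv)

lemma operator_tangent:
  "operator_field X A L \<Longrightarrow> p \<in> topspace X \<Longrightarrow> v \<in> tangent_space A p \<Longrightarrow> L p v \<in> tangent_space A p"
  by (auto simp: operator_field_def)

lemma operator_linear:
  assumes "operator_field X A L" "p \<in> topspace X" "v \<in> tangent_space A p"
  shows "w \<in> tangent_space A p \<Longrightarrow> L p (v + w) = L p v + L p w" "L p (r *\<^sub>R v) = r *\<^sub>R L p v"
  using assms by (auto simp: operator_field_def)

lemma operator_coordinates:
  assumes "c \<in> A" "p \<in> fst c" "v \<in> tangent_space A p"
  shows "L p v c = op_coord c L (snd c p) (v c)"
  using assms by (simp add: op_coord_eq tangent_coordinate)

lemma linear_op_coord:
  assumes "operator_field X A L" "c \<in> A" "x \<in> chart_image c"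
  shows "linear (op_coord c L x)"
proof -
  obtain p where p: "p \<in> fst c" "x = snd c p" using chart_imageE[OF assms(3,2)] by blast
  note T = coordinate_vector_tangent[OF assms(2) p(1)]
  note lin = operator_linear[OF assms(1) in_topspace[OF assms(2) p(1)]]
  have add: "coordinate_vector A c (e + e') p = coordinate_vector A c e p + coordinate_vector A c e' p" for e e'
    by (rule tangent_eqI[OF T tangent_add[OF T T] assms(2) p(1)])
      (simp add: coordinate_vector_same assms(2) p(1))
  have scale: "coordinate_vector A c (r *\<^sub>R e) p = r *\<^sub>R coordinate_vector A c e p" for r e
    by (rule tangent_eqI[OF T tangent_scale[OF T] assms(2) p(1)])
      (simp add: coordinate_vector_same assms(2) p(1) scaleR_fun_apply)
  show ?thesis
    by (rule linearI)
      (simp_all add: p op_coord_eq[OF assms(2)] add scale lin T scaleR_fun_apply)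
qed

lemma smooth_op_coord:
  assumes "operator_field X A L" "c \<in> A"
  shows "smooth_on (chart_image c) (\<lambda>x. op_coord c L x e)"
  using assms unfolding op_coord_def operator_field_def by simp

lemma operator_power:
  assumes "operator_field X A L" "c \<in> A" "p \<in> fst c" "v \<in> tangent_space A p"
  shows "(L p ^^ k) v \<in> tangent_space A p"
    "(L p ^^ k) v c = (op_coord c L (snd c p) ^^ k) (v c)"
proof (induction k)
  case (Suc k)
  show "(L p ^^ Suc k) v \<in> tangent_space A p"
    using Suc(1) operator_tangent[OF assms(1) in_topspace[OF assms(2,3)]] by simp
  show "(L p ^^ Suc k) v c = (op_coord c L (snd c p) ^^ Suc k) (v c)"
    using Suc operator_coordinates[OF assms(2,3), of "(L p ^^ k) v" L] by simp
qed (use assms in auto)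

lemma op_coord_change:
  assumes "operator_field X A L" "c \<in> A" "c' \<in> A" "p \<in> fst c" "p \<in> fst c'"
  shows "op_coord c' L (snd c' p) e = jac c c' p (op_coord c L (snd c p) (jac c' c p e))"
proof -
  let ?v = "coordinate_vector A c' e p"
  note T = coordinate_vector_tangent[OF assms(3,5), of e]
  have "op_coord c' L (snd c' p) e = L p ?v c'" by (rule op_coord_eq[OF assms(3,5)])
  also have "\<dots> = jac c c' p (L p ?v c)"
    using tangentD[OF operator_tangent[OF assms(1) in_topspace[OF assms(2,4)] T] assms(2-5)] .
  also have "L p ?v c = op_coord c L (snd c p) (?v c)"
    by (rule operator_coordinates[OF assms(2,4) T])
  finally show ?thesis using assms(2,4) by (simp add: coordinate_vector_eq)
qed

text \<open>A change of chart conjugates the coordinate matrix by the Jacobian. Hence the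
  coefficients are functions on the whole manifold.\<close>

lemma charpoly_chart_independent:
  assumes "operator_field X A L" "c \<in> A" "c' \<in> A" "p \<in> fst c" "p \<in> fst c'"
  shows "charpoly (matrix (op_coord c' L (snd c' p))) = charpoly (matrix (op_coord c L (snd c p)))"
proof -
  let ?M = "op_coord c L (snd c p)"
  note M = linear_op_coord[OF assms(1,2) chart_image[OF assms(4)]]
  note j = linear_jac[OF assms(2,3,4,5)] and j' = linear_jac[OF assms(3,2,5,4)]
  have "matrix (op_coord c' L (snd c' p)) = matrix (jac c c' p \<circ> ?M \<circ> jac c' c p)"
    by (rule arg_cong[where f = matrix]) (auto simp: op_coord_change[OF assms])
  also have "\<dots> = matrix (jac c c' p) ** matrix ?M ** matrix (jac c' c p)"
    using M j j' by (simp add: matrix_compose linear_compose matrix_mul_assoc)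
  also have "charpoly \<dots> = charpoly (matrix ?M)"
  proof (rule charpoly_similar)
    have "jac c c' p \<circ> jac c' c p = id"
      using assms by (auto simp: jac_cocycle jac_same)
    then show "matrix (jac c c' p) ** matrix (jac c' c p) = mat 1"
      using matrix_compose[OF j' j] by (simp add: matrix_id_mat_1)
  qed
  finally show ?thesis .
qed

lemma local_field_eq: "c \<in> A \<Longrightarrow> p \<in> fst c \<Longrightarrow> local_field c \<xi> (snd c p) = \<xi> p c"
  by (simp add: local_field_def chart_inv)

lemma vector_field_tangent:
  "vector_field X A \<xi> \<Longrightarrow> p \<in> topspace X \<Longrightarrow> \<xi> p \<in> tangent_space A p"
  by (simp add: vector_field_def)

lemma local_field_operator:
  assumes "vector_field X A \<xi>" "c \<in> A" "x \<in> chart_image c"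
  shows "local_field c (L \<star> \<xi>) x = op_coord c L x (local_field c \<xi> x)"
proof -
  obtain p where p: "p \<in> fst c" "x = snd c p" using chart_imageE[OF assms(3,2)] by blast
  show ?thesis
    using operator_coordinates[OF assms(2) p(1), of "\<xi> p" L] vector_field_tangent[OF assms(1)] in_topspace[OF assms(2) p(1)]
    by (simp add: p local_field_eq[OF assms(2)] field_app_def)
qed

lemma vector_field_operator:
  assumes L: "operator_field X A L" and \<xi>: "vector_field X A \<xi>"
  shows "vector_field X A (L \<star> \<xi>)"
  unfolding vector_field_def
proof (intro conjI ballI)
  show "(L \<star> \<xi>) p \<in> tangent_space A p" if "p \<in> topspace X" for p
    using operator_tangent[OF L that] vector_field_tangent[OF \<xi> that] by (simp add: field_app_def)
  fix c assume c: "c \<in> A"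
  note o = chart(2)[OF c]
  have "smooth_on (chart_image c) (local_field c \<xi>)"
    using \<xi> c by (simp add: vector_field_def)
  then have "smooth_on (chart_image c) (\<lambda>x. local_field c \<xi> x \<bullet> b)" for b
    by (rule smooth_on_bounded_linear_compose[OF o bounded_linear_inner_left])
  then have "smooth_on (chart_image c) (\<lambda>x. \<Sum>b\<in>Basis. (local_field c \<xi> x \<bullet> b) *\<^sub>R op_coord c L x b)"
    by (intro smooth_on_sum smooth_on_scaleR smooth_op_coord L c o)
  then show "smooth_on (chart_image c) (local_field c (L \<star> \<xi>))"
  proof (rule smooth_on_cong[OF o, rotated])
    fix x assume x: "x \<in> chart_image c"
    note lin = linear_op_coord[OF L c x]
    show "(\<Sum>b\<in>Basis. (local_field c \<xi> x \<bullet> b) *\<^sub>R op_coord c L x b) = local_field c (L \<star> \<xi>) x"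
      using local_field_operator[OF \<xi> c x, of L]
      by (simp add: euclidean_representation flip: linear_scale[OF lin] linear_sum[OF lin])
  qed
qed

end

subsection \<open>Symmetry of second derivatives and bump functions\<close>

lemma has_real_derivative_along_line:
  fixes f :: "'a::real_normed_vector \<Rightarrow> real"
  assumes "(f has_derivative f') (at (w + s *\<^sub>R u))"
  shows "((\<lambda>s. f (w + s *\<^sub>R u)) has_real_derivative f' u) (at s)"
proof -
  have "((\<lambda>s. w + s *\<^sub>R u) has_derivative (\<lambda>h. h *\<^sub>R u)) (at s)"
    by (auto intro!: derivative_eq_intros)
  from has_derivative_compose[OF this assms] show ?thesis
    using has_derivative_linear[OF assms] by (simp add: has_field_derivative_def linear_scale mult_commute_abs)
qed

text \<open>The mean value theorem is applied first in direction u, to the difference over a step in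
  v, and then in direction v to the resulting first derivative.\<close>

lemma second_difference_mean_value:
  fixes f :: "'a::real_normed_vector \<Rightarrow> real"
  assumes f: "\<And>y. y \<in> S \<Longrightarrow> (f has_derivative Df y) (at y)"
    and Df: "\<And>y. y \<in> S \<Longrightarrow> ((\<lambda>y. Df y u) has_derivative DDf y) (at y)"
    and S: "\<And>s t. 0 \<le> s \<Longrightarrow> s \<le> h \<Longrightarrow> 0 \<le> t \<Longrightarrow> t \<le> h \<Longrightarrow> x + s *\<^sub>R u + t *\<^sub>R v \<in> S"
    and h: "0 < h"
  obtains s t where "0 \<le> s" "s \<le> h" "0 \<le> t" "t \<le> h"
    "f (x + h *\<^sub>R u + h *\<^sub>R v) - f (x + h *\<^sub>R u) - f (x + h *\<^sub>R v) + f x = h * h * DDf (x + s *\<^sub>R u + t *\<^sub>R v) v"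
proof -
  let ?\<phi> = "\<lambda>s. f (x + h *\<^sub>R v + s *\<^sub>R u) - f (x + s *\<^sub>R u)"
  have "\<exists>s. 0 < s \<and> s < h \<and> ?\<phi> h - ?\<phi> 0 = (h - 0) * (Df (x + h *\<^sub>R v + s *\<^sub>R u) u - Df (x + s *\<^sub>R u) u)"
  proof (rule MVT2[OF h])
    fix s assume s: "0 \<le> s" "s \<le> h"
    have "x + h *\<^sub>R v + s *\<^sub>R u \<in> S" "x + s *\<^sub>R u \<in> S"
      using S[of s h] S[of s 0] s h by (simp_all add: add_ac)
    then show "(?\<phi> has_real_derivative (Df (x + h *\<^sub>R v + s *\<^sub>R u) u - Df (x + s *\<^sub>R u) u)) (at s)"
      by (intro DERIV_diff has_real_derivative_along_line f)
  qed
  then obtain s where s: "0 < s" "s < h"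
    and \<phi>: "?\<phi> h - ?\<phi> 0 = h * (Df (x + h *\<^sub>R v + s *\<^sub>R u) u - Df (x + s *\<^sub>R u) u)" by auto
  let ?\<psi> = "\<lambda>t. Df (x + s *\<^sub>R u + t *\<^sub>R v) u"
  have "\<exists>t. 0 < t \<and> t < h \<and> ?\<psi> h - ?\<psi> 0 = (h - 0) * DDf (x + s *\<^sub>R u + t *\<^sub>R v) v"
  proof (rule MVT2[OF h])
    fix t assume "0 \<le> t" "t \<le> h"
    then have "x + s *\<^sub>R u + t *\<^sub>R v \<in> S" using S s by simp
    from has_real_derivative_along_line[OF Df[OF this]]
    show "(?\<psi> has_real_derivative DDf (x + s *\<^sub>R u + t *\<^sub>R v) v) (at t)" .
  qed
  then obtain t where t: "0 < t" "t < h" and \<psi>: "?\<psi> h - ?\<psi> 0 = h * DDf (x + s *\<^sub>R u + t *\<^sub>R v) v"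
    by auto
  have "f (x + h *\<^sub>R u + h *\<^sub>R v) - f (x + h *\<^sub>R u) - f (x + h *\<^sub>R v) + f x = ?\<phi> h - ?\<phi> 0"
    by (simp add: add_ac)
  also have "\<dots> = h * (?\<psi> h - ?\<psi> 0)" unfolding \<phi> by (simp add: add_ac)
  finally show ?thesis unfolding \<psi> by (intro that[of s t]) (use s t in simp_all)
qed

text \<open>The second difference over a small parallelogram is symmetric in u and v and equals h^2
  times either mixed derivative at a nearby point; continuity finishes.\<close>

lemma symmetric_second_derivative_real:
  fixes f :: "'a::real_normed_vector \<Rightarrow> real"
  assumes S: "open S" "x \<in> S" and f: "smooth_on S f"
  shows "frechet_derivative (\<lambda>y. frechet_derivative f (at y) u) (at x) v =
    frechet_derivative (\<lambda>y. frechet_derivative f (at y) v) (at x) u"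
proof -
  define D where "D u y = frechet_derivative f (at y) u" for u y
  define g where "g u v y = frechet_derivative (D u) (at y) v" for u v y
  note d1 = smooth_on_derivative[OF f]
  have sD: "smooth_on S (D u)" for u
    unfolding D_def by (rule smooth_on_frechet_derivative[OF f])
  have d2: "((\<lambda>y. frechet_derivative f (at y) u) has_derivative (\<lambda>v. g u v y)) (at y)" if "y \<in> S" for u y
    using smooth_on_derivative[OF sD that, of u] unfolding g_def D_def[abs_def] .
  have "smooth_on S (g u v)" for u v
    unfolding g_def by (rule smooth_on_frechet_derivative[OF sD])
  then have "isCont (g u v) x" for u v
    using smooth_on_imp_continuous_on S continuous_on_eq_continuous_at by blast
  then have cont: "(g u v \<longlongrightarrow> g u v x) (nhds x)" for u v
    by (simp add: isCont_def tendsto_at_iff_tendsto_nhds)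
  have "\<bar>g u v x - g v u x\<bar> \<le> e" if e: "e > 0" for e
  proof -
    have "\<forall>\<^sub>F y in nhds x. dist (g u v y) (g u v x) < e / 2 \<and> dist (g v u y) (g v u x) < e / 2 \<and> y \<in> S"
      using tendstoD[OF cont, of "e / 2"] e S
      by (intro eventually_conj) (auto simp: eventually_nhds_in_open)
    then obtain \<delta> where \<delta>: "\<delta> > 0" and near: "\<And>y. dist y x < \<delta> \<Longrightarrow>
        dist (g u v y) (g u v x) < e / 2 \<and> dist (g v u y) (g v u x) < e / 2 \<and> y \<in> S"
      unfolding eventually_nhds_metric by blast
    have half: "\<delta> / (2 * k) * k = \<delta> / 2" if "k > 0" for k using that by simp
    \<comment> \<open>Small enough for the parallelogram with sides h u and h v to stay within delta
      of x; the summand 1 covers u = v = 0.\<close>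
    define h where "h = \<delta> / (2 * (norm u + norm v + 1))"
    have n: "norm u + norm v + 1 > 0" by (simp add: add_nonneg_pos)
    then have h: "h > 0" using \<delta> by (simp add: h_def)
    have close: "dist (x + s *\<^sub>R a + t *\<^sub>R b) x < \<delta>"
      if "0 \<le> s" "s \<le> h" "0 \<le> t" "t \<le> h" "a = u \<and> b = v \<or> a = v \<and> b = u" for s t a b
    proof -
      have "dist (x + s *\<^sub>R a + t *\<^sub>R b) x = norm (s *\<^sub>R a + t *\<^sub>R b)" by (simp add: dist_norm add.assoc)
      also have "\<dots> \<le> s * norm a + t * norm b"
        using norm_triangle_ineq[of "s *\<^sub>R a" "t *\<^sub>R b"] that by simp
      also have "\<dots> \<le> h * norm a + h * norm b"
        using that by (intro add_mono mult_right_mono) auto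
      also have "\<dots> = h * (norm u + norm v)"
        using that(5) by (auto simp: algebra_simps)
      also have "\<dots> \<le> h * (norm u + norm v + 1)" using h by simp
      also have "\<dots> = \<delta> / 2" unfolding h_def by (rule half[OF n])
      finally show ?thesis using \<delta> by simp
    qed
    obtain s t where st: "0 \<le> s" "s \<le> h" "0 \<le> t" "t \<le> h"
      "f (x + h *\<^sub>R u + h *\<^sub>R v) - f (x + h *\<^sub>R u) - f (x + h *\<^sub>R v) + f x = h * h * g u v (x + s *\<^sub>R u + t *\<^sub>R v)"
      by (rule second_difference_mean_value[OF d1 d2, where h = h and x = x and u = u and v = v]) (use close near h in auto)
    obtain s' t' where st': "0 \<le> s'" "s' \<le> h" "0 \<le> t'" "t' \<le> h"
      "f (x + h *\<^sub>R v + h *\<^sub>R u) - f (x + h *\<^sub>R v) - f (x + h *\<^sub>R u) + f x = h * h * g v u (x + s' *\<^sub>R v + t' *\<^sub>R u)"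
      by (rule second_difference_mean_value[OF d1 d2, where h = h and x = x and u = v and v = u]) (use close near h in auto)
    have "h * h * g u v (x + s *\<^sub>R u + t *\<^sub>R v) = h * h * g v u (x + s' *\<^sub>R v + t' *\<^sub>R u)"
      unfolding st(5)[symmetric] st'(5)[symmetric] by (simp add: add_ac)
    then have "g u v (x + s *\<^sub>R u + t *\<^sub>R v) = g v u (x + s' *\<^sub>R v + t' *\<^sub>R u)"
      using h by simp
    moreover have "dist (g u v (x + s *\<^sub>R u + t *\<^sub>R v)) (g u v x) < e / 2"
      using near[OF close[OF st(1-4)]] by simp
    moreover have "dist (g v u (x + s' *\<^sub>R v + t' *\<^sub>R u)) (g v u x) < e / 2"
      using near[OF close[OF st'(1-4)]] by simp
    ultimately show ?thesis unfolding dist_real_def by linarith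
  qed
  then have "\<bar>g u v x - g v u x\<bar> \<le> 0" by (rule field_le_epsilon) simp
  then show ?thesis by (simp add: g_def D_def[abs_def])
qed

lemma symmetric_second_derivative:
  fixes f :: "'a::real_normed_vector \<Rightarrow> 'b::euclidean_space"
  assumes S: "open S" "x \<in> S" and f: "smooth_on S f"
  shows "frechet_derivative (\<lambda>y. frechet_derivative f (at y) u) (at x) v =
    frechet_derivative (\<lambda>y. frechet_derivative f (at y) v) (at x) u"
proof (rule euclidean_eqI)
  fix b :: 'b
  let ?fb = "\<lambda>y. f y \<bullet> b"
  have fb: "smooth_on S ?fb"
    by (rule smooth_on_bounded_linear_compose[OF S(1) bounded_linear_inner_left f])
  have d: "frechet_derivative ?fb (at y) u = frechet_derivative f (at y) u \<bullet> b" if "y \<in> S" for u y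
    using has_derivative_unique[OF smooth_on_derivative[OF fb that]
        has_derivative_inner_left[OF smooth_on_derivative[OF f that], of b]] by metis
  have dd: "frechet_derivative (\<lambda>y. frechet_derivative ?fb (at y) u) (at x) v =
      frechet_derivative (\<lambda>y. frechet_derivative f (at y) u) (at x) v \<bullet> b" for u v
  proof -
    have "((\<lambda>y. frechet_derivative f (at y) u \<bullet> b) has_derivative
        (\<lambda>v. frechet_derivative (\<lambda>y. frechet_derivative f (at y) u) (at x) v \<bullet> b)) (at x)"
      by (rule has_derivative_inner_left[OF smooth_on_derivative[OF smooth_on_frechet_derivative[OF f] S(2)]])
    then have "((\<lambda>y. frechet_derivative ?fb (at y) u) has_derivative
        (\<lambda>v. frechet_derivative (\<lambda>y. frechet_derivative f (at y) u) (at x) v \<bullet> b)) (at x)"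
      by (rule has_derivative_transform_within_open[OF _ S]) (simp add: d)
    from has_derivative_unique[OF smooth_on_derivative[OF smooth_on_frechet_derivative[OF fb] S(2)] this]
    show ?thesis by metis
  qed
  show "frechet_derivative (\<lambda>y. frechet_derivative f (at y) u) (at x) v \<bullet> b =
    frechet_derivative (\<lambda>y. frechet_derivative f (at y) v) (at x) u \<bullet> b"
    using symmetric_second_derivative_real[OF S fb, of u v] unfolding dd .
qed

text \<open>The polynomial factor makes the family of functions p(1/t) exp(-1/t) closed under
  differentiation, so one induction proves all of them smooth.\<close>

definition flat :: "real poly \<Rightarrow> real \<Rightarrow> real"
  where "flat p t = (if t > 0 then poly p (1 / t) * exp (- (1 / t)) else 0)"

text \<open>In x = 1 / t, the factor x^2 and the sign of p - p' come from the derivative -1 / t^2 of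
  1 / t.\<close>

definition flat_deriv :: "real poly \<Rightarrow> real poly"
  where "flat_deriv p = [:0, 0, 1:] * (p - pderiv p)"

lemma poly_times_exp_tendsto_0: "((\<lambda>x. poly p x * exp (- x)) \<longlongrightarrow> 0) at_top" for p :: "real poly"
proof -
  have "((\<lambda>x. \<Sum>k\<le>degree p. coeff p k * (x ^ k / exp x)) \<longlongrightarrow> (\<Sum>k\<le>degree p. coeff p k * 0)) at_top"
    by (intro tendsto_sum tendsto_mult tendsto_const tendsto_power_div_exp_0)
  then show ?thesis
    by (simp add: poly_altdef exp_minus sum_distrib_right divide_inverse mult.assoc)
qed

lemma flat_has_derivative: "(flat p has_real_derivative flat (flat_deriv p) t) (at t)"
proof (cases t "0 :: real" rule: linorder_cases)
  case greater
  have "((\<lambda>t. poly p (1 / t) * exp (- (1 / t))) has_real_derivative flat (flat_deriv p) t) (at t)"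
    using greater
    by (auto intro!: derivative_eq_intros simp: flat_def flat_deriv_def field_simps power2_eq_square)
  then show ?thesis
    by (rule has_field_derivative_transform_within_open[of _ _ _ "{0<..}"])
      (use greater in \<open>auto simp: flat_def\<close>)
next
  case less
  have "((\<lambda>t. 0) has_real_derivative flat (flat_deriv p) t) (at t)"
    using less by (simp add: flat_def)
  then show ?thesis
    by (rule has_field_derivative_transform_within_open[of _ _ _ "{..<0}"])
      (use less in \<open>auto simp: flat_def\<close>)
next
  case equal
  have "((\<lambda>x. poly ([:0, 1:] * p) x * exp (- x)) \<longlongrightarrow> 0) at_top"
    by (rule poly_times_exp_tendsto_0)
  then have "((\<lambda>h. poly ([:0, 1:] * p) (inverse h) * exp (- inverse h)) \<longlongrightarrow> 0) (at_right 0)"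
    by (simp add: filterlim_at_right_to_top)
  then have right: "((\<lambda>h. flat p h / h) \<longlongrightarrow> 0) (at_right 0)"
    by (rule Lim_transform_eventually)
      (auto simp: flat_def eventually_at_right_less divide_inverse mult_ac
        intro!: eventually_mono[OF eventually_at_right_less])
  have left: "((\<lambda>h. flat p h / h) \<longlongrightarrow> 0) (at_left 0)"
    by (rule Lim_transform_eventually[OF tendsto_const])
      (auto simp: flat_def eventually_at_filter)
  have "((\<lambda>h. flat p h / h) \<longlongrightarrow> 0) (at 0)"
    using left right by (simp add: filterlim_at_split)
  then show ?thesis using equal by (simp add: DERIV_def flat_def)
qed

lemma smooth_on_flat: "smooth_on UNIV (flat p)"
proof -
  have "Ck_on k UNIV (flat p)" for k
  proof (induction k arbitrary: p)
    case 0
    then show ?case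
      using flat_has_derivative DERIV_isCont by (simp add: continuous_on_eq_continuous_at) blast
  next
    case (Suc k)
    show ?case
    proof (rule Ck_on_SucI[where f' = "\<lambda>t v. flat (flat_deriv p) t * v"])
      show "(flat p has_derivative (\<lambda>v. flat (flat_deriv p) t * v)) (at t)" for t
        using flat_has_derivative[of p t] by (simp add: has_field_derivative_def)
      show "Ck_on k UNIV (\<lambda>t. flat (flat_deriv p) t * v)" for v
        by (intro Ck_on_mult Ck_on_const Suc) auto
    qed auto
  qed
  then show ?thesis by (simp add: smooth_on_def)
qed

lemma bump_function:
  fixes x0 :: "'a::euclidean_space"
  assumes "r > 0"
  obtains \<beta> :: "'a \<Rightarrow> real" where "smooth_on UNIV \<beta>" "\<beta> x0 = 1" "\<And>x. x \<notin> cball x0 r \<Longrightarrow> \<beta> x = 0"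
proof
  let ?d = "\<lambda>x. r\<^sup>2 - (x - x0) \<bullet> (x - x0)"
  let ?\<beta> = "\<lambda>x. inverse (flat 1 (r\<^sup>2)) * flat 1 (?d x)"
  have id: "smooth_on UNIV (\<lambda>x. x - x0)"
    by (intro smooth_on_diff smooth_on_const smooth_on_bounded_linear bounded_linear_ident) auto
  have "smooth_on UNIV (\<lambda>x. (x - x0) \<bullet> (x - x0))"
    using id unfolding smooth_on_def by (auto intro: Ck_on_bilinear[OF open_UNIV bounded_bilinear_inner])
  then have "smooth_on UNIV ?d"
    by (intro smooth_on_diff smooth_on_const) auto
  then show "smooth_on UNIV ?\<beta>"
    by (intro smooth_on_mult smooth_on_const smooth_on_compose[OF open_UNIV open_UNIV _ _ smooth_on_flat]) auto
  show "?\<beta> x0 = 1" using assms by (simp add: flat_def)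
  fix x assume "x \<notin> cball x0 r"
  then have "r < norm (x - x0)" by (simp add: dist_norm norm_minus_commute)
  then have "r\<^sup>2 < (norm (x - x0))\<^sup>2" using assms by (intro power_strict_mono) auto
  then show "?\<beta> x = 0" by (simp add: flat_def power2_norm_eq_inner)
qed

section \<open>Extension of tangent vectors and the Lie bracket\<close>

context manifold
begin

text \<open>A constant coordinate field is cut off inside the chart and continued by zero. This
  realises arbitrary vectors at a point by global fields, to which the torsion hypothesis
  applies.\<close>

lemma vector_field_extension:
  assumes c: "c \<in> A" "p \<in> fst c"
  obtains \<xi> where "vector_field X A \<xi>" "\<xi> p c = u"
proof -
  obtain r where r: "r > 0" "cball (snd c p) r \<subseteq> chart_image c"
    using chart(2)[OF c(1)] chart_image[OF c(2)] open_contains_cball by blast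
  obtain \<beta> :: "real^'n \<Rightarrow> real" where \<beta>: "smooth_on UNIV \<beta>" "\<beta> (snd c p) = 1"
    "\<And>x. x \<notin> cball (snd c p) r \<Longrightarrow> \<beta> x = 0" using bump_function[OF r(1)] by blast
  define K where "K = {q \<in> fst c. snd c q \<in> cball (snd c p) r}"
  have "snd c ` K = cball (snd c p) r" using r(2) by (auto simp: K_def chart_image_def)
  then have "compactin (top_of_set (chart_image c)) (snd c ` K)"
    using r(2) by (simp add: compactin_subtopology)
  then have "compactin (subtopology X (fst c)) K"
    using homeomorphic_map_compactness[OF chart(4)[OF c(1)], of K] chart(5)[OF c(1)] by (auto simp: K_def)
  then have "compactin X K" by (simp add: compactin_subtopology)
  \<comment> \<open>Compactness passes from the chart to the manifold, and there the Hausdorff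
    property gives closedness; this makes the continuation by zero smooth across the boundary of the
    chart.\<close>
  then have "closedin X K"
    using manifold compactin_imp_closedin by (auto simp: smooth_manifold_def)
  then have oK: "openin X (topspace X - K)" by blast
  define \<xi> where "\<xi> q = (if q \<in> fst c then \<beta> (snd c q) *\<^sub>R coordinate_vector A c u q else 0)" for q
  have "vector_field X A \<xi>"
    unfolding vector_field_def
  proof (intro conjI ballI)
    show "\<xi> q \<in> tangent_space A q" for q
      using coordinate_vector_tangent[OF c(1)] by (simp add: \<xi>_def tangent_scale tangent_0)
    fix c' assume c': "c' \<in> A"
    let ?V = "snd c' ` (fst c' \<inter> (topspace X - K))"
    have cover: "chart_image c' = overlap c' c \<union> ?V"
      using in_topspace[OF c'] by (auto simp: chart_image_def overlap_def K_def)
    have "smooth_on (overlap c' c) (local_field c' \<xi>)"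
    proof (rule smooth_on_cong[OF open_overlap[OF c' c(1)]])
      show "smooth_on (overlap c' c) (\<lambda>y. \<beta> (transition c' c y) *\<^sub>R
          frechet_derivative (transition c c') (at (transition c' c y)) u)"
      proof (rule smooth_on_compose[where f = "transition c' c" and
            g = "\<lambda>x. \<beta> x *\<^sub>R frechet_derivative (transition c c') (at x) u", OF open_overlap[OF c' c(1)] open_overlap[OF c(1) c']])
        show "transition c' c ` overlap c' c \<subseteq> overlap c c'"
          using c' by (auto simp: overlap_def transition)
        show "smooth_on (overlap c c') (\<lambda>x. \<beta> x *\<^sub>R frechet_derivative (transition c c') (at x) u)"
          by (intro smooth_on_scaleR open_overlap smooth_on_frechet_derivative smooth_transition c c'
              smooth_on_subset[OF \<beta>(1)]) auto
      qed (rule smooth_transition[OF c' c(1)])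
      fix y assume "y \<in> overlap c' c"
      then obtain q where "q \<in> fst c'" "q \<in> fst c" "y = snd c' q" by (rule overlapE[OF _ c'])
      then show "\<beta> (transition c' c y) *\<^sub>R frechet_derivative (transition c c') (at (transition c' c y)) u =
          local_field c' \<xi> y"
        using c c' by (simp add: local_field_eq transition \<xi>_def scaleR_fun_apply coordinate_vector_def)
    qed
    moreover have "smooth_on ?V (local_field c' \<xi>)"
    proof (rule smooth_on_cong[OF open_chart_part[OF c' oK]])
      show "smooth_on ?V (\<lambda>y. 0 :: real^'n)" by (rule smooth_on_const[OF open_chart_part[OF c' oK]])
      fix y assume "y \<in> ?V"
      then obtain q where "q \<in> fst c'" "q \<notin> K" "y = snd c' q" by blast
      then show "0 = local_field c' \<xi> y"
        using c' \<beta>(3) by (auto simp: local_field_eq \<xi>_def K_def scaleR_fun_apply)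
    qed
    ultimately show "smooth_on (chart_image c') (local_field c' \<xi>)"
      unfolding cover by (intro smooth_on_Un open_overlap open_chart_part oK c c')
  qed
  moreover have "\<xi> p c = u"
    using c \<beta>(2) by (simp add: \<xi>_def coordinate_vector_same)
  ultimately show ?thesis by (rule that)
qed

lemma local_field_derivative:
  assumes "vector_field X A \<xi>" "c \<in> A" "p \<in> fst c"
  shows "(local_field c \<xi> has_derivative frechet_derivative (local_field c \<xi>) (at (snd c p))) (at (snd c p))"
  by (rule smooth_on_derivative[OF _ chart_image[OF assms(3)]])
    (use assms in \<open>simp add: vector_field_def\<close>)

lemma lie_bracket_eq:
  "c \<in> A \<Longrightarrow> p \<in> fst c \<Longrightarrow> lie_bracket A \<xi> \<eta> p c =
    frechet_derivative (local_field c \<eta>) (at (snd c p)) (\<xi> p c) -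
    frechet_derivative (local_field c \<xi>) (at (snd c p)) (\<eta> p c)"
  by (simp add: lie_bracket_def)

text \<open>Under a change of chart each term acquires a second derivative of the transition map; by
  symmetry these cancel in the difference.\<close>

lemma lie_bracket_tangent:
  assumes \<xi>: "vector_field X A \<xi>" and \<eta>: "vector_field X A \<eta>"
  shows "lie_bracket A \<xi> \<eta> p \<in> tangent_space A p"
  unfolding tangent_space_iff
proof (intro conjI allI ballI impI)
  show "lie_bracket A \<xi> \<eta> p c = 0" if "\<not> (c \<in> A \<and> p \<in> fst c)" for c
    using that by (auto simp: lie_bracket_def)
  fix c c' assume c: "c \<in> A" "c' \<in> A" and "p \<in> fst c \<and> p \<in> fst c'"
  then have p: "p \<in> fst c" "p \<in> fst c'" by auto
  let ?x = "snd c p" and ?\<tau> = "transition c c'"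
  let ?D2 = "\<lambda>w v. frechet_derivative (\<lambda>y. frechet_derivative ?\<tau> (at y) v) (at ?x) w"
  note O = open_overlap[OF c] in_overlap[OF p] and \<tau> = smooth_transition[OF c]
  \<comment> \<open>Differentiation in two ways of the transformation law that expresses the field
    in \<open>c'\<close> along the transition map by its expression in \<open>c\<close>.\<close>
  have change: "frechet_derivative (local_field c' \<zeta>) (at (snd c' p)) (jac c c' p w) =
      ?D2 w (\<zeta> p c) + jac c c' p (frechet_derivative (local_field c \<zeta>) (at ?x) w)"
    if \<zeta>: "vector_field X A \<zeta>" for \<zeta> w
  proof -
    have "(local_field c' \<zeta> has_derivative frechet_derivative (local_field c' \<zeta>) (at (snd c' p))) (at (?\<tau> ?x))"
      using local_field_derivative[OF \<zeta> c(2) p(2)] by (simp add: transition c p)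
    from has_derivative_compose[OF jac[OF c p] this]
    have 1: "((\<lambda>y. local_field c' \<zeta> (?\<tau> y)) has_derivative
        (\<lambda>w. frechet_derivative (local_field c' \<zeta>) (at (snd c' p)) (jac c c' p w))) (at ?x)" .
    have "((\<lambda>y. frechet_derivative ?\<tau> (at y) (local_field c \<zeta> y)) has_derivative
        (\<lambda>w. ?D2 w (local_field c \<zeta> ?x) + frechet_derivative ?\<tau> (at ?x) (frechet_derivative (local_field c \<zeta>) (at ?x) w))) (at ?x)"
    proof (rule has_derivative_operator_field[where M = "\<lambda>y. frechet_derivative ?\<tau> (at y)" and DM = ?D2, OF _ O])
      show "linear (frechet_derivative ?\<tau> (at y))" if "y \<in> overlap c c'" for y
        using smooth_on_derivative[OF \<tau> that] has_derivative_linear by blast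
      show "((\<lambda>y. frechet_derivative ?\<tau> (at y) v) has_derivative (\<lambda>w. ?D2 w v)) (at ?x)" for v
        by (rule smooth_on_derivative[OF smooth_on_frechet_derivative[OF \<tau>] O(2)])
    qed (rule local_field_derivative[OF \<zeta> c(1) p(1)])
    then have 2: "((\<lambda>y. local_field c' \<zeta> (?\<tau> y)) has_derivative
        (\<lambda>w. ?D2 w (local_field c \<zeta> ?x) + frechet_derivative ?\<tau> (at ?x) (frechet_derivative (local_field c \<zeta>) (at ?x) w))) (at ?x)"
    proof (rule has_derivative_transform_within_open[OF _ O])
      fix y assume "y \<in> overlap c c'"
      then obtain q where q: "q \<in> fst c" "q \<in> fst c'" "y = snd c q" by (rule overlapE[OF _ c(1)])
      show "frechet_derivative ?\<tau> (at y) (local_field c \<zeta> y) = local_field c' \<zeta> (?\<tau> y)"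
        using tangentD[OF vector_field_tangent[OF \<zeta> in_topspace[OF c(1) q(1)]] c q(1,2)] c q
        by (simp add: transition local_field_eq jac_def)
    qed
    from fun_cong[OF has_derivative_unique[OF 1 2], of w] show ?thesis
      by (simp add: local_field_eq c p jac_def)
  qed
  have top: "p \<in> topspace X" by (rule in_topspace[OF c(1) p(1)])
  have "lie_bracket A \<xi> \<eta> p c' =
      ?D2 (\<xi> p c) (\<eta> p c) + jac c c' p (frechet_derivative (local_field c \<eta>) (at ?x) (\<xi> p c)) -
      (?D2 (\<eta> p c) (\<xi> p c) + jac c c' p (frechet_derivative (local_field c \<xi>) (at ?x) (\<eta> p c)))"
    unfolding lie_bracket_eq[OF c(2) p(2)] tangentD[OF vector_field_tangent[OF \<xi> top] c p]
      tangentD[OF vector_field_tangent[OF \<eta> top] c p] change[OF \<xi>] change[OF \<eta>] ..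
  also have "?D2 (\<xi> p c) (\<eta> p c) = ?D2 (\<eta> p c) (\<xi> p c)"
    by (rule symmetric_second_derivative[OF O \<tau>])
  finally show "lie_bracket A \<xi> \<eta> p c' = jac c c' p (lie_bracket A \<xi> \<eta> p c)"
    unfolding lie_bracket_eq[OF c(1) p(1)] linear_diff[OF linear_jac[OF c p]] by simp
qed

end

section \<open>The torsions in coordinates\<close>

context manifold
begin

definition op_deriv :: "('a, 'n) chart \<Rightarrow> ('a, 'n) op_field \<Rightarrow> 'a \<Rightarrow> real ^ 'n \<Rightarrow> real ^ 'n \<Rightarrow> real ^ 'n"
  where "op_deriv c L p u v = frechet_derivative (\<lambda>x. op_coord c L x v) (at (snd c p)) u"

lemma op_deriv:
  assumes "operator_field X A L" "c \<in> A" "p \<in> fst c"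
  shows "((\<lambda>x. op_coord c L x v) has_derivative (\<lambda>u. op_deriv c L p u v)) (at (snd c p))"
  using smooth_on_derivative[OF smooth_op_coord[OF assms(1,2)] chart_image[OF assms(3)], of v]
  unfolding op_deriv_def .

lemma operator_field_derivative:
  assumes L: "operator_field X A L" and \<xi>: "vector_field X A \<xi>" and c: "c \<in> A" "p \<in> fst c"
  shows "frechet_derivative (local_field c (L \<star> \<xi>)) (at (snd c p)) u =
    op_deriv c L p u (\<xi> p c) + op_coord c L (snd c p) (frechet_derivative (local_field c \<xi>) (at (snd c p)) u)"
proof -
  have "((\<lambda>x. op_coord c L x (local_field c \<xi> x)) has_derivative
      (\<lambda>u. op_deriv c L p u (local_field c \<xi> (snd c p)) +
        op_coord c L (snd c p) (frechet_derivative (local_field c \<xi>) (at (snd c p)) u))) (at (snd c p))"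
    by (rule has_derivative_operator_field[OF linear_op_coord[OF L c(1)] chart(2)[OF c(1)]
          chart_image[OF c(2)] op_deriv[OF L c] local_field_derivative[OF \<xi> c]])
  then have "(local_field c (L \<star> \<xi>) has_derivative
      (\<lambda>u. op_deriv c L p u (local_field c \<xi> (snd c p)) +
        op_coord c L (snd c p) (frechet_derivative (local_field c \<xi>) (at (snd c p)) u))) (at (snd c p))"
    by (rule has_derivative_transform_within_open[OF _ chart(2)[OF c(1)] chart_image[OF c(2)]])
      (simp add: local_field_operator[OF \<xi> c(1)])
  from fun_cong[OF has_derivative_unique[OF local_field_derivative[OF vector_field_operator[OF L \<xi>] c] this], of u]
  show ?thesis by (simp add: local_field_eq c)
qed

lemma nijenhuis_tangent:
  assumes L: "operator_field X A L" and \<xi>: "vector_field X A \<xi>" and \<eta>: "vector_field X A \<eta>"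
    and p: "p \<in> topspace X"
  shows "nijenhuis A L \<xi> \<eta> p \<in> tangent_space A p"
proof -
  note v = vector_field_operator[OF L]
  have "nijenhuis A L \<xi> \<eta> p = L p (L p (lie_bracket A \<xi> \<eta> p)) + lie_bracket A (L \<star> \<xi>) (L \<star> \<eta>) p
      - L p (lie_bracket A (L \<star> \<xi>) \<eta> p) - L p (lie_bracket A \<xi> (L \<star> \<eta>) p)"
    by (simp add: nijenhuis_def field_app_def plus_fun_def fun_diff_def)
  then show ?thesis
    by (simp add: tangent_add tangent_diff operator_tangent[OF L p] lie_bracket_tangent \<xi> \<eta> v)
qed

text \<open>Every term with a derivative of a vector field cancels, so only the values of the fields
  and the derivative of the operator remain.\<close>

lemma nijenhuis_coordinates:
  assumes L: "operator_field X A L" and \<xi>: "vector_field X A \<xi>" and \<eta>: "vector_field X A \<eta>"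
    and c: "c \<in> A" "p \<in> fst c"
  shows "nijenhuis A L \<xi> \<eta> p c =
    point_nijenhuis (op_coord c L (snd c p)) (op_deriv c L p) (\<xi> p c) (\<eta> p c)"
proof -
  let ?M = "op_coord c L (snd c p)"
  let ?D = "\<lambda>\<zeta>. frechet_derivative (local_field c \<zeta>) (at (snd c p))"
  have p: "p \<in> topspace X" by (rule in_topspace[OF c])
  note M = linear_op_coord[OF L c(1) chart_image[OF c(2)]]
  note v = vector_field_operator[OF L]
  have app: "(L \<star> \<zeta>) p c = ?M (\<zeta> p c)" if "\<zeta> p \<in> tangent_space A p" for \<zeta>
    using operator_coordinates[OF c that] by (simp add: field_app_def)
  have tan: "(L \<star> \<zeta>) p \<in> tangent_space A p" if "\<zeta> p \<in> tangent_space A p" for \<zeta>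
    using operator_tangent[OF L p that] by (simp add: field_app_def)
  note b = lie_bracket_tangent
  show ?thesis
    unfolding nijenhuis_def plus_fun_apply minus_apply
    by (simp add: app tan b \<xi> \<eta> v vector_field_tangent p lie_bracket_eq[OF c]
        operator_field_derivative[OF L _ c] linear_diff[OF M] linear_add[OF M] point_nijenhuis_def)
qed

lemma haantjes_coordinates:
  assumes L: "operator_field X A L" and \<xi>: "vector_field X A \<xi>" and \<eta>: "vector_field X A \<eta>"
    and c: "c \<in> A" "p \<in> fst c"
  shows "haantjes A L \<xi> \<eta> p c = point_haantjes (op_coord c L (snd c p))
    (point_nijenhuis (op_coord c L (snd c p)) (op_deriv c L p)) (\<xi> p c) (\<eta> p c)"
proof -
  let ?M = "op_coord c L (snd c p)"
  have p: "p \<in> topspace X" by (rule in_topspace[OF c])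
  have app: "(L \<star> \<zeta>) p c = ?M (\<zeta> p c)" if "\<zeta> p \<in> tangent_space A p" for \<zeta>
    using operator_coordinates[OF c that] by (simp add: field_app_def)
  have tan: "(L \<star> \<zeta>) p \<in> tangent_space A p" if "\<zeta> p \<in> tangent_space A p" for \<zeta>
    using operator_tangent[OF L p that] by (simp add: field_app_def)
  show ?thesis
    unfolding haantjes_def plus_fun_apply minus_apply
    by (simp add: app tan nijenhuis_tangent L \<xi> \<eta> vector_field_operator vector_field_tangent p
        nijenhuis_coordinates c point_haantjes_def)
qed

lemma haantjes_operator_pointwise:
  assumes H: "haantjes_operator X A L" and c: "c \<in> A" "p \<in> fst c"
  shows "point_haantjes (op_coord c L (snd c p))
    (point_nijenhuis (op_coord c L (snd c p)) (op_deriv c L p)) u v = 0"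
proof -
  obtain \<xi> where \<xi>: "vector_field X A \<xi>" "\<xi> p c = u" by (rule vector_field_extension[OF c])
  obtain \<eta> where \<eta>: "vector_field X A \<eta>" "\<eta> p c = v" by (rule vector_field_extension[OF c])
  have "haantjes A L \<xi> \<eta> p = 0" and L: "operator_field X A L"
    using H \<xi> \<eta> in_topspace[OF c] by (auto simp: haantjes_operator_def)
  then show ?thesis
    using haantjes_coordinates[OF L \<xi>(1) \<eta>(1) c] by (simp add: \<xi> \<eta>)
qed

end

subsection \<open>The complex structure of a Haantjes operator\<close>

locale haantjes_manifold = manifold X A for X :: "'a topology" and A :: "('a, 'n::finite) chart set" +
  fixes L :: "('a, 'n) op_field"
  assumes haantjes: "haantjes_operator X A L"
    and no_real_eigenvalue: "\<forall>p\<in>topspace X. \<not> (\<exists>r. real_eigenvalue (tangent_space A p) (L p) r)"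
begin

lemma L: "operator_field X A L"
  using haantjes by (simp add: haantjes_operator_def)

definition local_charpoly :: "('a, 'n) chart \<Rightarrow> real ^ 'n \<Rightarrow> real poly"
  where "local_charpoly c x = charpoly (matrix (op_coord c L x))"

text \<open>The choice of the chart is immaterial by \<open>charpoly_chart_independent\<close>; the
  point is to have a function on the manifold instead of one per chart.\<close>

definition charpoly_at :: "'a \<Rightarrow> real poly"
  where "charpoly_at p = (let c = SOME c. c \<in> A \<and> p \<in> fst c in local_charpoly c (snd c p))"

lemma charpoly_at:
  assumes "c \<in> A" "p \<in> fst c"
  shows "charpoly_at p = local_charpoly c (snd c p)"
proof -
  define c' where "c' = (SOME c. c \<in> A \<and> p \<in> fst c)"
  have "c' \<in> A \<and> p \<in> fst c'" unfolding c'_def by (rule someI) (use assms in blast)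
  then show ?thesis
    using charpoly_chart_independent[OF L _ assms(1) _ assms(2), of c']
    by (simp add: charpoly_at_def local_charpoly_def flip: c'_def)
qed

lemma op_coord_matrix: "c \<in> A \<Longrightarrow> x \<in> chart_image c \<Longrightarrow> (*v) (matrix (op_coord c L x)) = op_coord c L x"
  using linear_op_coord[OF L] by (simp add: fun_eq_iff matrix_works)

lemma local_charpoly:
  assumes c: "c \<in> A" and x: "x \<in> chart_image c"
  shows "local_charpoly c x \<noteq> 0" "degree (local_charpoly c x) = CARD('n)"
    "poly_op (local_charpoly c x) (op_coord c L x) v = 0" "poly (local_charpoly c x) r \<noteq> 0"
proof -
  show "local_charpoly c x \<noteq> 0" "degree (local_charpoly c x) = CARD('n)"
    unfolding local_charpoly_def by (rule charpoly_nonzero charpoly_monic)+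
  show "poly_op (local_charpoly c x) (op_coord c L x) v = 0"
    using poly_op_charpoly[of "matrix (op_coord c L x)" v] unfolding op_coord_matrix[OF c x] local_charpoly_def .
  obtain p where p: "p \<in> fst c" "x = snd c p" using chart_imageE[OF x c] by blast
  show "poly (local_charpoly c x) r \<noteq> 0"
  proof
    assume "poly (local_charpoly c x) r = 0"
    then obtain v where v: "v \<noteq> 0" "op_coord c L x v = r *\<^sub>R v"
      using charpoly_root_eigenvector op_coord_matrix[OF c x] unfolding local_charpoly_def by metis
    let ?w = "coordinate_vector A c v p"
    note T = coordinate_vector_tangent[OF c p(1)]
    have "L p ?w = r *\<^sub>R ?w"
      by (rule tangent_eqI[OF operator_tangent[OF L in_topspace[OF c p(1)] T] tangent_scale[OF T] c p(1)])
        (use v p in \<open>simp add: scaleR_fun_apply coordinate_vector_same c flip: op_coord_eq\<close>)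
    moreover have "?w \<noteq> 0" using v(1) coordinate_vector_same[OF c p(1), of v] by auto
    ultimately show False
      using no_real_eigenvalue in_topspace[OF c p(1)] T by (auto simp: real_eigenvalue_def)
  qed
qed

lemma annihilated: "c \<in> A \<Longrightarrow> x \<in> chart_image c \<Longrightarrow> annihilated_operator (op_coord c L x) (local_charpoly c x)"
  by (simp add: annihilated_operator_def local_charpoly linear_op_coord[OF L])

definition a :: "nat \<Rightarrow> 'a \<Rightarrow> real"
  where "a k p = sign_coeff (charpoly_at p) k"

text \<open>The degree bound of \<open>sign_poly\<close> expressed by the dimension alone, so that
  one list of coefficient functions serves all points.\<close>

definition m :: nat
  where "m = 2 * CARD('n) + 1"

definition J :: "('a, 'n) op_field"
  where "J p v = (\<Sum>k\<le>m. a k p *\<^sub>R (L p ^^ k) v)"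

lemma smooth_a: "smooth_function A (a k)"
  unfolding smooth_function_def
proof
  fix c assume c: "c \<in> A"
  note o = chart(2)[OF c]
  have "smooth_coeffs (chart_image c) (local_charpoly c)"
    unfolding local_charpoly_def
  proof (rule smooth_coeffs_charpoly[OF o])
    show "smooth_on (chart_image c) (\<lambda>x. matrix (op_coord c L x) $ i $ j)" for i j
      using smooth_on_bounded_linear_compose[OF o bounded_linear_vec_nth smooth_op_coord[OF L c]]
      by (simp add: matrix_def)
  qed
  from smooth_sign_coeff[OF o this local_charpoly(2)[OF c] local_charpoly(1)[OF c] local_charpoly(4)[OF c]]
  have "smooth_on (chart_image c) (\<lambda>x. sign_coeff (local_charpoly c x) k)" by blast
  then show "smooth_on (chart_image c) (a k \<circ> chart_inv c)"
    by (rule smooth_on_cong[OF o, rotated])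
      (auto simp: a_def charpoly_at[OF c] elim!: chart_imageE[OF _ c])
qed

lemma polynomial_coordinates:
  assumes c: "c \<in> A" "p \<in> fst c" and v: "v \<in> tangent_space A p"
    and K: "K p v = (\<Sum>k\<le>n. b k p *\<^sub>R (L p ^^ k) v)"
  shows "K p v \<in> tangent_space A p" "K p v c = (\<Sum>k\<le>n. b k p *\<^sub>R (op_coord c L (snd c p) ^^ k) (v c))"
  unfolding K
  using operator_power[OF L c v] by (auto intro!: tangent_sum tangent_scale simp: sum_fun_apply scaleR_fun_apply)

lemma J_sign_poly:
  assumes c: "c \<in> A" "p \<in> fst c"
  shows "(\<Sum>k\<le>m. a k p *\<^sub>R (op_coord c L (snd c p) ^^ k) v) =
    poly_op (sign_poly (local_charpoly c (snd c p))) (op_coord c L (snd c p)) v"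
proof -
  note d = local_charpoly(2)[OF c(1) chart_image[OF c(2)]]
  have "degree (sign_poly (local_charpoly c (snd c p))) \<le> m"
    using degree_sign_poly d unfolding m_def by metis
  from poly_op_eq_sum[OF this, of "op_coord c L (snd c p)" v] show ?thesis
    by (simp add: coeff_sign_poly a_def charpoly_at[OF c] d m_def cong: sum.cong_simp)
qed

lemma J_coordinates:
  assumes c: "c \<in> A" "p \<in> fst c" and v: "v \<in> tangent_space A p"
  shows "J p v \<in> tangent_space A p"
    "J p v c = poly_op (sign_poly (local_charpoly c (snd c p))) (op_coord c L (snd c p)) (v c)"
  using polynomial_coordinates[OF c v, where K = J and n = m and b = a, OF J_def] J_sign_poly[OF c] by simp_all

lemma operator_field_J: "operator_field X A J"
  unfolding operator_field_def
proof (intro conjI ballI allI)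
  fix p assume p: "p \<in> topspace X"
  obtain c where c: "c \<in> A" "p \<in> fst c" using chart_exists[OF p] by blast
  note lin = linear_poly_op[OF linear_op_coord[OF L c(1) chart_image[OF c(2)]]]
  fix v assume v: "v \<in> tangent_space A p"
  show "J p v \<in> tangent_space A p" by (rule J_coordinates[OF c v])
  show "J p (r *\<^sub>R v) = r *\<^sub>R J p v" for r
    by (rule tangent_eqI[OF _ _ c])
      (simp_all add: J_coordinates[OF c] v tangent_scale scaleR_fun_apply linear_scale[OF lin])
  show "J p (v + w) = J p v + J p w" if "w \<in> tangent_space A p" for w
    by (rule tangent_eqI[OF _ _ c])
      (simp_all add: J_coordinates[OF c] v that tangent_add linear_add[OF lin])
next
  fix c e assume c: "c \<in> A"
  note o = chart(2)[OF c]
  have ops: "smooth_on (chart_image c) (\<lambda>x. (op_coord c L x ^^ k) e)" for k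
  proof (induction k)
    case (Suc k)
    have "smooth_on (chart_image c) (\<lambda>x. \<Sum>b\<in>Basis. ((op_coord c L x ^^ k) e \<bullet> b) *\<^sub>R op_coord c L x b)"
      by (intro smooth_on_sum smooth_on_scaleR smooth_op_coord L c o
          smooth_on_bounded_linear_compose[OF o bounded_linear_inner_left Suc])
    then show ?case
    proof (rule smooth_on_cong[OF o, rotated])
      fix x assume "x \<in> chart_image c"
      note lin = linear_op_coord[OF L c this]
      show "(\<Sum>b\<in>Basis. ((op_coord c L x ^^ k) e \<bullet> b) *\<^sub>R op_coord c L x b) = (op_coord c L x ^^ Suc k) e"
        by (simp add: euclidean_representation flip: linear_scale[OF lin] linear_sum[OF lin])
    qed
  qed (simp add: smooth_on_const o)
  have "smooth_on (chart_image c) (\<lambda>x. \<Sum>k\<le>m. (a k \<circ> chart_inv c) x *\<^sub>R (op_coord c L x ^^ k) e)"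
    using smooth_a c unfolding smooth_function_def by (intro smooth_on_sum smooth_on_scaleR ops o) blast
  then show "smooth_on (chart_image c) (local_field c (\<lambda>p. J p (coordinate_vector A c e p)))"
  proof (rule smooth_on_cong[OF o, rotated])
    fix x assume "x \<in> chart_image c"
    then obtain p where p: "p \<in> fst c" "x = snd c p" "chart_inv c x = p" using chart_imageE c by blast
    show "(\<Sum>k\<le>m. (a k \<circ> chart_inv c) x *\<^sub>R (op_coord c L x ^^ k) e) =
        local_field c (\<lambda>p. J p (coordinate_vector A c e p)) x"
      using polynomial_coordinates(2)[OF c p(1) coordinate_vector_tangent[OF c p(1)], where K = J and n = m and b = a, OF J_def]
      by (simp add: local_field_def p(3) p(2)[symmetric] coordinate_vector_same[OF c p(1)])
  qed
qed

lemma op_coord_J: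
  assumes c: "c \<in> A" "x \<in> chart_image c"
  shows "op_coord c J x v = (\<Sum>k\<le>m. (a k \<circ> chart_inv c) x *\<^sub>R (op_coord c L x ^^ k) v)"
    "op_coord c J x v = poly_op (sign_poly (local_charpoly c x)) (op_coord c L x) v"
proof -
  obtain p where p: "p \<in> fst c" "x = snd c p" "chart_inv c x = p" using chart_imageE c by blast
  show "op_coord c J x v = (\<Sum>k\<le>m. (a k \<circ> chart_inv c) x *\<^sub>R (op_coord c L x ^^ k) v)"
    using polynomial_coordinates(2)[OF c(1) p(1) coordinate_vector_tangent[OF c(1) p(1)], where K = J and n = m and b = a, OF J_def]
    by (simp add: op_coord_def local_field_def p(3) p(2)[symmetric] coordinate_vector_same[OF c(1) p(1)])
  then show "op_coord c J x v = poly_op (sign_poly (local_charpoly c x)) (op_coord c L x) v"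
    using J_sign_poly[OF c(1) p(1), of v] by (simp add: p(3) p(2)[symmetric])
qed

text \<open>The Leibniz rule puts the derivative of \<open>J\<close> into the form required by
  \<open>point_haantjes_polynomial\<close>; that kills the Haantjes expression of \<open>J\<close>,
  and \<open>point_nijenhuis_zero\<close> passes to the Nijenhuis expression.\<close>

lemma nijenhuis_J_pointwise:
  assumes c: "c \<in> A" "p \<in> fst c"
  shows "point_nijenhuis (op_coord c J (snd c p)) (op_deriv c J p) u v = 0"
proof -
  let ?x = "snd c p"
  let ?M = "op_coord c L ?x" and ?J = "op_coord c J ?x" and ?T = "op_deriv c L p" and ?TJ = "op_deriv c J p"
  note o = chart(2)[OF c(1)] chart_image[OF c(2)]
  define \<alpha> where "\<alpha> k = a k \<circ> chart_inv c" for k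
  define D where "D k = frechet_derivative (\<alpha> k) (at ?x)" for k
  have D: "(\<alpha> k has_derivative D k) (at ?x)" for k
    using smooth_a[of k] c(1) smooth_on_derivative[OF _ o(2)] by (auto simp: smooth_function_def \<alpha>_def D_def)
  have M: "linear ?M" by (rule linear_op_coord[OF L c(1) o(2)])
  have T2: "linear (\<lambda>u. ?T u v)" for v
    using op_deriv[OF L c, of v] has_derivative_linear by blast
  have T1: "linear (?T u)" for u
  proof (rule linearI)
    have eq: "?T u v = T' u" if "((\<lambda>x. op_coord c L x v) has_derivative T') (at ?x)" for v T'
      using has_derivative_unique[OF op_deriv[OF L c, of v] that] by metis
    have lin: "op_coord c L x (v + w) = op_coord c L x v + op_coord c L x w"
      "op_coord c L x (r *\<^sub>R v) = r *\<^sub>R op_coord c L x v" if "x \<in> chart_image c" for x v w r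
      using linear_op_coord[OF L c(1) that] by (simp_all add: linear_add linear_scale)
    show "?T u (v + w) = ?T u v + ?T u w" for v w
      by (rule eq, rule has_derivative_transform_within_open[OF
            has_derivative_add[OF op_deriv[OF L c] op_deriv[OF L c]] o]) (simp add: lin)
    show "?T u (r *\<^sub>R v) = r *\<^sub>R ?T u v" for r v
      by (rule eq, rule has_derivative_transform_within_open[OF
            has_derivative_scaleR_right[OF op_deriv[OF L c]] o]) (simp add: lin)
  qed
  have J: "?J v = (\<Sum>k\<le>m. \<alpha> k ?x *\<^sub>R (?M ^^ k) v)" for v
    unfolding \<alpha>_def by (rule op_coord_J[OF c(1) o(2)])
  have TJ: "?TJ u v = (\<Sum>k\<le>m. D k u *\<^sub>R (?M ^^ k) v +
      \<alpha> k ?x *\<^sub>R (\<Sum>i<k. (?M ^^ i) (?T u ((?M ^^ (k - 1 - i)) v))))" for u v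
  proof -
    have pow: "((\<lambda>x. (op_coord c L x ^^ k) v) has_derivative
        (\<lambda>u. \<Sum>i<k. (?M ^^ i) (?T u ((?M ^^ (k - 1 - i)) v)))) (at ?x)" for k
      by (rule has_derivative_operator_power[OF linear_op_coord[OF L c(1)] o op_deriv[OF L c]])
    have "((\<lambda>x. \<Sum>k\<le>m. \<alpha> k x *\<^sub>R (op_coord c L x ^^ k) v) has_derivative
        (\<lambda>u. \<Sum>k\<le>m. \<alpha> k ?x *\<^sub>R (\<Sum>i<k. (?M ^^ i) (?T u ((?M ^^ (k - 1 - i)) v))) +
          D k u *\<^sub>R (?M ^^ k) v)) (at ?x)"
      by (intro has_derivative_sum has_derivative_scaleR D pow)
    then have "((\<lambda>x. op_coord c J x v) has_derivative
        (\<lambda>u. \<Sum>k\<le>m. \<alpha> k ?x *\<^sub>R (\<Sum>i<k. (?M ^^ i) (?T u ((?M ^^ (k - 1 - i)) v))) +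
          D k u *\<^sub>R (?M ^^ k) v)) (at ?x)"
      by (rule has_derivative_transform_within_open[OF _ o]) (simp add: op_coord_J(1)[OF c(1)] \<alpha>_def)
    from fun_cong[OF has_derivative_unique[OF op_deriv[OF operator_field_J c] this], of u]
    show ?thesis by (simp add: add.commute)
  qed
  have JJ: "op_coord c J x (op_coord c J x v) = - v" if "x \<in> chart_image c" for x v
    using annihilated_operator.J_J[OF annihilated[OF c(1) that]] op_coord_J(2)[OF c(1) that] by simp
  have linJ: "linear ?J" by (rule linear_op_coord[OF operator_field_J c(1) o(2)])
  have TJ2: "linear (\<lambda>u. ?TJ u v)" for v
    using op_deriv[OF operator_field_J c, of v] has_derivative_linear by blast
  have TJ1: "linear (?TJ u)" for u
    unfolding TJ
    by (intro linear_compose_sum linear_compose_add linear_compose_scale_right ballI linear_funpow[OF M]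
        linear_compose[OF linear_compose[OF linear_funpow[OF M] T1] linear_funpow[OF M], unfolded o_def])
  \<comment> \<open>Obtained by differentiating J^2 = -1, which holds on the whole chart and so has
    derivative zero.\<close>
  have TJJ: "?TJ u (?J v) = - ?J (?TJ u v)" for u v
  proof -
    have 1: "((\<lambda>x. op_coord c J x (op_coord c J x v)) has_derivative
        (\<lambda>u. ?TJ u (?J v) + ?J (?TJ u v))) (at ?x)"
      by (rule has_derivative_operator_field[OF linear_op_coord[OF operator_field_J c(1)] o
            op_deriv[OF operator_field_J c] op_deriv[OF operator_field_J c]])
    have 2: "((\<lambda>x. op_coord c J x (op_coord c J x v)) has_derivative (\<lambda>u. 0)) (at ?x)"
      by (rule has_derivative_transform_within_open[OF has_derivative_const o]) (simp add: JJ)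
    from fun_cong[OF has_derivative_unique[OF 1 2], of u]
    show ?thesis by (simp add: eq_neg_iff_add_eq_0)
  qed
  have linD: "linear (D k)" for k using D has_derivative_linear by blast
  have eq: "?J = (\<lambda>v. \<Sum>k\<le>m. \<alpha> k ?x *\<^sub>R (?M ^^ k) v)"
    "?TJ = (\<lambda>u v. \<Sum>k\<le>m. D k u *\<^sub>R (?M ^^ k) v +
      \<alpha> k ?x *\<^sub>R (\<Sum>i<k. (?M ^^ i) (?T u ((?M ^^ (k - 1 - i)) v))))"
    using J TJ by blast+
  have H: "point_haantjes ?J (point_nijenhuis ?J ?TJ) u v = 0" for u v
    unfolding eq
    by (rule point_haantjes_polynomial[where M = ?M and T = ?T and D = D and m = m and a = "\<lambda>k. \<alpha> k ?x",
          OF M T1 T2 linD haantjes_operator_pointwise[OF haantjes c]])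
  show ?thesis
    by (rule point_nijenhuis_zero[where J = ?J and T = ?TJ, OF linJ JJ[OF o(2)] TJ1 TJ2 TJJ H])
qed

lemma complex_structure_J: "complex_structure X A J"
  unfolding complex_structure_def
proof (intro conjI ballI allI impI)
  show "operator_field X A J" by (rule operator_field_J)
  fix p assume p: "p \<in> topspace X"
  obtain c where c: "c \<in> A" "p \<in> fst c" using chart_exists[OF p] by blast
  show "J p (J p v) = - v" if "v \<in> tangent_space A p" for v
    by (rule tangent_eqI[OF _ _ c])
      (simp_all add: J_coordinates[OF c] that tangent_neg
        annihilated_operator.J_J[OF annihilated[OF c(1) chart_image[OF c(2)]]])
  show "nijenhuis A J \<xi> \<eta> p = 0" if "vector_field X A \<xi>" "vector_field X A \<eta>" for \<xi> \<eta>
    by (rule tangent_eqI[OF nijenhuis_tangent[OF operator_field_J that p] tangent_0 c])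
      (simp add: nijenhuis_coordinates[OF operator_field_J that c] nijenhuis_J_pointwise[OF c])
qed

lemma smooth_polynomial_J: "smooth_polynomial_in X A L J"
  unfolding smooth_polynomial_in_def using smooth_a J_def by blast

lemma J_commutes:
  assumes "p \<in> topspace X" "v \<in> tangent_space A p"
  shows "J p (L p v) = L p (J p v)"
proof -
  obtain c where c: "c \<in> A" "p \<in> fst c" using chart_exists[OF assms(1)] by blast
  note T = operator_tangent[OF L assms(1)]
  show ?thesis
    by (rule tangent_eqI[OF _ _ c])
      (simp_all add: J_coordinates[OF c] T assms(2) operator_coordinates[OF c, where L = L]
        poly_op_commute[OF linear_op_coord[OF L c(1) chart_image[OF c(2)]]])
qed

lemma J_eigenvalue:
  assumes p: "p \<in> topspace X" and "complex_eigenvalue (tangent_space A p) (J p \<circ> L p) z"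
  shows "Re z < 0"
proof -
  obtain c where c: "c \<in> A" "p \<in> fst c" using chart_exists[OF p] by blast
  obtain u w where uw: "u \<in> tangent_space A p" "w \<in> tangent_space A p" "u \<noteq> 0 \<or> w \<noteq> 0"
    "J p (L p u) = Re z *\<^sub>R u - Im z *\<^sub>R w" "J p (L p w) = Im z *\<^sub>R u + Re z *\<^sub>R w"
    using assms(2) by (auto simp: complex_eigenvalue_def)
  have "v c \<noteq> 0" if "v \<in> tangent_space A p" "v \<noteq> 0" for v
    using tangent_eqI[OF that(1) tangent_0 c] that(2) by auto
  then have "u c \<noteq> 0 \<or> w c \<noteq> 0" using uw by blast
  moreover have "poly_op (sign_poly (local_charpoly c (snd c p))) (op_coord c L (snd c p)) (op_coord c L (snd c p) (v c)) =
      J p (L p v) c" if "v \<in> tangent_space A p" for v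
    using that by (simp add: J_coordinates[OF c] operator_tangent[OF L p] operator_coordinates[OF c, where L = L])
  ultimately show ?thesis
    using annihilated_operator.Re_eigenvalue_negative[OF annihilated[OF c(1) chart_image[OF c(2)]], of "u c" "w c" z]
      uw by (simp add: scaleR_fun_apply)
qed

text \<open>At a fixed point both structures are real polynomials in the same coordinate operator,
  so \<open>sign_structure_unique\<close> decides. Its hypotheses concern coordinate vectors and are
  transferred through \<open>coordinate_vector\<close>.\<close>

lemma J_unique:
  assumes J': "complex_structure X A J'" "smooth_polynomial_in X A L J'"
    and neg: "\<And>z. complex_eigenvalue (tangent_space A p) (J' p \<circ> L p) z \<Longrightarrow> Re z < 0"
    and p: "p \<in> topspace X" and v: "v \<in> tangent_space A p"
  shows "J' p v = J p v"
proof -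
  obtain c where c: "c \<in> A" "p \<in> fst c" using chart_exists[OF p] by blast
  obtain n b where "\<forall>p\<in>topspace X. \<forall>v\<in>tangent_space A p. J' p v = (\<Sum>k\<le>n. b k p *\<^sub>R (L p ^^ k) v)"
    using J'(2) unfolding smooth_polynomial_in_def by (elim exE conjE)
  then have b: "J' p v = (\<Sum>k\<le>n. b k p *\<^sub>R (L p ^^ k) v)" if "v \<in> tangent_space A p" for v
    using p that by simp
  let ?M = "op_coord c L (snd c p)"
  note unique = annihilated_operator.sign_structure_unique[OF annihilated[OF c(1) chart_image[OF c(2)]]]
  define q where "q = (\<Sum>k\<le>n. monom (b k p) k)"
  have "degree q \<le> n" unfolding q_def by (intro degree_sum_le) (auto intro: order.trans[OF degree_monom_le])
  then have q: "poly_op q ?M w = (\<Sum>k\<le>n. b k p *\<^sub>R (?M ^^ k) w)" for w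
    by (simp add: poly_op_eq_sum) (simp add: q_def coeff_sum)
  have J'c: "J' p v \<in> tangent_space A p" "J' p v c = poly_op q ?M (v c)" if "v \<in> tangent_space A p" for v
    using polynomial_coordinates[OF c that, where K = J' and n = n and b = b, OF b[OF that]] by (simp_all add: q)
  let ?t = "\<lambda>e. coordinate_vector A c e p"
  note T = coordinate_vector_tangent[OF c] coordinate_vector_same[OF c]
  have JJ': "J' p (J' p w) = - w" if "w \<in> tangent_space A p" for w
    using J'(1) p that by (simp add: complex_structure_def)
  have sq: "poly_op q ?M (poly_op q ?M e) = - e" for e
    using arg_cong[OF JJ'[OF T(1)[of e]], of "\<lambda>w. w c"] by (simp add: J'c T)
  have ev: "Re z < 0" if "u \<noteq> 0 \<or> w \<noteq> 0" "poly_op q ?M (?M u) = Re z *\<^sub>R u - Im z *\<^sub>R w"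
    "poly_op q ?M (?M w) = Im z *\<^sub>R u + Re z *\<^sub>R w" for z u w
  proof (rule neg)
    note LT = operator_tangent[OF L p]
    have app: "J' p (L p (?t e)) \<in> tangent_space A p" "J' p (L p (?t e)) c = poly_op q ?M (?M e)" for e
      by (simp_all add: J'c LT T operator_coordinates[OF c, where L = L])
    have "?t u \<noteq> 0 \<or> ?t w \<noteq> 0"
      using that(1) T(2) by (metis zero_fun_apply)
    moreover have "J' p (L p (?t u)) = Re z *\<^sub>R ?t u - Im z *\<^sub>R ?t w"
      by (rule tangent_eqI[OF app(1) tangent_diff[OF tangent_scale[OF T(1)] tangent_scale[OF T(1)]] c])
        (simp add: app that T scaleR_fun_apply)
    moreover have "J' p (L p (?t w)) = Im z *\<^sub>R ?t u + Re z *\<^sub>R ?t w"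
      by (rule tangent_eqI[OF app(1) tangent_add[OF tangent_scale[OF T(1)] tangent_scale[OF T(1)]] c])
        (simp add: app that T scaleR_fun_apply)
    ultimately show "complex_eigenvalue (tangent_space A p) (J' p \<circ> L p) z"
      unfolding complex_eigenvalue_def using T(1) by (metis comp_apply)
  qed
  have "poly_op q ?M (v c) = poly_op (sign_poly (local_charpoly c (snd c p))) ?M (v c)"
    by (rule unique[OF sq]) (rule ev)
  then show ?thesis
    by (intro tangent_eqI[OF J'c(1)[OF v] J_coordinates(1)[OF c v] c])
      (simp add: J'c(2)[OF v] J_coordinates(2)[OF c v])
qed

end

theorem theorem6p1:
  fixes X :: "'a topology"
    and A :: "('a, 'n::finite) chart set"
    and L :: "('a, 'n) op_field"
  defines "P \<equiv> \<lambda>J. complex_structure X A J \<and>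
      smooth_polynomial_in X A L J \<and>
      (\<forall>p\<in>topspace X. \<forall>z. complex_eigenvalue (tangent_space A p) (J p \<circ> L p) z \<longrightarrow> Re z < 0)"
  assumes "smooth_manifold X A"
    and "even CARD('n)"
    and "haantjes_operator X A L"
    and "\<forall>p\<in>topspace X. \<not> (\<exists>r. real_eigenvalue (tangent_space A p) (L p) r)"
  shows "\<exists>J. P J \<and>
    (\<forall>p\<in>topspace X. \<forall>v\<in>tangent_space A p. J p (L p v) = L p (J p v)) \<and>
    (\<forall>J'. P J' \<longrightarrow> (\<forall>p\<in>topspace X. \<forall>v\<in>tangent_space A p. J' p v = J p v))"
proof -
  interpret haantjes_manifold X A L
    by unfold_locales (fact assms(2,4,5))+
  show ?thesis
    unfolding P_def
  proof (intro exI[of _ J] conjI ballI allI impI)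
    show "complex_structure X A J" by (rule complex_structure_J)
    show "smooth_polynomial_in X A L J" by (rule smooth_polynomial_J)
    show "Re z < 0" if "p \<in> topspace X" "complex_eigenvalue (tangent_space A p) (J p \<circ> L p) z" for p z
      by (rule J_eigenvalue[OF that])
    show "J p (L p v) = L p (J p v)" if "p \<in> topspace X" "v \<in> tangent_space A p" for p v
      by (rule J_commutes[OF that])
    fix J' p v
    assume J': "complex_structure X A J' \<and> smooth_polynomial_in X A L J' \<and>
        (\<forall>p\<in>topspace X. \<forall>z. complex_eigenvalue (tangent_space A p) (J' p \<circ> L p) z \<longrightarrow> Re z < 0)"
      and p: "p \<in> topspace X" and v: "v \<in> tangent_space A p"
    show "J' p v = J p v"
    proof (rule J_unique[OF _ _ _ p v])
      show "Re z < 0" if "complex_eigenvalue (tangent_space A p) (J' p \<circ> L p) z" for z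
        using J' p that by blast
    qed (use J' in blast)+
  qed
qed

end
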